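(* Let $\zeta \in \mathbb{T}$, and let $\varphi$ be a linear-fractional, non-automorphism self-map of $\mathbb{D}$ that satisfies $\varphi(\zeta) = \zeta$ and $\varphi'(\zeta) \neq 1$. Then the Fredholm index of every Fredholm operator in $C^*(C_{\varphi}, \mathcal{K})$ is $0$.
   Context: $\mathbb{D}$ is the open unit disk and $\mathbb{T}$ the unit circle in $\mathbb{C}$. $H^2(\mathbb{D})$ is the Hardy space of analytic functions $f(z)=\sum_{n\ge 0}a_nz^n$ on $\mathbb{D}$ with $\|f\|^2=\sum|a_n|^2<\infty$; $C_\varphi$ is the composition operator $f\mapsto f\circ\varphi$ on $H^2(\mathbb{D})$; $\mathcal{K}$ is the ideal of compact operators on $H^2(\mathbb{D})$; $C^*(C_\varphi,\mathcal{K})$ is the unital C$^*$-algebra of operators on $H^2(\mathbb{D})$ generated by $C_\varphi$ and $\mathcal{K}$. A linear-fractional self-map of $\mathbb{D}$ is a map $z\mapsto (az+b)/(cz+d)$ taking $\mathbb{D}$ into $\mathbb{D}$; it is a non-automorphism if it is not a bijection of $\mathbb{D}$ onto itself. *)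

theory Defs
  imports "HOL-Complex_Analysis.Complex_Analysis"
begin

section \<open>The Hardy space\<close>

definition taylor_coeff :: "(complex \<Rightarrow> complex) \<Rightarrow> nat \<Rightarrow> complex" where
  "taylor_coeff f n = (deriv ^^ n) f 0 / fact n"

text \<open>
  An element of the Hardy space is a function on the open unit disk; it is represented by its
  extension by zero to the plane, so that equality in the type is equality of functions on the disk.
\<close>

definition hardy_carrier :: "(complex \<Rightarrow> complex) set" where
  "hardy_carrier = {f. f holomorphic_on ball 0 1 \<and> (\<forall>z. z \<notin> ball 0 1 \<longrightarrow> f z = 0) \<and>
     summable (\<lambda>n. (cmod (taylor_coeff f n))\<^sup>2)}"

lemma taylor_coeff_add:
  assumes "f holomorphic_on ball 0 1" "g holomorphic_on ball 0 1"
  shows "taylor_coeff (\<lambda>z. f z + g z) n = taylor_coeff f n + taylor_coeff g n"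
  using higher_deriv_add[OF assms open_ball, of 0 n] by (simp add: taylor_coeff_def add_divide_distrib)

lemma taylor_coeff_cmult:
  assumes "f holomorphic_on ball 0 1"
  shows "taylor_coeff (\<lambda>z. c * f z) n = c * taylor_coeff f n"
  using higher_deriv_cmult[OF assms _ open_ball, of 0 n c] by (simp add: taylor_coeff_def)

lemma taylor_coeff_zero [simp]: "taylor_coeff (\<lambda>z. 0) n = 0"
  by (simp add: taylor_coeff_def)

lemma taylor_coeff_eqI:
  assumes "f holomorphic_on ball 0 1" "g holomorphic_on ball 0 1"
    and "\<And>n. taylor_coeff f n = taylor_coeff g n" and "z \<in> ball 0 1"
  shows "f z = g z"
proof -
  have "(\<lambda>n. taylor_coeff f n * z ^ n) sums f z" "(\<lambda>n. taylor_coeff g n * z ^ n) sums g z"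
    using holomorphic_power_series[OF assms(1,4)] holomorphic_power_series[OF assms(2,4)]
    by (simp_all add: taylor_coeff_def)
  then show ?thesis
    using assms(3) by (simp add: sums_unique2)
qed

lemma zero_in_hardy_carrier: "(\<lambda>z. 0) \<in> hardy_carrier"
  by (simp add: hardy_carrier_def)

lemma summable_sq_add:
  fixes a b :: "nat \<Rightarrow> complex"
  assumes "summable (\<lambda>n. (cmod (a n))\<^sup>2)" "summable (\<lambda>n. (cmod (b n))\<^sup>2)"
  shows "summable (\<lambda>n. (cmod (a n + b n))\<^sup>2)"
proof (rule summable_comparison_test)
  show "summable (\<lambda>n. 2 * (cmod (a n))\<^sup>2 + 2 * (cmod (b n))\<^sup>2)"
    using assms by (intro summable_add summable_mult)
  have "(cmod (a n + b n))\<^sup>2 \<le> 2 * (cmod (a n))\<^sup>2 + 2 * (cmod (b n))\<^sup>2" for n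
  proof -
    have "(cmod (a n + b n))\<^sup>2 \<le> (cmod (a n) + cmod (b n))\<^sup>2"
      by (simp add: norm_triangle_ineq power_mono)
    also have "\<dots> \<le> 2 * (cmod (a n))\<^sup>2 + 2 * (cmod (b n))\<^sup>2"
      using sum_squares_bound[of "cmod (a n)" "cmod (b n)"] by (simp add: power2_sum)
    finally show ?thesis .
  qed
  then show "\<exists>N. \<forall>n\<ge>N. norm ((cmod (a n + b n))\<^sup>2) \<le> 2 * (cmod (a n))\<^sup>2 + 2 * (cmod (b n))\<^sup>2"
    by auto
qed

lemma summable_mult_cnj:
  fixes a b :: "nat \<Rightarrow> complex"
  assumes "summable (\<lambda>n. (cmod (a n))\<^sup>2)" "summable (\<lambda>n. (cmod (b n))\<^sup>2)"
  shows "summable (\<lambda>n. a n * cnj (b n))"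
proof (rule summable_comparison_test)
  show "summable (\<lambda>n. (cmod (a n))\<^sup>2 + (cmod (b n))\<^sup>2)"
    using assms by (rule summable_add)
  have "cmod (a n * cnj (b n)) \<le> (cmod (a n))\<^sup>2 + (cmod (b n))\<^sup>2" for n
  proof -
    have "2 * cmod (a n) * cmod (b n) \<le> (cmod (a n))\<^sup>2 + (cmod (b n))\<^sup>2"
      by (rule sum_squares_bound)
    moreover have "0 \<le> cmod (a n) * cmod (b n)" by simp
    ultimately show ?thesis
      unfolding norm_mult complex_mod_cnj mult.assoc by linarith
  qed
  then show "\<exists>N. \<forall>n\<ge>N. norm (a n * cnj (b n)) \<le> (cmod (a n))\<^sup>2 + (cmod (b n))\<^sup>2"
    by auto
qed

lemma hardy_carrier_add:
  assumes "f \<in> hardy_carrier" "g \<in> hardy_carrier"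
  shows "(\<lambda>z. f z + g z) \<in> hardy_carrier"
  using assms summable_sq_add[of "taylor_coeff f" "taylor_coeff g"]
  by (auto simp: hardy_carrier_def taylor_coeff_add intro!: holomorphic_intros)

lemma hardy_carrier_cmult:
  assumes "f \<in> hardy_carrier"
  shows "(\<lambda>z. c * f z) \<in> hardy_carrier"
  using assms
  by (auto simp: hardy_carrier_def taylor_coeff_cmult norm_mult power_mult_distrib
      intro!: holomorphic_intros summable_mult)

typedef hardy2 = hardy_carrier
  morphisms hval Abs_hardy2
  using zero_in_hardy_carrier by blast

setup_lifting type_definition_hardy2

lemma hval_holomorphic: "hval f holomorphic_on ball 0 1"
  using hval[of f] by (simp add: hardy_carrier_def)

abbreviation hcoeff :: "hardy2 \<Rightarrow> nat \<Rightarrow> complex" where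
  "hcoeff f \<equiv> taylor_coeff (hval f)"

lemma summable_hcoeff: "summable (\<lambda>n. (cmod (hcoeff f n))\<^sup>2)"
  using hval[of f] by (simp add: hardy_carrier_def)

lemma hardy2_eqI:
  assumes "\<And>n. hcoeff f n = hcoeff g n"
  shows "f = g"
proof -
  have "hval f z = hval g z" for z
  proof (cases "z \<in> ball 0 1")
    case True
    then show ?thesis
      using taylor_coeff_eqI[OF hval_holomorphic hval_holomorphic assms] by blast
  next
    case False
    then show ?thesis
      using hval[of f] hval[of g] unfolding hardy_carrier_def by auto
  qed
  then show ?thesis
    by (simp add: hval_inject[symmetric] fun_eq_iff)
qed

lift_definition hscale :: "complex \<Rightarrow> hardy2 \<Rightarrow> hardy2" (infixr "*\<^sub>h" 75)
  is "\<lambda>c f z. c * f z"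
  by (rule hardy_carrier_cmult)

definition hinner :: "hardy2 \<Rightarrow> hardy2 \<Rightarrow> complex" where
  "hinner f g = (\<Sum>n. hcoeff f n * cnj (hcoeff g n))"

lemma summable_hinner: "summable (\<lambda>n. hcoeff f n * cnj (hcoeff g n))"
  by (intro summable_mult_cnj summable_hcoeff)

lemma hcoeff_hscale: "hcoeff (c *\<^sub>h f) n = c * hcoeff f n"
  by (simp add: hscale.rep_eq taylor_coeff_cmult hval_holomorphic)

lemma hinner_self: "hinner f f = of_real (\<Sum>n. (cmod (hcoeff f n))\<^sup>2)"
proof -
  have "hinner f f = (\<Sum>n. of_real ((cmod (hcoeff f n))\<^sup>2))"
    unfolding hinner_def by (simp only: complex_norm_square)
  then show ?thesis
    by (simp only: suminf_of_real[OF summable_hcoeff])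
qed

instantiation hardy2 :: real_inner
begin

lift_definition zero_hardy2 :: hardy2 is "\<lambda>z. 0"
  by (rule zero_in_hardy_carrier)

lift_definition plus_hardy2 :: "hardy2 \<Rightarrow> hardy2 \<Rightarrow> hardy2" is "\<lambda>f g z. f z + g z"
  by (rule hardy_carrier_add)

definition uminus_hardy2 :: "hardy2 \<Rightarrow> hardy2" where
  "uminus_hardy2 f = (- 1) *\<^sub>h f"

definition minus_hardy2 :: "hardy2 \<Rightarrow> hardy2 \<Rightarrow> hardy2" where
  "minus_hardy2 f g = f + (- g)"

definition scaleR_hardy2 :: "real \<Rightarrow> hardy2 \<Rightarrow> hardy2" where
  "scaleR_hardy2 r f = of_real r *\<^sub>h f"

definition inner_hardy2 :: "hardy2 \<Rightarrow> hardy2 \<Rightarrow> real" where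
  "inner_hardy2 f g = Re (hinner f g)"

definition norm_hardy2 :: "hardy2 \<Rightarrow> real" where
  "norm_hardy2 f = sqrt (\<Sum>n. (cmod (hcoeff f n))\<^sup>2)"

definition sgn_hardy2 :: "hardy2 \<Rightarrow> hardy2" where
  "sgn_hardy2 f = inverse (norm f) *\<^sub>R f"

definition dist_hardy2 :: "hardy2 \<Rightarrow> hardy2 \<Rightarrow> real" where
  "dist_hardy2 f g = norm (f - g)"

definition uniformity_hardy2 :: "(hardy2 \<times> hardy2) filter" where
  "uniformity_hardy2 = (INF e\<in>{0<..}. principal {(f, g). dist f g < e})"

definition open_hardy2 :: "hardy2 set \<Rightarrow> bool" where
  "open_hardy2 U = (\<forall>f\<in>U. eventually (\<lambda>(f', g). f' = f \<longrightarrow> g \<in> U) uniformity)"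

instance
proof
  fix f g h :: hardy2 and r s :: real
  have hcoeff_add: "hcoeff (f + g) n = hcoeff f n + hcoeff g n" for f g n
    by (simp add: plus_hardy2.rep_eq taylor_coeff_add hval_holomorphic)
  have hcoeff_zero: "hcoeff 0 n = 0" for n
    by (simp add: zero_hardy2.rep_eq)
  note coeffs = hcoeff_add hcoeff_zero hcoeff_hscale
  show "f + g + h = f + (g + h)" by (rule hardy2_eqI) (simp add: coeffs)
  show "f + g = g + f" by (rule hardy2_eqI) (simp add: coeffs)
  show "0 + f = f" by (rule hardy2_eqI) (simp add: coeffs)
  show "- f + f = 0" by (rule hardy2_eqI) (simp add: coeffs uminus_hardy2_def)
  show "f - g = f + - g" by (simp add: minus_hardy2_def)
  show "r *\<^sub>R (f + g) = r *\<^sub>R f + r *\<^sub>R g"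
    by (rule hardy2_eqI) (simp add: coeffs scaleR_hardy2_def algebra_simps)
  show "(r + s) *\<^sub>R f = r *\<^sub>R f + s *\<^sub>R f"
    by (rule hardy2_eqI) (simp add: coeffs scaleR_hardy2_def algebra_simps)
  show "r *\<^sub>R s *\<^sub>R f = (r * s) *\<^sub>R f"
    by (rule hardy2_eqI) (simp add: coeffs scaleR_hardy2_def)
  show "1 *\<^sub>R f = f"
    by (rule hardy2_eqI) (simp add: coeffs scaleR_hardy2_def)
  show "sgn f = inverse (norm f) *\<^sub>R f" by (rule sgn_hardy2_def)
  show "dist f g = norm (f - g)" by (rule dist_hardy2_def)
  show "(uniformity :: (hardy2 \<times> hardy2) filter) = (INF e\<in>{0<..}. principal {(f, g). dist f g < e})"
    by (rule uniformity_hardy2_def)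
  show "open U = (\<forall>f\<in>U. eventually (\<lambda>(f', g). f' = f \<longrightarrow> g \<in> U) uniformity)" for U :: "hardy2 set"
    by (rule open_hardy2_def)
  have inner_eq: "inner f g = (\<Sum>n. Re (hcoeff f n * cnj (hcoeff g n)))" for f g
    unfolding inner_hardy2_def hinner_def by (rule Re_suminf[OF summable_hinner])
  have sm: "summable (\<lambda>n. Re (hcoeff f n * cnj (hcoeff g n)))" for f g
    by (rule summable_Re[OF summable_hinner])
  show "inner f g = inner g f"
    unfolding inner_eq by (intro suminf_cong) (simp add: algebra_simps)
  show "inner (f + g) h = inner f h + inner g h"
    unfolding inner_eq suminf_add[OF sm sm] by (intro suminf_cong) (simp add: coeffs algebra_simps)
  show "inner (r *\<^sub>R f) g = r * inner f g"
    unfolding inner_eq suminf_mult[OF sm, symmetric]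
    by (intro suminf_cong) (simp add: coeffs scaleR_hardy2_def algebra_simps)
  have self: "inner f f = (\<Sum>n. (cmod (hcoeff f n))\<^sup>2)" for f
    by (simp only: inner_hardy2_def hinner_self Re_complex_of_real)
  show "0 \<le> inner f f"
    unfolding self by (intro suminf_nonneg summable_hcoeff) simp
  have "(inner f f = 0) = (\<forall>n. hcoeff f n = 0)"
    unfolding self by (subst suminf_eq_zero_iff[OF summable_hcoeff]) auto
  also have "\<dots> = (f = 0)"
    using hardy2_eqI[of f 0] hcoeff_zero by auto
  finally show "(inner f f = 0) = (f = 0)" .
  show "norm f = sqrt (inner f f)"
    unfolding self norm_hardy2_def ..
qed

end

lemma hcoeff_add: "hcoeff (f + g) n = hcoeff f n + hcoeff g n"
  by (simp add: plus_hardy2.rep_eq taylor_coeff_add hval_holomorphic)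

interpretation hardy2: vector_space hscale
proof
  fix a b :: complex and f g :: hardy2
  show "a *\<^sub>h (f + g) = a *\<^sub>h f + a *\<^sub>h g"
    by (rule hardy2_eqI) (simp add: hcoeff_add hcoeff_hscale algebra_simps)
  show "(a + b) *\<^sub>h f = a *\<^sub>h f + b *\<^sub>h f"
    by (rule hardy2_eqI) (simp add: hcoeff_add hcoeff_hscale algebra_simps)
  show "a *\<^sub>h b *\<^sub>h f = (a * b) *\<^sub>h f"
    by (rule hardy2_eqI) (simp add: hcoeff_hscale)
  show "1 *\<^sub>h f = f"
    by (rule hardy2_eqI) (simp add: hcoeff_hscale)
qed

lemma norm_hscale: "norm (c *\<^sub>h f) = cmod c * norm f"
  by (simp add: norm_hardy2_def hcoeff_hscale norm_mult power_mult_distrib real_sqrt_mult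
      suminf_mult[OF summable_hcoeff])


section \<open>Operators\<close>

text \<open>
  The type \<^typ>\<open>hardy2 \<Rightarrow>\<^sub>L hardy2\<close> carries the operator norm, but its elements are only
  real-linear; the bounded operators of the Hilbert space are the complex-linear ones.
\<close>

type_synonym hop = "hardy2 \<Rightarrow>\<^sub>L hardy2"

definition bounded_ops :: "hop set" where
  "bounded_ops = {T :: hop. \<forall>c f. T (c *\<^sub>h f) = c *\<^sub>h T f}"

definition compact_ops :: "hop set" where
  "compact_ops = {T \<in> bounded_ops. compact (closure (blinfun_apply T ` cball 0 1))}"

lemma bounded_linear_hscale: "bounded_linear (hscale c)"
proof (rule bounded_linear_intro)
  show "c *\<^sub>h (f + g) = c *\<^sub>h f + c *\<^sub>h g" for f g
    by (rule hardy2.scale_right_distrib)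
  show "c *\<^sub>h (r *\<^sub>R f) = r *\<^sub>R (c *\<^sub>h f)" for r and f :: hardy2
    by (simp add: scaleR_hardy2_def mult.commute)
  show "norm (c *\<^sub>h f) \<le> norm f * cmod c" for f
    by (simp add: norm_hscale)
qed

definition op_scale :: "complex \<Rightarrow> hop \<Rightarrow> hop" where
  "op_scale c T = Blinfun (\<lambda>f. c *\<^sub>h blinfun_apply T f)"

lemma op_scale_apply: "blinfun_apply (op_scale c T) f = c *\<^sub>h blinfun_apply T f"
  by (simp add: op_scale_def bounded_linear_Blinfun_apply
      bounded_linear_compose[OF bounded_linear_hscale blinfun.bounded_linear_right])

definition op_adjoint :: "hop \<Rightarrow> hop" where
  "op_adjoint T = (THE S :: hop. \<forall>f g. hinner (T f) g = hinner f (S g))"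

definition unital_cstar_algebra :: "hop set \<Rightarrow> bool" where
  "unital_cstar_algebra A \<longleftrightarrow>
     A \<subseteq> bounded_ops \<and> id_blinfun \<in> A \<and>
     (\<forall>S\<in>A. \<forall>T\<in>A. S + T \<in> A) \<and> (\<forall>c. \<forall>T\<in>A. op_scale c T \<in> A) \<and>
     (\<forall>S\<in>A. \<forall>T\<in>A. S o\<^sub>L T \<in> A) \<and> (\<forall>T\<in>A. op_adjoint T \<in> A) \<and> closed A"

definition cstar_generated :: "hop set \<Rightarrow> hop set" where
  "cstar_generated X = \<Inter>{A. unital_cstar_algebra A \<and> X \<subseteq> A}"

definition op_kernel :: "hop \<Rightarrow> hardy2 set" where
  "op_kernel T = {f. blinfun_apply T f = 0}"

definition finite_dim :: "hardy2 set \<Rightarrow> bool" where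
  "finite_dim V \<longleftrightarrow> (\<exists>B. finite B \<and> V \<subseteq> hardy2.span B)"

definition fredholm :: "hop \<Rightarrow> bool" where
  "fredholm T \<longleftrightarrow> T \<in> bounded_ops \<and> closed (range (blinfun_apply T)) \<and>
     finite_dim (op_kernel T) \<and> finite_dim (op_kernel (op_adjoint T))"

text \<open>
  Dimensions are over the complex numbers. The range of a Fredholm operator being closed, the kernel
  of the adjoint is its orthogonal complement and has the dimension of the cokernel.
\<close>

definition fredholm_index :: "hop \<Rightarrow> int" where
  "fredholm_index T =
     int (hardy2.dim (op_kernel T)) - int (hardy2.dim (op_kernel (op_adjoint T)))"


section \<open>Composition operators and linear-fractional maps\<close>

text \<open>
  For every holomorphic self-map of the disk this operator exists, by Littlewood's subordination
  theorem; it is unique because an element of the Hardy space vanishes off the disk.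
\<close>

definition composition_op :: "(complex \<Rightarrow> complex) \<Rightarrow> hop" where
  "composition_op \<phi> = (THE C :: hop. \<forall>f. \<forall>z\<in>ball 0 1. hval (C f) z = hval f (\<phi> z))"

text \<open>
  The formula is required on the whole plane, so that values and derivatives at boundary points
  are those of the linear-fractional map.
\<close>

definition linear_fractional_self_map :: "(complex \<Rightarrow> complex) \<Rightarrow> bool" where
  "linear_fractional_self_map \<phi> \<longleftrightarrow>
     (\<exists>a b c d. \<phi> = moebius a b c d \<and> (\<forall>z\<in>ball 0 1. c * z + d \<noteq> 0)) \<and>
     \<phi> ` ball 0 1 \<subseteq> ball 0 1"

definition disk_automorphism :: "(complex \<Rightarrow> complex) \<Rightarrow> bool" where
  "disk_automorphism \<phi> \<longleftrightarrow> bij_betw \<phi> (ball 0 1) (ball 0 1)"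

end

theory Submission
  imports Defs
begin

text \<open>
  Map the disk to the right half-plane so that the fixed point \<open>\<zeta>\<close> goes to infinity. The map
  \<open>\<phi>\<close> becomes \<open>w \<mapsto> \<mu> w + A\<close> with \<open>\<mu> = 1 / \<phi>' \<zeta>\<close>, where \<open>\<mu> > 0\<close> because the half-plane
  is preserved, and \<open>Re A > 0\<close> because \<open>\<phi>\<close> is not an automorphism. Since \<open>\<mu> \<noteq> 1\<close>, a vertical
  translation makes \<open>A\<close> real (lemma \<open>half_plane_normal_form\<close>). On the Hardy space of the half-plane,
  which the Laplace transform identifies with the square-integrable functions of \<open>t > 0\<close>, composition
  with this map is, up to a scalar, multiplication by an exponential function of \<open>t\<close> together with the
  dilation of \<open>t\<close> by \<open>\<mu>\<close>. The passage from the disk to the half-plane changes the operator by a weight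
  tending to a constant at \<open>\<zeta>\<close>; as \<open>\<phi>\<close> touches the circle only there, a nonzero multiple of the
  half-plane operator differs from the composition operator by a Hilbert--Schmidt operator (lemma
  \<open>weighted_composition_compact\<close>).

  Multiplication by the unimodular function \<open>t powr (\<i> * \<beta>)\<close> commutes with every multiplication
  operator, and with the dilation as soon as \<open>\<beta> * ln \<mu>\<close> is a multiple of \<open>2 * pi\<close>. Hence the
  half-plane operator commutes with an infinite sequence of unitaries, and these tend weakly to zero
  (lemma \<open>affine_model\<close>). The proof never leaves the disk: all these operators are determined by their
  action on the Cauchy kernels \<open>1 / (w + b)\<close>, \<open>b > 0\<close>, which form a total family; the imaginary power
  sends \<open>1 / (w + b)\<close> to a multiple of \<open>(w + b) powr (- 1 - \<i> * \<beta>)\<close>.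

  The rest is operator theory. The operators of the form \<open>X + K\<close>, with \<open>X\<close> and its adjoint commuting
  with weakly null unitaries \<open>U n\<close> and \<open>K\<close> compact, form a unital C*-algebra: it is closed because the
  unitaries displace every vector to where \<open>K\<close> is negligible, so that \<open>\<parallel>X\<parallel> \<le> \<parallel>X + K\<parallel>\<close>. It contains
  the composition operator and the compact operators, hence the algebra generated by them. If
  \<open>X + K\<close> is Fredholm, the same displacement turns its lower bounds modulo compact operators into true
  lower bounds for \<open>X\<close> and its adjoint. So \<open>X\<close> is invertible, and an invertible operator plus a
  compact one has index zero (lemma \<open>fredholm_index_essential_commutant\<close>).
\<close>

section \<open>The Hardy space as a complex Hilbert space\<close>

lemma hcoeff_zero [simp]: "hcoeff 0 n = 0"
  by (simp add: zero_hardy2.rep_eq)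

lemma hcoeff_minus: "hcoeff (- f) n = - hcoeff f n"
  unfolding uminus_hardy2_def hcoeff_hscale by simp

lemma hcoeff_diff: "hcoeff (f - g) n = hcoeff f n - hcoeff g n"
  unfolding minus_hardy2_def hcoeff_add hcoeff_minus by simp

lemma hcoeff_sum: "hcoeff (sum F A) n = (\<Sum>i\<in>A. hcoeff (F i) n)"
  by (induction A rule: infinite_finite_induct) (auto simp: hcoeff_add)

lemma hscale_of_real: "of_real r *\<^sub>h f = r *\<^sub>R f"
  by (simp add: scaleR_hardy2_def)

lemma hval_eq_0: "z \<notin> ball 0 1 \<Longrightarrow> hval f z = 0"
  using hval[of f] by (simp add: hardy_carrier_def)

lemma hval_add: "hval (f + g) z = hval f z + hval g z"
  by (simp add: plus_hardy2.rep_eq)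

lemma hval_hscale: "hval (c *\<^sub>h f) z = c * hval f z"
  by (simp add: hscale.rep_eq)

lemma hval_zero [simp]: "hval 0 z = 0"
  by (simp add: zero_hardy2.rep_eq)

lemma hval_sums: "z \<in> ball 0 1 \<Longrightarrow> (\<lambda>n. hcoeff f n * z ^ n) sums hval f z"
  using holomorphic_power_series[OF hval_holomorphic[of f], of z] by (simp add: taylor_coeff_def)

lemma hardy2_eq_iff_on_disk: "(\<And>z. z \<in> ball 0 1 \<Longrightarrow> hval f z = hval g z) \<Longrightarrow> f = g"
  by (metis hval_eq_0 hval_inject ext)

lemma norm_sq_sums: "(\<lambda>n. (cmod (hcoeff f n))\<^sup>2) sums (norm f)\<^sup>2"
proof -
  have "(norm f)\<^sup>2 = (\<Sum>n. (cmod (hcoeff f n))\<^sup>2)"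
    unfolding norm_hardy2_def by (intro real_sqrt_pow2 suminf_nonneg summable_hcoeff) simp
  then show ?thesis using summable_sums[OF summable_hcoeff[of f]] by simp
qed

lemma sum_hcoeff_le_norm: "finite A \<Longrightarrow> (\<Sum>n\<in>A. (cmod (hcoeff f n))\<^sup>2) \<le> (norm f)\<^sup>2"
  using sum_le_suminf[OF summable_hcoeff, of A f] norm_sq_sums[of f] by (simp add: sums_iff)

lemma cmod_hcoeff_le: "cmod (hcoeff f n) \<le> norm f"
  using sum_hcoeff_le_norm[of "{n}" f] by (simp add: power2_le_iff_abs_le)

text \<open>Power series with square-summable coefficients converge on the disk by comparison
  with a geometric series, since their coefficients are bounded.\<close>

lemma hardy2_of_coeffs:
  assumes "summable (\<lambda>n. (cmod (a n))\<^sup>2)"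
  obtains f where "\<And>n. hcoeff f n = a n"
proof -
  have "(\<lambda>n. (cmod (a n))\<^sup>2) \<longlonglongrightarrow> 0" by (rule summable_LIMSEQ_zero[OF assms])
  then have "(\<lambda>n. sqrt ((cmod (a n))\<^sup>2)) \<longlonglongrightarrow> sqrt 0" by (intro tendsto_real_sqrt)
  then have "a \<longlonglongrightarrow> 0" by (simp add: tendsto_norm_zero_iff)
  then have "Bseq a" using convergentI convergent_imp_Bseq by blast
  then obtain K where K: "\<And>n. cmod (a n) \<le> K" by (auto simp: Bseq_def)
  define F where "F = Abs_fps a"
  have "summable (\<lambda>n. a n * z ^ n)" if "cmod z < 1" for z
  proof (rule summable_comparison_test)
    show "summable (\<lambda>n. K * cmod z ^ n)" using that by (intro summable_mult summable_geometric) auto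
    show "\<exists>N. \<forall>n\<ge>N. norm (a n * z ^ n) \<le> K * cmod z ^ n"
      by (auto simp: norm_mult norm_power intro!: mult_right_mono K)
  qed
  then have "conv_radius a \<ge> 1"
    by (intro conv_radius_geI_ex') (auto)
  then have rad: "fps_conv_radius F \<ge> 1" by (simp add: F_def fps_conv_radius_def)
  define g where "g z = (if z \<in> ball 0 1 then eval_fps F z else 0)" for z
  have hol: "eval_fps F holomorphic_on ball 0 1"
    using rad by (intro holomorphic_on_eval_fps) (auto simp: eball_def dual_order.strict_trans1)
  have "(deriv ^^ n) g 0 = (deriv ^^ n) (eval_fps F) 0" for n
  proof (rule higher_deriv_cong_ev)
    show "\<forall>\<^sub>F x in nhds 0. g x = eval_fps F x"
      using eventually_nhds_in_open[of "ball 0 1" "0::complex"]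
      by (auto simp: g_def elim!: eventually_mono)
  qed simp
  moreover have "fps_nth F n = (deriv ^^ n) (eval_fps F) 0 / fact n" for n
    using rad by (intro fps_nth_conv_deriv) (auto simp: dual_order.strict_trans1)
  ultimately have co: "taylor_coeff g n = a n" for n
    by (simp add: taylor_coeff_def F_def)
  have "g holomorphic_on ball 0 1"
    using hol by (rule holomorphic_transform) (simp add: g_def)
  then have "g \<in> hardy_carrier" using assms by (auto simp: hardy_carrier_def co g_def)
  then have "hcoeff (Abs_hardy2 g) n = a n" for n by (simp add: Abs_hardy2_inverse co)
  then show ?thesis by (rule that)
qed

lemma hinner_add_left: "hinner (f + g) h = hinner f h + hinner g h"
  unfolding hinner_def
  by (subst suminf_add[OF summable_hinner summable_hinner]) (simp add: hcoeff_add algebra_simps)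

lemma hinner_hscale_left: "hinner (c *\<^sub>h f) h = c * hinner f h"
  unfolding hinner_def
  by (subst suminf_mult[OF summable_hinner, symmetric]) (simp add: hcoeff_hscale algebra_simps)

lemma hinner_commute: "hinner f g = cnj (hinner g f)"
proof -
  have "(\<lambda>n. cnj (hcoeff g n * cnj (hcoeff f n))) sums cnj (hinner g f)"
    unfolding sums_cnj hinner_def by (rule summable_sums[OF summable_hinner])
  moreover have "(\<lambda>n. cnj (hcoeff g n * cnj (hcoeff f n))) = (\<lambda>n. hcoeff f n * cnj (hcoeff g n))"
    by (simp add: fun_eq_iff mult.commute)
  ultimately have "(\<lambda>n. hcoeff f n * cnj (hcoeff g n)) sums cnj (hinner g f)" by simp
  moreover have "(\<lambda>n. hcoeff f n * cnj (hcoeff g n)) sums hinner f g"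
    unfolding hinner_def by (rule summable_sums[OF summable_hinner])
  ultimately show ?thesis by (rule sums_unique2[symmetric])
qed

lemma hinner_add_right: "hinner h (f + g) = hinner h f + hinner h g"
  using arg_cong[OF hinner_add_left[of f g h], of cnj] by (simp add: hinner_commute[symmetric])

lemma hinner_hscale_right: "hinner h (c *\<^sub>h f) = cnj c * hinner h f"
  using arg_cong[OF hinner_hscale_left[of c f h], of cnj] by (simp add: hinner_commute[symmetric])

lemma hinner_zero_left [simp]: "hinner 0 f = 0"
  by (simp add: hinner_def)

lemma hinner_zero_right [simp]: "hinner f 0 = 0"
  by (simp add: hinner_def)

lemma hinner_minus_left: "hinner (- f) h = - hinner f h"
  unfolding uminus_hardy2_def hinner_hscale_left by simp

lemma hinner_minus_right: "hinner h (- f) = - hinner h f"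
  unfolding uminus_hardy2_def hinner_hscale_right by simp

lemma hinner_diff_left: "hinner (f - g) h = hinner f h - hinner g h"
  unfolding minus_hardy2_def hinner_add_left hinner_minus_left by simp

lemma hinner_diff_right: "hinner h (f - g) = hinner h f - hinner h g"
  unfolding minus_hardy2_def hinner_add_right hinner_minus_right by simp

lemma hinner_sum_left: "hinner (sum F A) h = (\<Sum>i\<in>A. hinner (F i) h)"
  by (induction A rule: infinite_finite_induct) (auto simp: hinner_add_left)

lemma hinner_sum_right: "hinner h (sum F A) = (\<Sum>i\<in>A. hinner h (F i))"
  by (induction A rule: infinite_finite_induct) (auto simp: hinner_add_right)

lemma hinner_self_norm: "hinner f f = of_real ((norm f)\<^sup>2)"
  using norm_sq_sums[of f] by (simp add: hinner_self sums_iff)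

lemma hinner_self_eq_0 [simp]: "hinner f f = 0 \<longleftrightarrow> f = 0"
  by (simp add: hinner_self_norm)

lemma inner_hardy2: "inner f g = Re (hinner f g)"
  by (rule inner_hardy2_def)

text \<open>The complex Cauchy--Schwarz inequality follows from the real one after rotating the first
  argument so that the complex inner product becomes its modulus.\<close>

lemma cmod_hinner_le: "cmod (hinner f g) \<le> norm f * norm g"
proof -
  define c where "c = (if hinner f g = 0 then 1 else cnj (sgn (hinner f g)))"
  have c: "cmod c = 1" "c * hinner f g = of_real (cmod (hinner f g))"
    unfolding c_def
    by (auto simp: norm_sgn sgn_eq norm_divide mult.commute[of "cnj _"] complex_norm_square[symmetric] power2_eq_square)
  have "cmod (hinner f g) = inner (c *\<^sub>h f) g"
    by (simp add: inner_hardy2 hinner_hscale_left c)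
  also have "\<dots> \<le> norm (c *\<^sub>h f) * norm g" by (rule norm_cauchy_schwarz)
  finally show ?thesis by (simp add: norm_hscale c)
qed

lemma bounded_linear_hinner_left: "bounded_linear (\<lambda>f. hinner f g)"
proof (rule bounded_linear_intro)
  show "hinner (r *\<^sub>R f) g = r *\<^sub>R hinner f g" for r and f :: hardy2
    by (simp add: hscale_of_real[symmetric] hinner_hscale_left scaleR_conv_of_real)
  show "norm (hinner f g) \<le> norm f * norm g" for f by (rule cmod_hinner_le)
qed (rule hinner_add_left)

lemmas tendsto_hinner_left = bounded_linear.tendsto[OF bounded_linear_hinner_left]
lemmas tendsto_hscale = bounded_linear.tendsto[OF bounded_linear_hscale]

lemma hinner_ext: "(\<And>g. hinner f g = hinner f' g) \<Longrightarrow> f = f'"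
  using hinner_self_eq_0[of "f - f'"] by (simp add: hinner_diff_left del: hinner_self_eq_0)

lemma hinner_ext_right: "(\<And>g. hinner g f = hinner g f') \<Longrightarrow> f = f'"
  using hinner_self_eq_0[of "f - f'"] by (simp add: hinner_diff_right del: hinner_self_eq_0)

lemma norm_le_if_coeffs:
  assumes "\<And>N. (\<Sum>n<N. (cmod (hcoeff f n))\<^sup>2) \<le> B\<^sup>2" "0 \<le> B"
  shows "norm f \<le> B"
proof -
  have "(norm f)\<^sup>2 \<le> B\<^sup>2"
    using norm_sq_sums[of f] assms(1) suminf_le_const[OF summable_hcoeff, of f "B\<^sup>2"] by (simp add: sums_iff)
  then show ?thesis using assms(2) by (simp add: power2_le_iff_abs_le)
qed

instance hardy2 :: complete_space
proof
  fix X :: "nat \<Rightarrow> hardy2"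
  assume C: "Cauchy X"
  have "Cauchy (\<lambda>k. hcoeff (X k) n)" for n
  proof (rule CauchyI)
    fix e :: real assume "0 < e"
    then obtain M where M: "\<And>m n. m \<ge> M \<Longrightarrow> n \<ge> M \<Longrightarrow> norm (X m - X n) < e"
      using C CauchyD by blast
    show "\<exists>M. \<forall>k\<ge>M. \<forall>l\<ge>M. norm (hcoeff (X k) n - hcoeff (X l) n) < e"
    proof (intro exI[of _ M] allI impI)
      fix k l assume "M \<le> k" "M \<le> l"
      then show "norm (hcoeff (X k) n - hcoeff (X l) n) < e"
        using M[of k l] cmod_hcoeff_le[of "X k - X l" n] by (simp add: hcoeff_diff)
    qed
  qed
  then have "\<exists>a. (\<lambda>k. hcoeff (X k) n) \<longlonglongrightarrow> a" for n
    by (meson Cauchy_convergent convergent_def)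
  then obtain a where a: "\<And>n. (\<lambda>k. hcoeff (X k) n) \<longlonglongrightarrow> a n" by metis
  have far: "(\<Sum>n<N. (cmod (hcoeff (X k) n - a n))\<^sup>2) \<le> e\<^sup>2"
    if "\<And>l. l \<ge> M \<Longrightarrow> norm (X k - X l) \<le> e" for N k e M
  proof (rule LIMSEQ_le_const2)
    show "(\<lambda>l. \<Sum>n<N. (cmod (hcoeff (X k) n - hcoeff (X l) n))\<^sup>2)
        \<longlonglongrightarrow> (\<Sum>n<N. (cmod (hcoeff (X k) n - a n))\<^sup>2)"
      by (intro tendsto_intros a)
    have "(\<Sum>n<N. (cmod (hcoeff (X k) n - hcoeff (X l) n))\<^sup>2) \<le> e\<^sup>2" if "l \<ge> M" for l
    proof -
      have "(\<Sum>n<N. (cmod (hcoeff (X k) n - hcoeff (X l) n))\<^sup>2) \<le> (norm (X k - X l))\<^sup>2"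
        using sum_hcoeff_le_norm[of "{..<N}" "X k - X l"] by (simp add: hcoeff_diff)
      also have "\<dots> \<le> e\<^sup>2" using \<open>\<And>l. l \<ge> M \<Longrightarrow> norm (X k - X l) \<le> e\<close> that by (simp add: power_mono)
      finally show ?thesis .
    qed
    then show "\<exists>M. \<forall>l\<ge>M. (\<Sum>n<N. (cmod (hcoeff (X k) n - hcoeff (X l) n))\<^sup>2) \<le> e\<^sup>2" by blast
  qed
  obtain M where M: "\<And>m n. m \<ge> M \<Longrightarrow> n \<ge> M \<Longrightarrow> norm (X m - X n) < 1"
    using C CauchyD[of X 1] by auto
  have "summable (\<lambda>n. (cmod (a n - hcoeff (X M) n))\<^sup>2)"
  proof (rule bounded_imp_summable)
    show "(\<Sum>n\<le>N. (cmod (a n - hcoeff (X M) n))\<^sup>2) \<le> 1" for N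
      using far[of M M 1 "Suc N"] M by (simp add: lessThan_Suc_atMost norm_minus_commute less_imp_le)
  qed simp
  from summable_sq_add[OF this summable_hcoeff[of "X M"]]
  have "summable (\<lambda>n. (cmod (a n))\<^sup>2)" by simp
  then obtain f where f: "\<And>n. hcoeff f n = a n" by (rule hardy2_of_coeffs) blast
  have "X \<longlonglongrightarrow> f"
  proof (rule LIMSEQ_I)
    fix e :: real assume "0 < e"
    then obtain M where M: "\<And>m n. m \<ge> M \<Longrightarrow> n \<ge> M \<Longrightarrow> norm (X m - X n) < e / 2"
      using C CauchyD[of X "e/2"] by auto
    have "norm (X k - f) \<le> e / 2" if "k \<ge> M" for k
    proof (rule norm_le_if_coeffs)
      show "(\<Sum>n<N. (cmod (hcoeff (X k - f) n))\<^sup>2) \<le> (e/2)\<^sup>2" for N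
        using far[of M k "e/2" N] M[OF that] by (simp add: hcoeff_diff f less_imp_le)
    qed (use \<open>0 < e\<close> in simp)
    then show "\<exists>no. \<forall>n\<ge>no. norm (X n - f) < e" using \<open>0 < e\<close> by (intro exI[of _ M]) fastforce
  qed
  then show "convergent X" by (auto simp: convergent_def)
qed

instance hardy2 :: banach ..

section \<open>Orthogonal projection onto closed subspaces\<close>

lemma subspace_diff: "hardy2.subspace V \<Longrightarrow> f \<in> V \<Longrightarrow> g \<in> V \<Longrightarrow> f - g \<in> V"
  by (rule hardy2.subspace_diff)

lemma subspace_scaleR: "hardy2.subspace V \<Longrightarrow> f \<in> V \<Longrightarrow> r *\<^sub>R f \<in> V"
  using hardy2.subspace_scale[of V f "of_real r"] by (simp add: hscale_of_real)

text \<open>Completeness enters through a minimising sequence for the distance, which is Cauchy by the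
  parallelogram law.\<close>

lemma exists_nearest_point:
  assumes V: "hardy2.subspace V" "closed V"
  obtains p where "p \<in> V" "\<And>v. v \<in> V \<Longrightarrow> norm (f - p) \<le> norm (f - v)"
proof -
  define d where "d = Inf ((\<lambda>v. norm (f - v)) ` V)"
  have 0: "0 \<in> V" using V(1) by (rule hardy2.subspace_0)
  have bdd: "bdd_below ((\<lambda>v. norm (f - v)) ` V)" by (rule bdd_belowI[of _ 0]) auto
  have d: "d \<le> norm (f - v)" if "v \<in> V" for v
    unfolding d_def using that bdd by (intro cInf_lower) auto
  have d0: "0 \<le> d" unfolding d_def using 0 by (intro cInf_greatest) auto
  have "\<exists>v\<in>V. norm (f - v) < d + 1 / real (Suc n)" for n
    using cInf_lessD[of "(\<lambda>v. norm (f - v)) ` V" "d + 1 / real (Suc n)"] 0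
    by (fastforce simp: d_def)
  then obtain v where v: "\<And>n. v n \<in> V" "\<And>n. norm (f - v n) < d + 1 / real (Suc n)" by metis
  have near: "(\<lambda>n. norm (f - v n)) \<longlonglongrightarrow> d"
  proof (rule tendsto_sandwich[of "\<lambda>_. d" _ _ "\<lambda>n. d + 1 / real (Suc n)"])
    show "(\<lambda>n. d + 1 / real (Suc n)) \<longlonglongrightarrow> d"
      using tendsto_add[OF tendsto_const[of d] LIMSEQ_Suc[OF lim_1_over_n]] by simp
    show "\<forall>\<^sub>F n in sequentially. d \<le> norm (f - v n)" using d v(1) by simp
    show "\<forall>\<^sub>F n in sequentially. norm (f - v n) \<le> d + 1 / real (Suc n)"
      using v(2) by (simp add: less_imp_le)
  qed simp
  have para: "(norm (v m - v n))\<^sup>2 \<le> 2 * (norm (f - v m))\<^sup>2 + 2 * (norm (f - v n))\<^sup>2 - 4 * d\<^sup>2" for m n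
  proof -
    have "(1/2) *\<^sub>R (v m + v n) \<in> V"
      using v(1) V(1) by (intro subspace_scaleR hardy2.subspace_add)
    from d[OF this] have "2 * d \<le> norm (2 *\<^sub>R (f - (1/2) *\<^sub>R (v m + v n)))" by simp
    also have "2 *\<^sub>R (f - (1/2) *\<^sub>R (v m + v n)) = (f - v m) + (f - v n)"
      by (simp add: algebra_simps scaleR_2)
    finally have "(2 * d)\<^sup>2 \<le> (norm ((f - v m) + (f - v n)))\<^sup>2"
      using d0 by (intro power_mono) auto
    moreover have "(norm ((f - v m) + (f - v n)))\<^sup>2 + (norm ((f - v n) - (f - v m)))\<^sup>2
        = 2 * (norm (f - v m))\<^sup>2 + 2 * (norm (f - v n))\<^sup>2"
      by (simp add: power2_norm_eq_inner inner_add_left inner_add_right inner_diff_left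
          inner_diff_right inner_commute)
    ultimately show ?thesis by (simp add: power_mult_distrib)
  qed
  have "Cauchy v"
  proof (rule CauchyI)
    fix e :: real assume e: "0 < e"
    have "(\<lambda>n. 2 * (norm (f - v n))\<^sup>2) \<longlonglongrightarrow> 2 * d\<^sup>2" by (intro tendsto_intros near)
    then have "\<forall>\<^sub>F n in sequentially. 2 * (norm (f - v n))\<^sup>2 < 2 * d\<^sup>2 + e\<^sup>2 / 2"
      by (rule order_tendstoD) (use e in simp)
    then obtain M where M: "\<And>n. n \<ge> M \<Longrightarrow> 2 * (norm (f - v n))\<^sup>2 < 2 * d\<^sup>2 + e\<^sup>2 / 2"
      by (auto simp: eventually_sequentially)
    have "norm (v m - v n) < e" if "m \<ge> M" "n \<ge> M" for m n
    proof -
      have "(norm (v m - v n))\<^sup>2 < e\<^sup>2" using para[of m n] M[OF that(1)] M[OF that(2)] by simp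
      then show ?thesis using e by (simp add: power_less_imp_less_base)
    qed
    then show "\<exists>M. \<forall>m\<ge>M. \<forall>n\<ge>M. norm (v m - v n) < e" by blast
  qed
  then obtain p where p: "v \<longlonglongrightarrow> p" using Cauchy_convergent convergent_def by blast
  have "p \<in> V" using closed_sequentially[OF V(2)] v(1) p by blast
  moreover have "(\<lambda>n. norm (f - v n)) \<longlonglongrightarrow> norm (f - p)" by (intro tendsto_intros p)
  then have "norm (f - p) = d" using near LIMSEQ_unique by blast
  ultimately show ?thesis using d that by simp
qed

lemma projection_theorem:
  assumes V: "hardy2.subspace V" "closed V"
  obtains p where "p \<in> V" "\<And>v. v \<in> V \<Longrightarrow> hinner (f - p) v = 0"
proof -
  obtain p where p: "p \<in> V" and near: "\<And>v. v \<in> V \<Longrightarrow> norm (f - p) \<le> norm (f - v)"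
    using exists_nearest_point[OF V] by blast
  have "hinner (f - p) v = 0" if v: "v \<in> V" for v
  proof (cases "v = 0")
    case False
    \<comment> \<open>Moving from p by the component of f - p along v would bring it closer to f.\<close>
    define c where "c = hinner (f - p) v / of_real ((norm v)\<^sup>2)"
    have nv: "(norm v)\<^sup>2 > 0" using False by simp
    have "p + c *\<^sub>h v \<in> V" using v p V(1) by (intro hardy2.subspace_add hardy2.subspace_scale)
    from near[OF this] have "(norm (f - p))\<^sup>2 \<le> (norm (f - p - c *\<^sub>h v))\<^sup>2"
      by (intro power_mono) (simp_all add: algebra_simps)
    also have "of_real ((norm (f - p - c *\<^sub>h v))\<^sup>2) = hinner (f - p - c *\<^sub>h v) (f - p - c *\<^sub>h v)"
      by (simp add: hinner_self_norm)
    then have "(norm (f - p - c *\<^sub>h v))\<^sup>2 = Re (hinner (f - p - c *\<^sub>h v) (f - p - c *\<^sub>h v))"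
      by (metis Re_complex_of_real)
    also have "hinner (f - p - c *\<^sub>h v) (f - p - c *\<^sub>h v)
        = hinner (f - p) (f - p) - cnj c * hinner (f - p) v - c * hinner v (f - p)
          + c * cnj c * hinner v v"
      by (simp only: hinner_diff_left hinner_diff_right hinner_hscale_left hinner_hscale_right)
         (simp add: algebra_simps)
    also have "hinner v (f - p) = cnj (hinner (f - p) v)" by (rule hinner_commute)
    also have "hinner (f - p) v = c * of_real ((norm v)\<^sup>2)" using nv by (simp add: c_def)
    also have "hinner (f - p) (f - p) - cnj c * (c * of_real ((norm v)\<^sup>2))
        - c * cnj (c * of_real ((norm v)\<^sup>2)) + c * cnj c * hinner v v
        = of_real ((norm (f - p))\<^sup>2) - (c * cnj c) * of_real ((norm v)\<^sup>2)"
      by (simp add: hinner_self_norm algebra_simps)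
    also have "\<dots> = of_real ((norm (f - p))\<^sup>2 - (cmod c)\<^sup>2 * (norm v)\<^sup>2)"
      by (simp only: complex_norm_square[symmetric] of_real_mult of_real_diff)
    also have "Re \<dots> = (norm (f - p))\<^sup>2 - (cmod c)\<^sup>2 * (norm v)\<^sup>2" by (rule Re_complex_of_real)
    finally have "(cmod c)\<^sup>2 * (norm v)\<^sup>2 \<le> 0" by linarith
    then have "c = 0" using nv by (simp add: mult_le_0_iff)
    then show ?thesis using nv by (simp add: c_def)
  qed simp
  with p show ?thesis by (rule that)
qed

lemma closed_subspace_eq_UNIV:
  assumes "hardy2.subspace V" "closed V" "\<And>f. (\<And>v. v \<in> V \<Longrightarrow> hinner f v = 0) \<Longrightarrow> f = 0"
  shows "V = UNIV"
  using projection_theorem[OF assms(1,2)] assms(3) by (metis UNIV_eq_I eq_iff_diff_eq_0)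

section \<open>Bounded operators and their adjoints\<close>

lemma bounded_opsD: "T \<in> bounded_ops \<Longrightarrow> T (c *\<^sub>h f) = c *\<^sub>h T f"
  by (simp add: bounded_ops_def)

lemma bounded_op_exists:
  assumes "\<And>f g. F (f + g) = F f + F g" "\<And>c f. F (c *\<^sub>h f) = c *\<^sub>h F f"
    "\<And>f. norm (F f) \<le> M * norm f"
  obtains T :: hop where "T \<in> bounded_ops" "\<And>f. T f = F f" "0 \<le> M \<Longrightarrow> norm T \<le> M"
proof -
  have lin: "bounded_linear F"
  proof (rule bounded_linear_intro)
    show "F (r *\<^sub>R f) = r *\<^sub>R F f" for r f using assms(2)[of "of_real r" f] by (simp add: hscale_of_real)
    show "norm (F f) \<le> norm f * M" for f using assms(3)[of f] by (simp add: mult.commute)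
  qed (rule assms)
  have "blinfun_apply (Blinfun F) = F" by (rule bounded_linear_Blinfun_apply[OF lin])
  then show ?thesis
    by (intro that[of "Blinfun F"]) (auto simp: bounded_ops_def assms intro!: norm_blinfun_bound)
qed

lemma id_in_bounded_ops [simp]: "id_blinfun \<in> bounded_ops"
  by (simp add: bounded_ops_def)

lemma compose_in_bounded_ops: "S \<in> bounded_ops \<Longrightarrow> T \<in> bounded_ops \<Longrightarrow> S o\<^sub>L T \<in> bounded_ops"
  by (simp add: bounded_ops_def)

lemma add_in_bounded_ops: "S \<in> bounded_ops \<Longrightarrow> T \<in> bounded_ops \<Longrightarrow> S + T \<in> bounded_ops"
  by (simp add: bounded_ops_def blinfun.add_left hardy2.scale_right_distrib)

lemma op_scale_in_bounded_ops: "T \<in> bounded_ops \<Longrightarrow> op_scale c T \<in> bounded_ops"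
  by (simp add: bounded_ops_def op_scale_apply mult.commute)

lemma minus_op_conv_scale: "S - T = S + op_scale (-1) T"
  by (rule blinfun_eqI) (simp add: op_scale_apply blinfun.diff_left blinfun.add_left)

lemma diff_in_bounded_ops: "S \<in> bounded_ops \<Longrightarrow> T \<in> bounded_ops \<Longrightarrow> S - T \<in> bounded_ops"
  by (simp add: minus_op_conv_scale add_in_bounded_ops op_scale_in_bounded_ops)

lemma blinfun_tendsto_apply:
  fixes T :: "nat \<Rightarrow> hop"
  shows "T \<longlonglongrightarrow> S \<Longrightarrow> (\<lambda>n. T n f) \<longlonglongrightarrow> S f"
  by (intro tendsto_intros)

lemma closed_sequentiallyI:
  fixes S :: "'a::metric_space set"
  assumes "\<And>x l. (\<And>n. x n \<in> S) \<Longrightarrow> x \<longlonglongrightarrow> l \<Longrightarrow> l \<in> S"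
  shows "closed S"
  using assms unfolding closed_sequential_limits by blast

lemma closed_bounded_ops: "closed bounded_ops"
proof (rule closed_sequentiallyI)
  fix T :: "nat \<Rightarrow> hop" and S
  assume T: "\<And>n. T n \<in> bounded_ops" and lim: "T \<longlonglongrightarrow> S"
  have "S (c *\<^sub>h f) = c *\<^sub>h S f" for c f
  proof (rule LIMSEQ_unique)
    show "(\<lambda>n. T n (c *\<^sub>h f)) \<longlonglongrightarrow> S (c *\<^sub>h f)" by (rule blinfun_tendsto_apply[OF lim])
    show "(\<lambda>n. T n (c *\<^sub>h f)) \<longlonglongrightarrow> c *\<^sub>h S f"
      using tendsto_hscale[OF blinfun_tendsto_apply[OF lim], of c f] by (simp add: bounded_opsD[OF T])
  qed
  then show "S \<in> bounded_ops" by (simp add: bounded_ops_def)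
qed

text \<open>The monomials form an orthonormal basis.\<close>

lemma monomials:
  obtains e where "\<And>n k. hcoeff (e n) k = (if k = n then 1 else 0)"
proof -
  have "\<exists>e. \<forall>k. hcoeff e k = (if k = n then 1 else 0)" for n
  proof (rule hardy2_of_coeffs[of "\<lambda>k. if k = n then 1 else 0"])
    show "summable (\<lambda>k. (cmod (if k = n then 1 else 0))\<^sup>2)"
      by (rule summable_finite[of "{n}"]) auto
  qed blast
  then show ?thesis using that by metis
qed

lemma monomial_expansion:
  assumes e: "\<And>n k. hcoeff (e n) k = (if k = n then 1 else 0)"
  shows "(\<lambda>N. \<Sum>n<N. hcoeff f n *\<^sub>h e n) \<longlonglongrightarrow> f"
proof (rule Lim_null_comparison[THEN LIM_zero_cancel])
  define s where "s N = (\<Sum>n<N. (cmod (hcoeff f n))\<^sup>2)" for N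
  have "(\<lambda>N. (norm f)\<^sup>2 - s N) \<longlonglongrightarrow> (norm f)\<^sup>2 - (norm f)\<^sup>2"
    using norm_sq_sums[of f] unfolding s_def by (intro tendsto_intros) (simp add: sums_def)
  from tendsto_real_sqrt[OF this] show "(\<lambda>N. sqrt ((norm f)\<^sup>2 - s N)) \<longlonglongrightarrow> 0" by simp
  have "norm ((\<Sum>n<N. hcoeff f n *\<^sub>h e n) - f) \<le> sqrt ((norm f)\<^sup>2 - s N)" for N
  proof (rule norm_le_if_coeffs)
    have nn: "s N \<le> (norm f)\<^sup>2" unfolding s_def by (rule sum_hcoeff_le_norm) simp
    then show "0 \<le> sqrt ((norm f)\<^sup>2 - s N)" by simp
    fix M
    have c: "hcoeff ((\<Sum>n<N. hcoeff f n *\<^sub>h e n) - f) k = (if k < N then 0 else - hcoeff f k)" for k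
      by (auto simp: hcoeff_sum hcoeff_diff hcoeff_hscale e if_distrib[of "\<lambda>x. _ * x"] cong: if_cong)
    have "(\<Sum>k<M. (cmod (hcoeff ((\<Sum>n<N. hcoeff f n *\<^sub>h e n) - f) k))\<^sup>2)
        = (\<Sum>k\<in>{..<M} - {..<N}. (cmod (hcoeff f k))\<^sup>2)"
      unfolding c by (intro sum.mono_neutral_cong_right) auto
    also have "\<dots> = (\<Sum>k\<in>({..<M} - {..<N}) \<union> {..<N}. (cmod (hcoeff f k))\<^sup>2) - s N"
      unfolding s_def by (subst sum.union_disjoint) auto
    also have "\<dots> \<le> (norm f)\<^sup>2 - s N"
      using sum_hcoeff_le_norm[of "({..<M} - {..<N}) \<union> {..<N}" f] by simp
    finally show "(\<Sum>k<M. (cmod (hcoeff ((\<Sum>n<N. hcoeff f n *\<^sub>h e n) - f) k))\<^sup>2)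
        \<le> (sqrt ((norm f)\<^sup>2 - s N))\<^sup>2" using nn by simp
  qed
  then show "\<forall>\<^sub>F N in sequentially. norm ((\<Sum>n<N. hcoeff f n *\<^sub>h e n) - f) \<le> sqrt ((norm f)\<^sup>2 - s N)"
    by simp
qed

text \<open>The adjoint can be read off the matrix of the operator with respect to the monomials,
  without the representation theorem for functionals.\<close>

lemma adjoint_exists:
  assumes T: "T \<in> bounded_ops"
  obtains S :: hop where "S \<in> bounded_ops" "\<And>f g. hinner (T f) g = hinner f (S g)"
proof -
  obtain e where e: "\<And>n k. hcoeff (e n) k = (if k = n then 1 else 0)" by (rule monomials) blast
  define a where "a g n = hinner g (T (e n))" for g n
  have bound: "(\<Sum>n<N. (cmod (a g n))\<^sup>2) \<le> (norm T * norm g)\<^sup>2" for g N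
  proof -
    define s where "s = (\<Sum>n<N. (cmod (a g n))\<^sup>2)"
    define h where "h = (\<Sum>n<N. a g n *\<^sub>h e n)"
    have hc: "hcoeff h k = (if k < N then a g k else 0)" for k
      by (auto simp: h_def hcoeff_sum hcoeff_hscale e if_distrib[of "\<lambda>x. _ * x"] cong: if_cong)
    have "(\<lambda>k. (cmod (hcoeff h k))\<^sup>2) sums s"
      unfolding s_def hc using sums_If_finite_set[of "{..<N}" "\<lambda>k. (cmod (a g k))\<^sup>2"]
      by (simp add: if_distrib[of "\<lambda>x. (cmod x)\<^sup>2"] cong: if_cong)
    then have nh: "(norm h)\<^sup>2 = s" using norm_sq_sums sums_unique2 by blast
    have "hinner g (T h) = (\<Sum>n<N. cnj (a g n) * a g n)"
      by (simp add: h_def blinfun.sum_right bounded_opsD[OF T] hinner_sum_right hinner_hscale_right a_def)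
    also have "\<dots> = of_real s"
      by (simp add: s_def complex_norm_square mult.commute del: of_real_power)
    finally have "s \<le> cmod (hinner g (T h))" by simp
    also have "\<dots> \<le> norm g * norm (T h)" by (rule cmod_hinner_le)
    also have "\<dots> \<le> norm g * (norm T * norm h)" by (intro mult_left_mono norm_blinfun) simp
    finally have "(norm h)\<^sup>2 \<le> (norm T * norm g) * norm h" by (simp add: nh algebra_simps)
    then have "norm h \<le> norm T * norm g"
      by (cases "norm h = 0") (auto simp: power2_eq_square mult_le_cancel_right)
    then show ?thesis unfolding s_def[symmetric] nh[symmetric] by (simp add: power_mono)
  qed
  have "summable (\<lambda>n. (cmod (a g n))\<^sup>2)" for g
    by (rule bounded_imp_summable[of _ "(norm T * norm g)\<^sup>2"])
       (use bound[of g "Suc _"] in \<open>auto simp: lessThan_Suc_atMost\<close>)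
  then have "\<exists>h. \<forall>n. hcoeff h n = a g n" for g by (metis hardy2_of_coeffs)
  then obtain S where S: "\<And>g n. hcoeff (S g) n = a g n" by metis
  have eq: "hinner (T f) g = hinner f (S g)" for f g
  proof -
    have "(\<lambda>N. \<Sum>n<N. hcoeff f n *\<^sub>h e n) \<longlonglongrightarrow> f" by (rule monomial_expansion[OF e])
    then have "(\<lambda>N. hinner (T (\<Sum>n<N. hcoeff f n *\<^sub>h e n)) g) \<longlonglongrightarrow> hinner (T f) g"
      by (intro tendsto_hinner_left blinfun.tendsto tendsto_const)
    moreover have "hinner (T (e n)) g = cnj (a g n)" for n
      by (simp add: a_def hinner_commute[symmetric])
    ultimately have "(\<lambda>n. hcoeff f n * cnj (a g n)) sums hinner (T f) g"
      by (simp add: sums_def blinfun.sum_right bounded_opsD[OF T] hinner_sum_left hinner_hscale_left)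
    then show ?thesis by (simp add: hinner_def S sums_iff)
  qed
  have "norm (S g) \<le> norm T * norm g" for g
    by (rule norm_le_if_coeffs) (use bound in \<open>auto simp: S\<close>)
  moreover have "S (g + h) = S g + S h" for g h
    by (rule hinner_ext_right) (simp add: eq[symmetric] hinner_add_right)
  moreover have "S (c *\<^sub>h g) = c *\<^sub>h S g" for c g
    by (rule hinner_ext_right) (simp add: eq[symmetric] hinner_hscale_right)
  ultimately obtain A :: hop where "A \<in> bounded_ops" "\<And>f. A f = S f"
    using bounded_op_exists[of S "norm T"] by metis
  then show ?thesis using eq by (intro that[of A]) auto
qed

lemma op_adjoint_eqI:
  assumes "\<And>f g. hinner (blinfun_apply T f) g = hinner f (blinfun_apply S g)"
  shows "op_adjoint T = S"
  unfolding op_adjoint_def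
proof (rule the_equality)
  fix S' :: hop assume "\<forall>f g. hinner (T f) g = hinner f (S' g)"
  then show "S' = S" by (intro blinfun_eqI hinner_ext_right) (simp add: assms[symmetric])
qed (use assms in simp)

lemma op_adjoint:
  assumes "T \<in> bounded_ops"
  shows op_adjoint_in_bounded_ops: "op_adjoint T \<in> bounded_ops"
    and hinner_op_adjoint: "hinner (T f) g = hinner f (op_adjoint T g)"
  using adjoint_exists[OF assms] op_adjoint_eqI by metis+

lemma hinner_op_adjoint_left: "T \<in> bounded_ops \<Longrightarrow> hinner (op_adjoint T f) g = hinner f (T g)"
  by (metis hinner_op_adjoint hinner_commute)

lemma op_adjoint_op_adjoint: "T \<in> bounded_ops \<Longrightarrow> op_adjoint (op_adjoint T) = T"
  by (rule op_adjoint_eqI) (rule hinner_op_adjoint_left)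

lemma op_adjoint_add:
  "S \<in> bounded_ops \<Longrightarrow> T \<in> bounded_ops \<Longrightarrow> op_adjoint (S + T) = op_adjoint S + op_adjoint T"
  by (rule op_adjoint_eqI) (simp add: blinfun.add_left hinner_add_left hinner_add_right hinner_op_adjoint)

section \<open>Compact operators\<close>

lemma compact_closureI:
  fixes S :: "hardy2 set"
  assumes "\<And>x. (\<And>n::nat. x n \<in> S) \<Longrightarrow> \<exists>l r. strict_mono (r :: nat \<Rightarrow> nat) \<and> (x \<circ> r) \<longlonglongrightarrow> l"
  shows "compact (closure S)"
proof -
  have "seq_compact (closure S)"
  proof (rule seq_compactI)
    fix y :: "nat \<Rightarrow> hardy2" assume y: "\<forall>n. y n \<in> closure S"
    have "\<exists>x\<in>S. dist x (y n) < 1 / real (Suc n)" for n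
      using y by (auto simp: closure_approachable)
    then obtain x where x: "\<And>n. x n \<in> S" "\<And>n. dist (x n) (y n) < 1 / real (Suc n)" by metis
    obtain l r where r: "strict_mono (r :: nat \<Rightarrow> nat)" "(x \<circ> r) \<longlonglongrightarrow> l" using assms[of x] x(1) by blast
    have "(\<lambda>n. y n - x n) \<longlonglongrightarrow> 0"
      by (rule Lim_null_comparison[OF _ LIMSEQ_Suc[OF lim_1_over_n]])
         (use x(2) in \<open>auto simp: dist_norm norm_minus_commute less_imp_le\<close>)
    then have "(\<lambda>n. (y \<circ> r) n - (x \<circ> r) n) \<longlonglongrightarrow> 0"
      using LIMSEQ_subseq_LIMSEQ[OF _ r(1)] by (fastforce simp: o_def)
    from tendsto_add[OF this r(2)] have "(y \<circ> r) \<longlonglongrightarrow> l" by (simp add: o_def)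
    moreover have "l \<in> closure S" using r(2) x(1)
      unfolding closure_sequential by (intro exI[of _ "x \<circ> r"]) simp
    ultimately show "\<exists>l\<in>closure S. \<exists>r. strict_mono r \<and> (y \<circ> r) \<longlonglongrightarrow> l" using r(1) by blast
  qed
  then show ?thesis by (simp add: compact_eq_seq_compact_metric)
qed

lemma compact_opsI:
  assumes "T \<in> bounded_ops"
    and "\<And>f. (\<And>n. norm (f n) \<le> 1) \<Longrightarrow> \<exists>l r. strict_mono (r :: nat \<Rightarrow> nat) \<and> (\<lambda>n. T (f (r n))) \<longlonglongrightarrow> l"
  shows "T \<in> compact_ops"
  unfolding compact_ops_def
proof (intro CollectI conjI compact_closureI)
  fix x :: "nat \<Rightarrow> hardy2" assume "\<And>n. x n \<in> blinfun_apply T ` cball 0 1"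
  then have "\<forall>n. \<exists>f. norm f \<le> 1 \<and> x n = T f" by fastforce
  then obtain f where f: "\<And>n. norm (f n) \<le> 1" "\<And>n. x n = T (f n)" by metis
  then show "\<exists>l r. strict_mono r \<and> (x \<circ> r) \<longlonglongrightarrow> l" using assms(2)[of f] by (simp add: o_def)
qed (rule assms)

lemma compact_ops_bounded: "T \<in> compact_ops \<Longrightarrow> T \<in> bounded_ops"
  by (simp add: compact_ops_def)

lemma compact_opsD:
  assumes T: "T \<in> compact_ops" and f: "\<And>n::nat. norm (f n) \<le> B"
  obtains l r where "strict_mono (r :: nat \<Rightarrow> nat)" "(\<lambda>n. T (f (r n))) \<longlonglongrightarrow> l"
proof -
  define M where "M = max B 1"
  have M: "M > 0" "norm (f n) \<le> M" for n using f[of n] by (auto simp: M_def)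
  define g where "g n = (1 / M) *\<^sub>R f n" for n
  have "T (g n) \<in> closure (blinfun_apply T ` cball 0 1)" for n
    using M by (intro subsetD[OF closure_subset] imageI) (simp add: g_def)
  moreover have "seq_compact (closure (blinfun_apply T ` cball 0 1))"
    using T by (simp add: compact_ops_def compact_eq_seq_compact_metric)
  ultimately obtain l r where lr: "strict_mono (r :: nat \<Rightarrow> nat)" "((\<lambda>n. T (g n)) \<circ> r) \<longlonglongrightarrow> l"
    unfolding seq_compact_def by meson
  have "(\<lambda>n. M *\<^sub>R T (g (r n))) \<longlonglongrightarrow> M *\<^sub>R l" using lr(2) by (intro tendsto_intros) (simp add: o_def)
  moreover have "M *\<^sub>R T (g n) = T (f n)" for n using M by (simp add: g_def blinfun.scaleR_right)
  ultimately show ?thesis using that lr(1) by simp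
qed

lemma add_in_compact_ops:
  assumes "S \<in> compact_ops" "T \<in> compact_ops"
  shows "S + T \<in> compact_ops"
proof (rule compact_opsI)
  fix f :: "nat \<Rightarrow> hardy2" assume f: "\<And>n. norm (f n) \<le> 1"
  obtain l r where r: "strict_mono r" "(\<lambda>n. S (f (r n))) \<longlonglongrightarrow> l" by (rule compact_opsD[OF assms(1) f])
  obtain m q where q: "strict_mono q" "(\<lambda>n. T (f (r (q n)))) \<longlonglongrightarrow> m"
    by (rule compact_opsD[OF assms(2), of "\<lambda>n. f (r n)"]) (use f in auto)
  have "(\<lambda>n. S (f (r (q n)))) \<longlonglongrightarrow> l" using LIMSEQ_subseq_LIMSEQ[OF r(2) q(1)] by (simp add: o_def)
  from tendsto_add[OF this q(2)] have "(\<lambda>n. (S + T) (f ((r \<circ> q) n))) \<longlonglongrightarrow> l + m"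
    by (simp add: blinfun.add_left)
  then show "\<exists>l r. strict_mono r \<and> (\<lambda>n. (S + T) (f (r n))) \<longlonglongrightarrow> l"
    using strict_mono_o[OF r(1) q(1)] by blast
qed (use assms in \<open>simp add: add_in_bounded_ops compact_ops_bounded\<close>)

lemma compose_left_in_compact_ops:
  assumes "S \<in> bounded_ops" "T \<in> compact_ops"
  shows "S o\<^sub>L T \<in> compact_ops"
proof (rule compact_opsI)
  fix f :: "nat \<Rightarrow> hardy2" assume f: "\<And>n. norm (f n) \<le> 1"
  obtain l r where r: "strict_mono r" "(\<lambda>n. T (f (r n))) \<longlonglongrightarrow> l" by (rule compact_opsD[OF assms(2) f])
  then have "(\<lambda>n. (S o\<^sub>L T) (f (r n))) \<longlonglongrightarrow> S l" by (simp add: blinfun.tendsto)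
  then show "\<exists>l r. strict_mono r \<and> (\<lambda>n. (S o\<^sub>L T) (f (r n))) \<longlonglongrightarrow> l" using r(1) by blast
qed (use assms in \<open>simp add: compose_in_bounded_ops compact_ops_bounded\<close>)

lemma compose_right_in_compact_ops:
  assumes "S \<in> bounded_ops" "T \<in> compact_ops"
  shows "T o\<^sub>L S \<in> compact_ops"
proof (rule compact_opsI)
  fix f :: "nat \<Rightarrow> hardy2" assume f: "\<And>n. norm (f n) \<le> 1"
  have "norm (S (f n)) \<le> norm S" for n
    using norm_blinfun[of S "f n"] mult_left_mono[OF f[of n], of "norm S"] by simp
  then obtain l r where "strict_mono r" "(\<lambda>n. T (S (f (r n)))) \<longlonglongrightarrow> l"
    by (rule compact_opsD[OF assms(2), of "\<lambda>n. S (f n)"])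
  then show "\<exists>l r. strict_mono r \<and> (\<lambda>n. (T o\<^sub>L S) (f (r n))) \<longlonglongrightarrow> l" by auto
qed (use assms in \<open>simp add: compose_in_bounded_ops compact_ops_bounded\<close>)

lemma op_scale_compose: "op_scale c T = op_scale c id_blinfun o\<^sub>L T"
  by (rule blinfun_eqI) (simp add: op_scale_apply)

lemma op_scale_in_compact_ops: "T \<in> compact_ops \<Longrightarrow> op_scale c T \<in> compact_ops"
  by (subst op_scale_compose) (simp add: compose_left_in_compact_ops op_scale_in_bounded_ops)

lemma diff_in_compact_ops: "S \<in> compact_ops \<Longrightarrow> T \<in> compact_ops \<Longrightarrow> S - T \<in> compact_ops"
  by (simp add: minus_op_conv_scale add_in_compact_ops op_scale_in_compact_ops)

text \<open>The identity \<open>\<parallel>T\<^sup>* v\<parallel>\<^sup>2 = \<langle>T T\<^sup>* v, v\<rangle>\<close> shows that \<open>T\<^sup>*\<close> maps a sequence to a Cauchy sequence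
  whenever the compact operator \<open>T T\<^sup>*\<close> does.\<close>

lemma op_adjoint_in_compact_ops:
  assumes T: "T \<in> compact_ops"
  shows "op_adjoint T \<in> compact_ops"
proof (rule compact_opsI)
  let ?S = "op_adjoint T"
  have Tb: "T \<in> bounded_ops" using T by (rule compact_ops_bounded)
  show Sb: "?S \<in> bounded_ops" using Tb by (rule op_adjoint_in_bounded_ops)
  fix f :: "nat \<Rightarrow> hardy2" assume f: "\<And>n. norm (f n) \<le> 1"
  obtain l r where r: "strict_mono r" "(\<lambda>n. (T o\<^sub>L ?S) (f (r n))) \<longlonglongrightarrow> l"
    by (rule compact_opsD[OF compose_right_in_compact_ops[OF Sb T] f])
  have key: "(norm (?S v))\<^sup>2 \<le> norm (T (?S v)) * norm v" for v
  proof -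
    have "complex_of_real ((norm (?S v))\<^sup>2) = hinner (T (?S v)) v"
      by (simp only: hinner_op_adjoint[OF Tb] hinner_self_norm)
    then have "(norm (?S v))\<^sup>2 = cmod (hinner (T (?S v)) v)"
      by (metis norm_of_real abs_of_nonneg zero_le_power2)
    then show ?thesis using cmod_hinner_le by simp
  qed
  have "Cauchy (\<lambda>n. ?S (f (r n)))"
  proof (rule CauchyI)
    fix e :: real assume e: "0 < e"
    have "Cauchy (\<lambda>n. T (?S (f (r n))))" using r(2) by (auto intro: LIMSEQ_imp_Cauchy)
    then obtain M where M: "\<And>m n. m \<ge> M \<Longrightarrow> n \<ge> M \<Longrightarrow> norm (T (?S (f (r m))) - T (?S (f (r n)))) < e\<^sup>2 / 2"
      using CauchyD[of _ "e\<^sup>2 / 2"] e by (metis half_gt_zero_iff zero_less_power)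
    have "norm (?S (f (r m)) - ?S (f (r n))) < e" if "m \<ge> M" "n \<ge> M" for m n
    proof -
      have "norm (f (r m) - f (r n)) \<le> 2"
        using norm_triangle_ineq4[of "f (r m)" "f (r n)"] f[of "r m"] f[of "r n"] by linarith
      then have "(norm (?S (f (r m) - f (r n))))\<^sup>2 \<le> norm (T (?S (f (r m) - f (r n)))) * 2"
        using key[of "f (r m) - f (r n)"] by (meson mult_left_mono norm_ge_zero order_trans)
      also have "\<dots> < e\<^sup>2" using M[OF that] by (simp add: blinfun.diff_right)
      finally show ?thesis using e by (simp add: blinfun.diff_right power_less_imp_less_base)
    qed
    then show "\<exists>M. \<forall>m\<ge>M. \<forall>n\<ge>M. norm (?S (f (r m)) - ?S (f (r n))) < e" by blast
  qed
  then show "\<exists>l r. strict_mono r \<and> (\<lambda>n. ?S (f (r n))) \<longlonglongrightarrow> l"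
    using r(1) Cauchy_convergent convergent_def by blast
qed

text \<open>A finite net for the image of the ball under a nearby compact operator also serves the limit.\<close>

lemma closed_compact_ops: "closed compact_ops"
proof (rule closed_sequentiallyI)
  fix T :: "nat \<Rightarrow> hop" and S
  assume T: "\<And>n. T n \<in> compact_ops" and lim: "T \<longlonglongrightarrow> S"
  have S: "S \<in> bounded_ops"
    by (rule closed_sequentially[OF closed_bounded_ops _ lim]) (simp add: T compact_ops_bounded)
  let ?K = "closure (blinfun_apply S ` cball 0 1)"
  have "\<exists>k. finite k \<and> ?K \<subseteq> (\<Union>x\<in>k. ball x e)" if e: "e > 0" for e
  proof -
    obtain n where n: "norm (T n - S) < e / 4"
      using LIMSEQ_D[OF lim, of "e/4"] e by auto
    have "compact (closure (blinfun_apply (T n) ` cball 0 1))" using T by (simp add: compact_ops_def)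
    then obtain k where k: "finite k" "closure (blinfun_apply (T n) ` cball 0 1) \<subseteq> (\<Union>x\<in>k. ball x (e/4))"
      unfolding compact_eq_totally_bounded using e by (meson divide_pos_pos zero_less_numeral)
    have "?K \<subseteq> (\<Union>x\<in>k. ball x e)"
    proof
      fix y assume "y \<in> ?K"
      then obtain s where "s \<in> blinfun_apply S ` cball 0 1" "dist s y < e / 4"
        using e unfolding closure_approachable by (meson divide_pos_pos zero_less_numeral)
      then obtain f where f: "norm f \<le> 1" "dist (S f) y < e / 4" by auto
      have "T n f \<in> closure (blinfun_apply (T n) ` cball 0 1)"
        using f by (intro subsetD[OF closure_subset] imageI) simp
      then obtain x where x: "x \<in> k" "dist x (T n f) < e / 4" using k(2) by auto
      have "norm ((T n - S) f) \<le> norm (T n - S) * 1"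
        using norm_blinfun[of "T n - S" f] mult_left_mono[OF f(1), of "norm (T n - S)"] by simp
      then have "dist (T n f) (S f) < e / 4" using n by (simp add: dist_norm blinfun.diff_left)
      then have "dist x y < e"
        using dist_triangle[of x y "T n f"] dist_triangle[of "T n f" y "S f"] x(2) f(2) e by linarith
      then show "y \<in> (\<Union>x\<in>k. ball x e)" using x(1) by auto
    qed
    then show ?thesis using k(1) by blast
  qed
  then have "compact ?K" unfolding compact_eq_totally_bounded by (auto simp: complete_eq_closed)
  then show "S \<in> compact_ops" using S by (simp add: compact_ops_def)
qed

definition rank_one :: "hardy2 \<Rightarrow> hardy2 \<Rightarrow> hop" where
  "rank_one g h = Blinfun (\<lambda>f. hinner f g *\<^sub>h h)"

lemma rank_one_apply: "rank_one g h f = hinner f g *\<^sub>h h"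
  and rank_one_in_compact_ops: "rank_one g h \<in> compact_ops"
proof -
  have "bounded_linear (\<lambda>f. hinner f g *\<^sub>h h)"
  proof (rule bounded_linear_intro)
    show "hinner (r *\<^sub>R f) g *\<^sub>h h = r *\<^sub>R (hinner f g *\<^sub>h h)" for r f
      by (simp add: hscale_of_real[symmetric] hinner_hscale_left)
    show "norm (hinner f g *\<^sub>h h) \<le> norm f * (norm g * norm h)" for f
      using mult_right_mono[OF cmod_hinner_le[of f g], of "norm h"] by (simp add: norm_hscale mult.assoc)
  qed (simp add: hinner_add_left hardy2.scale_left_distrib)
  then show app: "rank_one g h f = hinner f g *\<^sub>h h" for f
    by (simp add: rank_one_def bounded_linear_Blinfun_apply)
  show "rank_one g h \<in> compact_ops"
  proof (rule compact_opsI)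
    show "rank_one g h \<in> bounded_ops" by (simp add: bounded_ops_def app hinner_hscale_left)
    fix f :: "nat \<Rightarrow> hardy2" assume f: "\<And>n. norm (f n) \<le> 1"
    have "cmod (hinner (f n) g) \<le> norm g" for n
      using cmod_hinner_le[of "f n" g] mult_right_mono[OF f[of n], of "norm g"] by simp
    then have "bounded (range (\<lambda>n. hinner (f n) g))" by (auto simp: bounded_iff)
    then obtain l r where r: "strict_mono (r :: nat \<Rightarrow> nat)" "((\<lambda>n. hinner (f n) g) \<circ> r) \<longlonglongrightarrow> l"
      using bounded_imp_convergent_subsequence by blast
    have "bounded_linear (\<lambda>c. c *\<^sub>h h)"
    proof (rule bounded_linear_intro)
      show "(r *\<^sub>R c) *\<^sub>h h = r *\<^sub>R (c *\<^sub>h h)" for r c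
        by (simp add: hscale_of_real[symmetric] scaleR_conv_of_real)
      show "norm (c *\<^sub>h h) \<le> norm c * norm h" for c by (simp add: norm_hscale)
    qed (rule hardy2.scale_left_distrib)
    from bounded_linear.tendsto[OF this r(2)]
    have "(\<lambda>n. rank_one g h (f (r n))) \<longlonglongrightarrow> l *\<^sub>h h" by (simp add: app o_def)
    then show "\<exists>l r. strict_mono r \<and> (\<lambda>n. rank_one g h (f (r n))) \<longlonglongrightarrow> l" using r(1) by blast
  qed
qed

lemma zero_in_compact_ops: "0 \<in> compact_ops"
  using diff_in_compact_ops[OF rank_one_in_compact_ops rank_one_in_compact_ops] by (metis diff_self)

lemma sum_in_compact_ops: "(\<And>i. i \<in> A \<Longrightarrow> F i \<in> compact_ops) \<Longrightarrow> sum F A \<in> compact_ops"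
  by (induction A rule: infinite_finite_induct) (auto simp: zero_in_compact_ops add_in_compact_ops)

text \<open>Along a subsequence the images converge in norm; their limit is orthogonal to everything.\<close>

lemma compact_op_weakly_null:
  assumes K: "K \<in> compact_ops" and f: "\<And>n::nat. norm (f n) \<le> B"
    and weak: "\<And>g. (\<lambda>n. hinner (f n) g) \<longlonglongrightarrow> 0"
  shows "(\<lambda>n. K (f n)) \<longlonglongrightarrow> 0"
proof (rule ccontr)
  assume "\<not> (\<lambda>n. K (f n)) \<longlonglongrightarrow> 0"
  then obtain e where e: "e > 0" "\<And>N. \<exists>n\<ge>N. norm (K (f n)) \<ge> e"
    by (auto simp: LIMSEQ_iff not_less)
  then have "\<forall>N. \<exists>n>N. norm (K (f n)) \<ge> e" by (meson Suc_le_lessD)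
  then have "infinite {n. norm (K (f n)) \<ge> e}" unfolding infinite_nat_iff_unbounded by auto
  then obtain r where r: "strict_mono (r :: nat \<Rightarrow> nat)" "\<And>n. norm (K (f (r n))) \<ge> e"
    using infinite_enumerate by blast
  obtain l q where q: "strict_mono (q :: nat \<Rightarrow> nat)" "(\<lambda>n. K (f (r (q n)))) \<longlonglongrightarrow> l"
    by (rule compact_opsD[OF K, of "\<lambda>n. f (r n)"]) (use f in auto)
  have "hinner l g = 0" for g
  proof (rule LIMSEQ_unique)
    show "(\<lambda>n. hinner (K (f (r (q n)))) g) \<longlonglongrightarrow> hinner l g" by (rule tendsto_hinner_left[OF q(2)])
    have "strict_mono (r \<circ> q)" using r(1) q(1) by (rule strict_mono_o)
    from LIMSEQ_subseq_LIMSEQ[OF weak this]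
    show "(\<lambda>n. hinner (K (f (r (q n)))) g) \<longlonglongrightarrow> 0"
      by (simp add: o_def hinner_op_adjoint[OF compact_ops_bounded[OF K]])
  qed
  then have "l = 0" by (intro hinner_ext) simp
  moreover have "e \<le> norm l"
    by (rule LIMSEQ_le_const[OF tendsto_norm[OF q(2)]]) (use r(2) in auto)
  ultimately show False using e(1) by simp
qed

section \<open>Operators with closed range\<close>

lemma subspace_range: "T \<in> bounded_ops \<Longrightarrow> hardy2.subspace (range (blinfun_apply T))"
  unfolding hardy2.subspace_def
  by (auto simp: blinfun.add_right[symmetric] bounded_opsD[symmetric] intro: range_eqI[of _ _ 0])

lemma subspace_op_kernel: "T \<in> bounded_ops \<Longrightarrow> hardy2.subspace (op_kernel T)"
  unfolding hardy2.subspace_def op_kernel_def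
  by (auto simp: blinfun.add_right bounded_opsD)

text \<open>Open mapping theorem onto the range. By Baire's theorem some closure of the image of a ball
  has interior in the range, so every vector of the range can be approximated up to half its norm
  with control on the preimage; iterating the approximation and summing gives an exact preimage.\<close>

lemma closed_range_preimage_bound:
  fixes T :: hop
  assumes cl: "closed (range (blinfun_apply T))"
  obtains C where "C > 0" "\<And>f. \<exists>f'. T f' = T f \<and> norm f' \<le> C * norm (T f)"
proof -
  let ?R = "range (blinfun_apply T)"
  define G where "G n = closure (blinfun_apply T ` cball 0 (real n))" for n
  have GR: "G n \<subseteq> ?R" for n unfolding G_def using cl by (intro closure_minimal) auto
  have un: "(\<Union>n. G n) = ?R"
  proof
    show "?R \<subseteq> (\<Union>n. G n)"
    proof
      fix y assume "y \<in> ?R"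
      then obtain f where f: "y = T f" by auto
      obtain n where "norm f \<le> real n" using real_arch_simple by blast
      then have "y \<in> G n" unfolding G_def f by (intro subsetD[OF closure_subset] imageI) simp
      then show "y \<in> (\<Union>n. G n)" by blast
    qed
  qed (use GR in blast)
  have "\<exists>n. top_of_set ?R interior_of (G n) \<noteq> {}"
  proof (rule ccontr)
    assume "\<not> ?thesis"
    then have *: "top_of_set ?R interior_of (G n) = {}" for n by blast
    have "top_of_set ?R interior_of (\<Union>(range G)) = {}"
    proof (rule Baire_category_alt)
      show "completely_metrizable_space (top_of_set ?R)
          \<or> locally_compact_space (top_of_set ?R) \<and> regular_space (top_of_set ?R)"
        using cl by (intro disjI1 completely_metrizable_space_closedin completely_metrizable_space_euclidean) auto
      show "closedin (top_of_set ?R) S \<and> top_of_set ?R interior_of S = {}" if "S \<in> range G" for S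
        
      proof
        obtain n where n: "S = G n" using \<open>S \<in> range G\<close> by blast
        show "closedin (top_of_set ?R) S"
          unfolding n by (rule closed_subset[OF GR]) (simp add: G_def)
        show "top_of_set ?R interior_of S = {}" unfolding n by (rule *)
      qed
    qed simp
    moreover have "top_of_set ?R interior_of ?R = ?R"
      using interior_of_topspace[of "top_of_set ?R"] by simp
    ultimately show False using un by simp
  qed
  then obtain n y where "y \<in> top_of_set ?R interior_of (G n)" by blast
  then obtain O' where O': "openin (top_of_set ?R) O'" "y \<in> O'" "O' \<subseteq> G n"
    by (auto simp: interior_of_def)
  then obtain e where e: "e > 0" "\<And>z. z \<in> ?R \<Longrightarrow> dist z y < e \<Longrightarrow> z \<in> G n" and yR: "y \<in> ?R"
    by (metis openin_euclidean_subtopology_iff subset_iff)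
  define A where "A = 4 * real n / e"
  have A0: "A \<ge> 0" using e by (simp add: A_def)
  have "\<exists>f. norm f \<le> A * norm g \<and> norm (g - T f) \<le> norm g / 2" if g: "g \<in> ?R" for g
  proof (cases "g = 0")
    case True
    then show ?thesis by (intro exI[of _ 0]) simp
  next
    case False
    \<comment> \<open>With this scaling y + t g stays in the ball around y; subtracting an approximation of y leaves one of t g.\<close>
    define t where "t = e / (2 * norm g)"
    have t: "t > 0" "t * norm g = e / 2" using e False by (auto simp: t_def)
    have near: "\<exists>f. norm f \<le> real n \<and> norm (T f - z) < e / 8" if "z \<in> G n" for z
    proof -
      obtain s where "s \<in> blinfun_apply T ` cball 0 (real n)" "dist s z < e / 8"
        using \<open>z \<in> G n\<close> e(1) unfolding G_def closure_approachable by (meson divide_pos_pos zero_less_numeral)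
      then show ?thesis by (auto simp: dist_norm)
    qed
    have "y + t *\<^sub>R g \<in> ?R" using yR g by (auto simp: blinfun.add_right[symmetric] blinfun.scaleR_right[symmetric])
    moreover have "dist (y + t *\<^sub>R g) y < e" using t e by (simp add: dist_norm)
    ultimately have "y + t *\<^sub>R g \<in> G n" by (rule e(2))
    then obtain f1 where f1: "norm f1 \<le> real n" "norm (T f1 - (y + t *\<^sub>R g)) < e / 8" using near by blast
    have "y \<in> G n" using e yR by simp
    then obtain f2 where f2: "norm f2 \<le> real n" "norm (T f2 - y) < e / 8" using near by blast
    define f where "f = (1 / t) *\<^sub>R (f1 - f2)"
    have "norm f = norm (f1 - f2) / t" using t by (simp add: f_def)
    also have "\<dots> \<le> (2 * real n) / t"
      using norm_triangle_ineq4[of f1 f2] f1(1) f2(1) t by (intro divide_right_mono) linarith+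
    also have "\<dots> = A * norm g" using e(1) False by (simp add: A_def t_def)
    finally have "norm f \<le> A * norm g" .
    moreover have "norm (g - T f) \<le> norm g / 2"
    proof -
      have "t *\<^sub>R (g - T f) = (T f2 - y) - (T f1 - (y + t *\<^sub>R g))"
        using t by (simp add: f_def blinfun.scaleR_right blinfun.diff_right algebra_simps)
      then have "t * norm (g - T f) = norm ((T f2 - y) - (T f1 - (y + t *\<^sub>R g)))"
        using t by (metis norm_scaleR abs_of_pos)
      also have "\<dots> \<le> norm (T f2 - y) + norm (T f1 - (y + t *\<^sub>R g))" by (rule norm_triangle_ineq4)
      also have "\<dots> \<le> e / 4" using f1(2) f2(2) by linarith
      also have "\<dots> = t * (norm g / 2)" using t by simp
      finally show ?thesis by (simp only: mult_le_cancel_left_pos[OF t(1)])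
    qed
    ultimately show ?thesis by blast
  qed
  then obtain s where s: "\<And>g. g \<in> ?R \<Longrightarrow> norm (s g) \<le> A * norm g"
      "\<And>g. g \<in> ?R \<Longrightarrow> norm (g - T (s g)) \<le> norm g / 2" by metis
  have ex: "\<exists>f'. T f' = g \<and> norm f' \<le> (2 * A) * norm g" if g: "g \<in> ?R" for g
  proof -
    define q where "q k = ((\<lambda>g. g - T (s g)) ^^ k) g" for k
    have q0: "q 0 = g" and qS: "q (Suc k) = q k - T (s (q k))" for k by (simp_all add: q_def)
    have qR: "q k \<in> ?R" for k
    proof (induction k)
      case (Suc k)
      then obtain h where "q k = T h" by auto
      then show ?case by (auto simp: qS blinfun.diff_right[symmetric])
    qed (use g in \<open>simp add: q0\<close>)
    have qn: "norm (q k) \<le> (1/2) ^ k * norm g" for k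
    proof (induction k)
      case (Suc k)
      have "norm (q (Suc k)) \<le> norm (q k) / 2" using s(2)[OF qR[of k]] by (simp add: qS)
      then show ?case using Suc by simp
    qed (simp add: q0)
    have sn: "norm (s (q k)) \<le> A * norm g * (1/2) ^ k" for k
      using s(1)[OF qR[of k]] mult_left_mono[OF qn[of k] A0] by (simp add: algebra_simps)
    have sg: "(\<lambda>k. A * norm g * (1/2) ^ k) sums (A * norm g * 2)"
      using geometric_sums[of "1/2::real"] by (intro sums_mult) simp
    have sm: "summable (\<lambda>k. norm (s (q k)))"
      by (rule summable_comparison_test[OF _ sums_summable[OF sg]]) (use sn in auto)
    define f where "f = (\<Sum>k. s (q k))"
    have "norm f \<le> (\<Sum>k. norm (s (q k)))" unfolding f_def by (rule summable_norm[OF sm])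
    also have "\<dots> \<le> A * norm g * 2" using suminf_le[OF sn sm sums_summable[OF sg]] sg by (simp add: sums_iff)
    finally have nf: "norm f \<le> (2 * A) * norm g" by simp
    have part: "T (\<Sum>k<m. s (q k)) = g - q m" for m
      by (induction m) (simp_all add: q0 qS blinfun.add_right)
    have "(\<lambda>m. \<Sum>k<m. s (q k)) \<longlonglongrightarrow> f"
      unfolding f_def using summable_sums[OF summable_norm_cancel[OF sm]] by (simp add: sums_def)
    then have "(\<lambda>m. T (\<Sum>k<m. s (q k))) \<longlonglongrightarrow> T f" by (intro blinfun.tendsto tendsto_const)
    then have "(\<lambda>m. g - q m) \<longlonglongrightarrow> T f" by (simp add: part)
    moreover have "(\<lambda>m. (1/2) ^ m * norm g) \<longlonglongrightarrow> 0 * norm g"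
      by (intro tendsto_intros LIMSEQ_power_zero) simp
    then have "q \<longlonglongrightarrow> 0" by (intro Lim_null_comparison[of q "\<lambda>m. (1/2) ^ m * norm g"]) (use qn in auto)
    then have "(\<lambda>m. g - q m) \<longlonglongrightarrow> g - 0" by (intro tendsto_intros)
    ultimately have "T f = g" using LIMSEQ_unique by fastforce
    then show ?thesis using nf by blast
  qed
  show ?thesis
  proof (rule that[of "2 * A + 1"])
    fix f
    obtain f' where "T f' = T f" "norm f' \<le> (2 * A) * norm (T f)" using ex[of "T f"] by auto
    moreover have "(2 * A) * norm (T f) \<le> (2 * A + 1) * norm (T f)" by (simp add: mult_right_mono)
    ultimately show "\<exists>f'. T f' = T f \<and> norm f' \<le> (2 * A + 1) * norm (T f)" by fastforce
  qed (use A0 in simp)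
qed

text \<open>Gram--Schmidt in operator form: the orthogonal projection onto a finite-dimensional subspace
  is enlarged by the projection onto the new orthogonal direction.\<close>

lemma finite_dim_projection:
  assumes "finite B"
  shows "\<exists>P\<in>compact_ops. (\<forall>k\<in>hardy2.span B. P k = k) \<and> (\<forall>f. P f \<in> hardy2.span B)
    \<and> (\<forall>f g. hinner (P f) g = hinner f (P g))"
  using assms
proof (induction B rule: finite_induct)
  case empty
  show ?case by (rule bexI[OF _ zero_in_compact_ops]) simp
next
  case (insert b B)
  then obtain P where P: "P \<in> compact_ops" "\<And>k. k \<in> hardy2.span B \<Longrightarrow> P k = k"
      "\<And>f. P f \<in> hardy2.span B" "\<And>f g. hinner (P f) g = hinner f (P g)"
    by blast
  have Pb: "P \<in> bounded_ops" using P(1) by (rule compact_ops_bounded)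
  define w where "w = b - P b"
  have sp: "\<exists>c. k - c *\<^sub>h b \<in> hardy2.span B" if "k \<in> hardy2.span (insert b B)" for k
    using that by (simp add: hardy2.span_insert)
  have mono: "hardy2.span B \<subseteq> hardy2.span (insert b B)" by (rule hardy2.span_mono) auto
  show ?case
  proof (cases "w = 0")
    case True
    then have "P b = b" by (simp add: w_def)
    have "P k = k" if k: "k \<in> hardy2.span (insert b B)" for k
    proof -
      obtain c where "k - c *\<^sub>h b \<in> hardy2.span B" using sp[OF k] by blast
      from P(2)[OF this] show ?thesis by (simp add: blinfun.diff_right bounded_opsD[OF Pb] \<open>P b = b\<close>)
    qed
    moreover have "\<forall>f. P f \<in> hardy2.span (insert b B)" using P(3) mono by blast
    ultimately show ?thesis using P(1,4) by blast
  next
    case False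
    define r where "r = complex_of_real (1 / (norm w)\<^sup>2)"
    define P' where "P' = P + op_scale r (rank_one w w)"
    have app: "P' f = P f + (r * hinner f w) *\<^sub>h w" for f
      by (simp add: P'_def blinfun.add_left op_scale_apply rank_one_apply)
    have orth: "hinner k w = 0" if "k \<in> hardy2.span B" for k
      using P(2)[OF that] P(4)[of k b] by (simp add: w_def hinner_diff_right)
    have bw: "r * hinner b w = 1"
    proof -
      have "hinner b w = hinner w w + hinner (P b) w" by (simp add: w_def hinner_add_left[symmetric])
      then show ?thesis using orth[OF P(3)] False by (simp add: hinner_self_norm r_def)
    qed
    have wsp: "w \<in> hardy2.span (insert b B)"
      unfolding w_def using P(3)[of b] mono
      by (intro hardy2.span_diff hardy2.span_base[of b]) auto
    have "P' k = k" if k: "k \<in> hardy2.span (insert b B)" for k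
    proof -
      obtain c where c: "k - c *\<^sub>h b \<in> hardy2.span B" using sp[OF k] by blast
      have "P' (k - c *\<^sub>h b) = k - c *\<^sub>h b" using P(2)[OF c] orth[OF c] by (simp add: app)
      moreover have "P' b = b" by (simp only: app bw) (simp add: w_def)
      moreover have "P' \<in> bounded_ops"
        unfolding P'_def using Pb rank_one_in_compact_ops compact_ops_bounded
        by (intro add_in_bounded_ops op_scale_in_bounded_ops) auto
      ultimately show ?thesis by (simp add: blinfun.diff_right bounded_opsD)
    qed
    moreover have "P' f \<in> hardy2.span (insert b B)" for f
      unfolding app using P(3) mono wsp by (intro hardy2.span_add hardy2.span_scale) auto
    moreover have "hinner (P' f) g = hinner f (P' g)" for f g
    proof -
      have "cnj (hinner g w) = hinner w g" by (rule hinner_commute[symmetric])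
      then show ?thesis
        by (simp add: app hinner_add_left hinner_add_right hinner_hscale_left hinner_hscale_right P(4) r_def)
    qed
    moreover have "P' \<in> compact_ops"
      unfolding P'_def by (intro add_in_compact_ops op_scale_in_compact_ops P rank_one_in_compact_ops)
    ultimately show ?thesis by blast
  qed
qed

text \<open>A vector and the short preimage of its image supplied by the open mapping theorem differ by an
  element of the kernel, which the finite-rank projection onto the kernel fixes.\<close>

lemma bounded_below_modulo_compact:
  assumes "closed (range (blinfun_apply T))" "finite_dim (op_kernel T)"
  obtains C P where "C > 0" "P \<in> compact_ops" "\<And>f. norm (f - P f) \<le> C * norm (T f)"
proof -
  obtain B where B: "finite B" "op_kernel T \<subseteq> hardy2.span B" using assms(2) by (auto simp: finite_dim_def)
  obtain P where P: "P \<in> compact_ops" "\<And>k. k \<in> hardy2.span B \<Longrightarrow> P k = k"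
    using finite_dim_projection[OF B(1)] by blast
  obtain C where C: "C > 0" "\<And>f. \<exists>f'. T f' = T f \<and> norm f' \<le> C * norm (T f)"
    using closed_range_preimage_bound[OF assms(1)] by blast
  show ?thesis
  proof (rule that[of "(1 + norm P) * C" P])
    fix f
    obtain f' where f': "T f' = T f" "norm f' \<le> C * norm (T f)" using C(2) by blast
    have "f - f' \<in> op_kernel T" using f' by (simp add: op_kernel_def blinfun.diff_right)
    then have "P (f - f') = f - f'" using P(2) B(2) by blast
    then have "f - P f = f' - P f'" by (simp add: blinfun.diff_right algebra_simps)
    then have "norm (f - P f) \<le> norm f' + norm (P f')" by (simp add: norm_triangle_ineq4)
    also have "\<dots> \<le> norm f' + norm P * norm f'" by (simp add: norm_blinfun)
    also have "\<dots> = (1 + norm P) * norm f'" by (simp add: algebra_simps)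
    also have "\<dots> \<le> (1 + norm P) * (C * norm (T f))" by (intro mult_left_mono f') simp
    finally show "norm (f - P f) \<le> (1 + norm P) * C * norm (T f)" by (simp add: mult.assoc)
  qed (use C P in \<open>auto intro!: mult_pos_pos add_pos_nonneg\<close>)
qed

lemma closed_range_eq_orthogonal:
  assumes T: "T \<in> bounded_ops" and cl: "closed (range (blinfun_apply T))"
  shows "g \<in> range (blinfun_apply T) \<longleftrightarrow> (\<forall>k\<in>op_kernel (op_adjoint T). hinner g k = 0)"
proof
  assume "g \<in> range (blinfun_apply T)"
  then show "\<forall>k\<in>op_kernel (op_adjoint T). hinner g k = 0"
    by (auto simp: op_kernel_def hinner_op_adjoint[OF T])
next
  assume orth: "\<forall>k\<in>op_kernel (op_adjoint T). hinner g k = 0"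
  obtain p where p: "p \<in> range (blinfun_apply T)" "\<And>v. v \<in> range (blinfun_apply T) \<Longrightarrow> hinner (g - p) v = 0"
    using projection_theorem[OF subspace_range[OF T] cl] by blast
  have "hinner f (op_adjoint T (g - p)) = 0" for f
    using p(2)[of "T f"] hinner_commute[of "T f" "g - p"] by (simp add: hinner_op_adjoint[OF T, symmetric])
  then have "op_adjoint T (g - p) = 0" by (intro hinner_ext_right) simp
  then have "hinner g (g - p) = 0" using orth by (simp add: op_kernel_def)
  moreover have "hinner p (g - p) = 0" using p hinner_commute[of p "g - p"] by simp
  ultimately have "hinner (g - p) (g - p) = 0" by (simp add: hinner_diff_left)
  then show "g \<in> range (blinfun_apply T)" using p(1) by simp
qed

lemma bounded_below_closed_image:
  fixes T :: hop
  assumes c: "c > 0" "\<And>f. c * norm f \<le> norm (T f)" and V: "closed V"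
  shows "closed (blinfun_apply T ` V)"
proof (rule closed_sequentiallyI)
  fix y :: "nat \<Rightarrow> hardy2" and l assume y: "\<And>n. y n \<in> blinfun_apply T ` V" and l: "y \<longlonglongrightarrow> l"
  have "\<forall>n. \<exists>v. v \<in> V \<and> y n = T v" using y by blast
  then obtain x where x: "\<And>n. x n \<in> V" "\<And>n. y n = T (x n)" by metis
  have "Cauchy x"
  proof (rule CauchyI)
    fix e :: real assume "0 < e"
    then obtain M where M: "\<And>m n. m \<ge> M \<Longrightarrow> n \<ge> M \<Longrightarrow> norm (y m - y n) < c * e"
      using CauchyD[OF LIMSEQ_imp_Cauchy[OF l], of "c * e"] c by (metis mult_pos_pos)
    have "norm (x m - x n) < e" if "m \<ge> M" "n \<ge> M" for m n
    proof -
      have "c * norm (x m - x n) < c * e"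
        using c(2)[of "x m - x n"] M[OF that] by (simp add: x blinfun.diff_right)
      then show ?thesis using c by simp
    qed
    then show "\<exists>M. \<forall>m\<ge>M. \<forall>n\<ge>M. norm (x m - x n) < e" by blast
  qed
  then obtain z where z: "x \<longlonglongrightarrow> z" using Cauchy_convergent convergent_def by blast
  have "z \<in> V" using closed_sequentially[OF V] x(1) z by blast
  moreover have "y \<longlonglongrightarrow> T z" unfolding x(2) by (intro blinfun.tendsto tendsto_const z)
  then have "T z = l" using l LIMSEQ_unique by blast
  ultimately show "l \<in> blinfun_apply T ` V" by blast
qed

section \<open>Index of an invertible operator plus a compact one\<close>

lemma id_plus_compact_bounded_below:
  assumes L: "L \<in> compact_ops" and inj: "\<And>f. f + L f = 0 \<Longrightarrow> f = 0"
  obtains c where "c > 0" "\<And>f. c * norm f \<le> norm (f + L f)"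
proof (rule ccontr)
  assume "\<not> thesis"
  then have "\<exists>f. norm (f + L f) < (1 / real (Suc n)) * norm f" for n
    using that[of "1 / real (Suc n)"] by (force simp: not_le)
  then obtain g where g: "\<And>n. norm (g n + L (g n)) < (1 / real (Suc n)) * norm (g n)" by metis
  have gpos: "norm (g n) > 0" for n
    using le_less_trans[OF norm_ge_zero g[of n]] by auto
  define f where "f n = (1 / norm (g n)) *\<^sub>R g n" for n
  have f1: "norm (f n) = 1" for n using gpos[of n] by (simp add: f_def)
  have "norm (f n + L (f n)) \<le> 1 / real (Suc n)" for n
  proof -
    have "f n + L (f n) = (1 / norm (g n)) *\<^sub>R (g n + L (g n))"
      by (simp add: f_def blinfun.scaleR_right scaleR_add_right)
    then have "norm (f n + L (f n)) = norm (g n + L (g n)) / norm (g n)" by simp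
    also have "\<dots> \<le> 1 / real (Suc n)" using g[of n] gpos[of n] by (simp add: divide_le_eq)
    finally show ?thesis .
  qed
  then have lim: "(\<lambda>n. f n + L (f n)) \<longlonglongrightarrow> 0"
    by (intro Lim_null_comparison[OF _ LIMSEQ_Suc[OF lim_1_over_n]]) auto
  obtain l r where r: "strict_mono (r :: nat \<Rightarrow> nat)" "(\<lambda>n. L (f (r n))) \<longlonglongrightarrow> l"
    by (rule compact_opsD[OF L, of f 1]) (auto simp: f1)
  have "(\<lambda>n. f (r n) + L (f (r n))) \<longlonglongrightarrow> 0" using LIMSEQ_subseq_LIMSEQ[OF lim r(1)] by (simp add: o_def)
  from tendsto_diff[OF this r(2)] have fl: "(\<lambda>n. f (r n)) \<longlonglongrightarrow> - l" by simp
  then have "(\<lambda>n. L (f (r n))) \<longlonglongrightarrow> L (- l)" by (intro blinfun.tendsto tendsto_const)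
  then have "L (- l) = l" using r(2) LIMSEQ_unique by blast
  then have "- l + L (- l) = 0" by (simp only: left_minus)
  then have "- l = 0" by (rule inj)
  moreover have "norm (- l) = 1"
    using tendsto_norm[OF fl] LIMSEQ_unique[OF _ tendsto_const[of 1 sequentially]] by (simp add: f1 LIMSEQ_const_iff)
  ultimately show False by simp
qed

text \<open>Riesz: if \<open>S = 1 + L\<close> were injective but not surjective, the closed subspaces \<open>S\<^sup>n H\<close> would
  decrease strictly; unit vectors from their successive orthogonal differences have images under
  \<open>L\<close> at mutual distance at least one.\<close>

lemma id_plus_compact_surj:
  assumes L: "L \<in> compact_ops" and inj: "\<And>f. f + L f = 0 \<Longrightarrow> f = 0"
  shows "\<exists>f. f + L f = g"
proof (rule ccontr)
  assume g: "\<nexists>f. f + L f = g"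
  define S where "S = id_blinfun + L"
  have S: "S f = f + L f" for f by (simp add: S_def blinfun.add_left)
  have Sb: "S \<in> bounded_ops" unfolding S_def using L compact_ops_bounded by (intro add_in_bounded_ops) auto
  obtain c where c: "c > 0" "\<And>f. c * norm f \<le> norm (S f)"
    using id_plus_compact_bounded_below[OF L inj] unfolding S by blast
  have injS: "inj (blinfun_apply S)"
  proof (rule injI)
    fix f h assume "S f = S h"
    then have "S (f - h) = 0" by (simp add: blinfun.diff_right)
    then have "(f - h) + L (f - h) = 0" by (simp only: S)
    then have "f - h = 0" by (rule inj)
    then show "f = h" by simp
  qed
  define R where "R n = ((`) (blinfun_apply S) ^^ n) UNIV" for n
  have R0: "R 0 = UNIV" and RS: "R (Suc n) = blinfun_apply S ` R n" for n by (simp_all add: R_def)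
  have cl: "closed (R n)" for n
    by (induction n) (auto simp: R0 RS intro!: bounded_below_closed_image c)
  have sub: "hardy2.subspace (R n)" for n
  proof (induction n)
    case (Suc n)
    show ?case unfolding hardy2.subspace_def RS
    proof (intro conjI ballI allI)
      show "0 \<in> blinfun_apply S ` R n" using hardy2.subspace_0[OF Suc] by (intro image_eqI[of _ _ 0]) auto
      fix x y assume "x \<in> blinfun_apply S ` R n" "y \<in> blinfun_apply S ` R n"
      then show "x + y \<in> blinfun_apply S ` R n"
        using hardy2.subspace_add[OF Suc] by (auto simp: blinfun.add_right[symmetric])
    next
      fix a x assume "x \<in> blinfun_apply S ` R n"
      then show "a *\<^sub>h x \<in> blinfun_apply S ` R n"
        using hardy2.subspace_scale[OF Suc] by (auto simp: bounded_opsD[OF Sb, symmetric])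
    qed
  qed (simp add: R0)
  have dec1: "R (Suc n) \<subseteq> R n" for n by (induction n) (use R0 RS in auto)
  have dec: "R n \<subseteq> R m" if "m \<le> n" for m n using lift_Suc_antimono_le[of R, OF dec1 that] .
  have "R (Suc n) \<noteq> R n" for n
  proof (induction n)
    case 0
    have "g \<notin> range (blinfun_apply S)" using g S by auto
    then show ?case by (auto simp: R0 RS)
  next
    case (Suc n)
    then show ?case unfolding RS[of "Suc n"] RS[of n] using inj_image_eq_iff[OF injS] RS by metis
  qed
  then have "\<exists>x. x \<in> R n \<and> x \<notin> R (Suc n)" for n using dec1 by blast
  then obtain x where x: "\<And>n. x n \<in> R n" "\<And>n. x n \<notin> R (Suc n)" by metis
  have "\<exists>e. e \<in> R n \<and> norm e = 1 \<and> (\<forall>v\<in>R (Suc n). hinner v e = 0)" for n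
  proof -
    obtain p where p: "p \<in> R (Suc n)" "\<And>v. v \<in> R (Suc n) \<Longrightarrow> hinner (x n - p) v = 0"
      using projection_theorem[OF sub cl] by blast
    have ne: "x n - p \<noteq> 0" using p(1) x(2)[of n] by auto
    have "x n - p \<in> R n" using x(1) p(1) dec1 by (intro subspace_diff sub) auto
    moreover have "hinner v (x n - p) = 0" if "v \<in> R (Suc n)" for v
      using p(2)[OF that] hinner_commute[of v "x n - p"] by simp
    ultimately show ?thesis using ne
      by (intro exI[of _ "(1 / norm (x n - p)) *\<^sub>R (x n - p)"])
         (auto simp: hardy2.subspace_scale[OF sub] hscale_of_real[symmetric] hinner_hscale_right norm_hscale norm_divide)
  qed
  then obtain e where e: "\<And>n. e n \<in> R n" "\<And>n. norm (e n) = 1" "\<And>n v. v \<in> R (Suc n) \<Longrightarrow> hinner v (e n) = 0"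
    by metis
  have sep: "1 \<le> norm (L (e n) - L (e m))" if "n < m" for n m
  proof -
    define v where "v = S (e n) - L (e m)"
    have "e m \<in> R (Suc n)" using e(1)[of m] dec[of "Suc n" m] that by auto
    moreover have "S (e m) \<in> R (Suc n)" using e(1)[of m] dec[of "Suc n" "Suc m"] that by (auto simp: RS)
    ultimately have "S (e m) - e m \<in> R (Suc n)" using subspace_diff[OF sub] by blast
    then have "L (e m) \<in> R (Suc n)" by (simp add: S)
    moreover have "S (e n) \<in> R (Suc n)" using e(1) by (simp add: RS)
    ultimately have v: "hinner v (e n) = 0" unfolding v_def by (intro e(3) subspace_diff[OF sub])
    have "1 = cmod (hinner (v - e n) (e n))" by (simp add: hinner_diff_left v hinner_self_norm e(2))
    also have "\<dots> \<le> norm (v - e n) * norm (e n)" by (rule cmod_hinner_le)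
    also have "v - e n = L (e n) - L (e m)" by (simp add: v_def S)
    finally show ?thesis by (simp add: e(2))
  qed
  obtain l r where r: "strict_mono (r :: nat \<Rightarrow> nat)" "(\<lambda>n. L (e (r n))) \<longlonglongrightarrow> l"
    by (rule compact_opsD[OF L, of e 1]) (auto simp: e(2))
  obtain M where M: "\<And>m n. m \<ge> M \<Longrightarrow> n \<ge> M \<Longrightarrow> norm (L (e (r m)) - L (e (r n))) < 1"
    using CauchyD[OF LIMSEQ_imp_Cauchy[OF r(2)], of 1] by auto
  show False using M[of M "Suc M"] sep[of "r M" "r (Suc M)"] strict_monoD[OF r(1), of M "Suc M"] by simp
qed

lemma invertible_plus_compact_surj:
  fixes X Y K :: hop
  assumes Y: "Y \<in> bounded_ops" "\<And>f. Y (X f) = f" "\<And>f. X (Y f) = f"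
    and K: "K \<in> compact_ops" and inj: "\<And>f. X f + K f = 0 \<Longrightarrow> f = 0"
  shows "\<exists>f. X f + K f = g"
proof -
  define L where "L = Y o\<^sub>L K"
  have L: "L \<in> compact_ops" unfolding L_def by (rule compose_left_in_compact_ops[OF Y(1) K])
  have XL: "X (f + L f) = X f + K f" for f by (simp add: L_def blinfun.add_right Y)
  have "f = 0" if "f + L f = 0" for f
  proof (rule inj)
    show "X f + K f = 0" unfolding XL[symmetric] that by simp
  qed
  from id_plus_compact_surj[OF L this, of "Y g"] obtain f where "f + L f = Y g" by blast
  then have "X f + K f = g" using XL[of f] Y(3) by simp
  then show ?thesis by blast
qed

lemma finite_dim_basis:
  assumes "finite_dim V"
  obtains B where "B \<subseteq> V" "finite B" "hardy2.independent B" "V \<subseteq> hardy2.span B" "card B = hardy2.dim V"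
proof -
  obtain F where F: "finite F" "V \<subseteq> hardy2.span F" using assms by (auto simp: finite_dim_def)
  obtain B where B: "B \<subseteq> V" "hardy2.independent B" "V \<subseteq> hardy2.span B" "card B = hardy2.dim V"
    by (rule hardy2.basis_exists)
  have "finite B" using hardy2.independent_span_bound[OF F(1) B(2)] B(1) F(2) by blast
  then show ?thesis using that B by blast
qed

text \<open>If the cokernel were larger than the kernel, a finite-rank operator mapping the kernel
  injectively, but not onto, the orthogonal complement of the range could be added to obtain an
  injective operator that is not surjective.\<close>

lemma invertible_plus_compact_dim_le:
  fixes X Y K :: hop
  assumes X: "X \<in> bounded_ops"
    and Y: "Y \<in> bounded_ops" "\<And>f. Y (X f) = f" "\<And>f. X (Y f) = f" and K: "K \<in> compact_ops"
    and fin: "finite_dim (op_kernel (X + K))" "finite_dim (op_kernel (op_adjoint (X + K)))"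
  shows "hardy2.dim (op_kernel (op_adjoint (X + K))) \<le> hardy2.dim (op_kernel (X + K))"
proof (rule ccontr)
  define T where "T = X + K"
  have T: "T \<in> bounded_ops" unfolding T_def using X K compact_ops_bounded by (intro add_in_bounded_ops) auto
  assume "\<not> ?thesis"
  then have less: "hardy2.dim (op_kernel T) < hardy2.dim (op_kernel (op_adjoint T))" by (simp add: T_def)
  obtain B where B: "B \<subseteq> op_kernel T" "finite B" "hardy2.independent B" "op_kernel T \<subseteq> hardy2.span B"
      "card B = hardy2.dim (op_kernel T)"
    by (rule finite_dim_basis[OF fin(1)[folded T_def]])
  obtain D where D: "D \<subseteq> op_kernel (op_adjoint T)" "finite D" "hardy2.independent D"
      "op_kernel (op_adjoint T) \<subseteq> hardy2.span D" "card D = hardy2.dim (op_kernel (op_adjoint T))"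
    by (rule finite_dim_basis[OF fin(2)[folded T_def]])
  obtain \<pi> where \<pi>: "\<pi> ` B \<subseteq> D" "inj_on \<pi> B"
    using card_le_inj[OF B(2) D(2)] less B(5) D(5) by auto
  have "card (\<pi> ` B) < card D" using card_image[OF \<pi>(2)] less B(5) D(5) by simp
  then obtain y where y: "y \<in> D" "y \<notin> \<pi> ` B" using \<pi>(1) by (metis less_irrefl subsetI subset_antisym)
  define F where "F = (\<Sum>b\<in>B. rank_one b (\<pi> b))"
  have F: "F f = (\<Sum>b\<in>B. hinner f b *\<^sub>h \<pi> b)" for f
    by (simp add: F_def blinfun.sum_left rank_one_apply)
  have Fspan: "F f \<in> hardy2.span (\<pi> ` B)" for f
    unfolding F by (intro hardy2.span_sum hardy2.span_scale hardy2.span_base) auto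
  have subK: "hardy2.subspace (op_kernel (op_adjoint T))"
    by (intro subspace_op_kernel op_adjoint_in_bounded_ops T)
  have Fker: "F f \<in> op_kernel (op_adjoint T)" for f
    using Fspan hardy2.span_minimal[OF _ subK, of "\<pi> ` B"] \<pi>(1) D(1) by blast
  have orth: "T f = 0" if "T f \<in> op_kernel (op_adjoint T)" for f
  proof -
    have "hinner (T f) (T f) = hinner f (op_adjoint T (T f))" by (rule hinner_op_adjoint[OF T])
    also have "\<dots> = 0" using that by (simp add: op_kernel_def)
    finally show ?thesis by simp
  qed
  have inj: "f = 0" if eq: "X f + (K + F) f = 0" for f
  proof -
    have eq: "T f + F f = 0" using eq by (simp add: T_def blinfun.add_left add.assoc)
    then have "T f = - F f" by (simp add: add_eq_0_iff2)
    moreover have "- F f \<in> op_kernel (op_adjoint T)" using hardy2.subspace_neg[OF subK Fker] .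
    ultimately have Tf: "T f = 0" by (intro orth) simp
    then have "(\<Sum>b\<in>B. hinner f b *\<^sub>h \<pi> b) = 0" using eq by (simp add: F)
    then have zero: "(\<Sum>v\<in>\<pi> ` B. hinner f (the_inv_into B \<pi> v) *\<^sub>h v) = 0"
      by (simp add: sum.reindex[OF \<pi>(2)] the_inv_into_f_f[OF \<pi>(2)])
    have z: "hinner f (the_inv_into B \<pi> v) = 0" if "v \<in> \<pi> ` B" for v
      by (rule hardy2.independentD[OF D(3) finite_imageI[OF B(2)] \<pi>(1) zero that])
    have "hinner f b = 0" if "b \<in> B" for b using z[of "\<pi> b"] that by (simp add: the_inv_into_f_f[OF \<pi>(2)])
    moreover have "hardy2.subspace {g. hinner f g = 0}"
      by (simp add: hardy2.subspace_def hinner_add_right hinner_hscale_right)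
    ultimately have "hardy2.span B \<subseteq> {g. hinner f g = 0}" by (intro hardy2.span_minimal) auto
    moreover have "f \<in> op_kernel T" using Tf by (simp add: op_kernel_def)
    ultimately have "hinner f f = 0" using B(4) by blast
    then show ?thesis by simp
  qed
  have KF: "K + F \<in> compact_ops"
    unfolding F_def by (intro add_in_compact_ops K sum_in_compact_ops rank_one_in_compact_ops)
  obtain f where f: "X f + (K + F) f = y"
    using invertible_plus_compact_surj[OF Y KF inj] by blast
  then have "T f = y - F f" by (simp add: T_def blinfun.add_left algebra_simps)
  moreover have "y - F f \<in> op_kernel (op_adjoint T)" using subspace_diff[OF subK _ Fker] y(1) D(1) by blast
 ultimately have "T f = 0" by (intro orth) simp
  then have "y = F f" using \<open>T f = y - F f\<close> by simp
  then have "y \<in> hardy2.span (D - {y})"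
    using Fspan hardy2.span_mono[of "\<pi> ` B" "D - {y}"] \<pi>(1) y(2) by blast
  then show False using D(3) y(1) by (auto simp: hardy2.dependent_def)
qed

section \<open>Essential commutants of weakly null unitaries\<close>

text \<open>\<open>V n\<close> is both the inverse and the adjoint of \<open>U n\<close>. Since the compact operators annihilate weakly
  null sequences in the limit, the commutant of such a sequence meets them only in zero.\<close>

locale weakly_null_unitaries =
  fixes U V :: "nat \<Rightarrow> hop"
  assumes U: "U n \<in> bounded_ops"
    and UV: "U n (V n f) = f" and VU: "V n (U n f) = f"
    and adj: "hinner (U n f) g = hinner f (V n g)"
    and weak: "(\<lambda>n. hinner (U n f) g) \<longlonglongrightarrow> 0"
begin

lemma norm_U: "norm (U n f) = norm f"
proof -
  have "hinner (U n f) (U n f) = hinner f f" by (simp add: adj VU)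
  then have "(norm (U n f))\<^sup>2 = (norm f)\<^sup>2" by (simp only: hinner_self_norm of_real_eq_iff)
  then show ?thesis by (simp add: power2_eq_iff_nonneg)
qed

definition commutant :: "hop set" where
  "commutant = {X \<in> bounded_ops. \<forall>n f. X (U n f) = U n (X f)}"

lemma commutantD: "X \<in> commutant \<Longrightarrow> X \<in> bounded_ops" "X \<in> commutant \<Longrightarrow> X (U n f) = U n (X f)"
  by (auto simp: commutant_def)

lemma commutant_V: "X \<in> commutant \<Longrightarrow> X (V n f) = V n (X f)"
  using commutantD(2)[of X n "V n f"] by (metis UV VU)

lemma adjoint_in_commutant:
  assumes X: "X \<in> commutant"
  shows "op_adjoint X \<in> commutant"
  unfolding commutant_def
proof (intro CollectI conjI allI)
  note Xb = commutantD(1)[OF X]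
  show "op_adjoint X \<in> bounded_ops" by (rule op_adjoint_in_bounded_ops[OF Xb])
  show "op_adjoint X (U n f) = U n (op_adjoint X f)" for n f
    by (rule hinner_ext) (simp add: hinner_op_adjoint_left[OF Xb] adj commutant_V[OF X])
qed

lemma compact_U_null: "K \<in> compact_ops \<Longrightarrow> (\<lambda>n. K (U n f)) \<longlonglongrightarrow> 0"
  by (rule compact_op_weakly_null[of _ _ "norm f"]) (auto simp: norm_U weak)

text \<open>An element of the commutant sees the same vector again far out along the weakly null
  sequence, where the compact perturbation has died.\<close>

lemma norm_le_plus_compact:
  assumes X: "X \<in> commutant" and K: "K \<in> compact_ops"
  shows "norm X \<le> norm (X + K)"
proof (rule norm_blinfun_bound)
  fix f
  have "norm (X f) \<le> norm (X + K) * norm f + norm (K (U n f))" for n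
  proof -
    have "norm (X f) = norm ((X + K) (U n f) - K (U n f))"
      by (simp add: blinfun.add_left commutantD(2)[OF X] norm_U)
    also have "\<dots> \<le> norm ((X + K) (U n f)) + norm (K (U n f))" by (rule norm_triangle_ineq4)
    also have "norm ((X + K) (U n f)) \<le> norm (X + K) * norm f" using norm_blinfun[of "X + K" "U n f"] by (simp add: norm_U)
    finally show ?thesis by simp
  qed
  moreover have "(\<lambda>n. norm (X + K) * norm f + norm (K (U n f))) \<longlonglongrightarrow> norm (X + K) * norm f + norm (0::hardy2)"
    by (intro tendsto_intros compact_U_null K)
  ultimately show "norm (X f) \<le> norm (X + K) * norm f" by (intro LIMSEQ_le_const) auto
qed simp

lemma closed_commutant: "closed commutant"
proof (rule closed_sequentiallyI)
  fix X :: "nat \<Rightarrow> hop" and Z assume X: "\<And>n. X n \<in> commutant" and lim: "X \<longlonglongrightarrow> Z"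
  have "Z (U n f) = U n (Z f)" for n f
  proof (rule LIMSEQ_unique)
    show "(\<lambda>k. X k (U n f)) \<longlonglongrightarrow> Z (U n f)" by (rule blinfun_tendsto_apply[OF lim])
    show "(\<lambda>k. X k (U n f)) \<longlonglongrightarrow> U n (Z f)"
      unfolding commutantD(2)[OF X] by (intro blinfun.tendsto tendsto_const blinfun_tendsto_apply[OF lim])
  qed
  moreover have "Z \<in> bounded_ops"
    by (rule closed_sequentially[OF closed_bounded_ops _ lim]) (use X commutantD(1) in blast)
  ultimately show "Z \<in> commutant" by (simp add: commutant_def)
qed

definition essential_commutant :: "hop set" where
  "essential_commutant = {X + K | X K. X \<in> commutant \<and> K \<in> compact_ops}"

text \<open>By the previous estimate the commuting parts of a convergent sequence form a Cauchy sequence.\<close>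

lemma closed_essential_commutant: "closed essential_commutant"
proof (rule closed_sequentiallyI)
  fix T :: "nat \<Rightarrow> hop" and S assume T: "\<And>n. T n \<in> essential_commutant" and lim: "T \<longlonglongrightarrow> S"
  have "\<forall>n. \<exists>X K. T n = X + K \<and> X \<in> commutant \<and> K \<in> compact_ops"
    using T by (auto simp: essential_commutant_def)
  then obtain X K where XK: "\<And>n. T n = X n + K n" "\<And>n. X n \<in> commutant" "\<And>n. K n \<in> compact_ops" by metis
  have le: "norm (X m - X n) \<le> norm (T m - T n)" for m n
  proof -
    have "X m - X n \<in> commutant"
      using XK(2) by (auto simp: commutant_def diff_in_bounded_ops blinfun.diff_left blinfun.diff_right)
    from norm_le_plus_compact[OF this diff_in_compact_ops[OF XK(3) XK(3)], of m n]
    show ?thesis by (simp add: XK(1) algebra_simps)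
  qed
  have "Cauchy X"
  proof (rule CauchyI)
    fix e :: real assume "0 < e"
    then obtain M where "\<And>m n. m \<ge> M \<Longrightarrow> n \<ge> M \<Longrightarrow> norm (T m - T n) < e"
      using CauchyD[OF LIMSEQ_imp_Cauchy[OF lim]] by blast
    then show "\<exists>M. \<forall>m\<ge>M. \<forall>n\<ge>M. norm (X m - X n) < e" using le by (meson le_less_trans)
  qed
  then obtain Z where Z: "X \<longlonglongrightarrow> Z" using Cauchy_convergent convergent_def by blast
  have "K \<longlonglongrightarrow> S - Z" using tendsto_diff[OF lim Z] by (simp add: XK(1))
  then have "S - Z \<in> compact_ops" using closed_sequentially[OF closed_compact_ops] XK(3) by blast
  moreover have "Z \<in> commutant" using closed_sequentially[OF closed_commutant] XK(2) Z by blast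
  ultimately show "S \<in> essential_commutant" unfolding essential_commutant_def
    by (intro CollectI exI[of _ Z] exI[of _ "S - Z"]) simp
qed

lemma unital_cstar_algebra_essential_commutant: "unital_cstar_algebra essential_commutant"
  unfolding unital_cstar_algebra_def
proof (intro conjI ballI allI)
  have I: "X + K \<in> essential_commutant" if "X \<in> commutant" "K \<in> compact_ops" for X K
    using that by (auto simp: essential_commutant_def)
  show "essential_commutant \<subseteq> bounded_ops"
    by (auto simp: essential_commutant_def commutant_def compact_ops_bounded add_in_bounded_ops)
  have "id_blinfun + 0 \<in> essential_commutant" by (intro I zero_in_compact_ops) (simp add: commutant_def)
  then show "id_blinfun \<in> essential_commutant" by simp
  show "closed essential_commutant" by (rule closed_essential_commutant)
  fix T assume "T \<in> essential_commutant"
  then obtain X K where T: "T = X + K" and X: "X \<in> commutant" and K: "K \<in> compact_ops"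
    by (auto simp: essential_commutant_def)
  note b = commutantD(1)[OF X] compact_ops_bounded[OF K]
  have "op_adjoint T = op_adjoint X + op_adjoint K" unfolding T by (rule op_adjoint_add[OF b])
  then show "op_adjoint T \<in> essential_commutant"
    by (simp add: I adjoint_in_commutant X op_adjoint_in_compact_ops K)
  show "op_scale c T \<in> essential_commutant" for c
  proof -
    have "op_scale c T = op_scale c X + op_scale c K"
      by (rule blinfun_eqI) (simp add: T op_scale_apply blinfun.add_left hardy2.scale_right_distrib)
    moreover have "op_scale c X \<in> commutant"
      using X by (auto simp: commutant_def op_scale_in_bounded_ops op_scale_apply bounded_opsD[OF U])
    ultimately show ?thesis by (simp add: I op_scale_in_compact_ops K)
  qed
  fix S assume "S \<in> essential_commutant"
  then obtain X' K' where S: "S = X' + K'" and X': "X' \<in> commutant" and K': "K' \<in> compact_ops"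
    by (auto simp: essential_commutant_def)
  note b' = commutantD(1)[OF X'] compact_ops_bounded[OF K']
  have "S + T = (X' + X) + (K' + K)" by (simp add: S T algebra_simps)
  moreover have "X' + X \<in> commutant"
    using X X' by (auto simp: commutant_def add_in_bounded_ops blinfun.add_left blinfun.add_right)
  ultimately show "S + T \<in> essential_commutant" by (simp add: I add_in_compact_ops K K')
  have "S o\<^sub>L T = (X' o\<^sub>L X) + ((X' o\<^sub>L K) + (K' o\<^sub>L T))"
    by (rule blinfun_eqI) (simp add: S T blinfun.add_left blinfun.add_right algebra_simps)
  moreover have "X' o\<^sub>L X \<in> commutant"
    using X X' by (auto simp: commutant_def compose_in_bounded_ops)
  moreover have "(X' o\<^sub>L K) + (K' o\<^sub>L T) \<in> compact_ops"
    using T b b' K K' by (intro add_in_compact_ops compose_left_in_compact_ops compose_right_in_compact_ops)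
      (auto simp: add_in_bounded_ops)
  ultimately show "S o\<^sub>L T \<in> essential_commutant" by (simp add: I)
qed

text \<open>The same displacement along the unitaries removes compact corrections from lower bounds.\<close>

lemma commutant_bounded_below:
  assumes X: "X \<in> commutant" and K: "K \<in> compact_ops" and P: "P \<in> compact_ops"
    and C: "C > 0" and below: "\<And>f. norm (f - P f) \<le> C * norm (X f + K f)"
  shows "norm f \<le> C * norm (X f)"
proof -
  have "norm f \<le> C * (norm (X f) + norm (K (U n f))) + norm (P (U n f))" for n
  proof -
    have "norm f = norm ((U n f - P (U n f)) + P (U n f))" by (simp add: norm_U)
    also have "\<dots> \<le> norm (U n f - P (U n f)) + norm (P (U n f))" by (rule norm_triangle_ineq)
    also have "norm (U n f - P (U n f)) \<le> C * norm (X (U n f) + K (U n f))" by (rule below)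
    also have "norm (X (U n f) + K (U n f)) \<le> norm (X (U n f)) + norm (K (U n f))" by (rule norm_triangle_ineq)
    also have "norm (X (U n f)) = norm (X f)" by (simp add: commutantD(2)[OF X] norm_U)
    finally show ?thesis using C by simp
  qed
  moreover have "(\<lambda>n. C * (norm (X f) + norm (K (U n f))) + norm (P (U n f)))
      \<longlonglongrightarrow> C * (norm (X f) + norm (0::hardy2)) + norm (0::hardy2)"
    by (intro tendsto_intros compact_U_null K P)
  ultimately show ?thesis by (intro LIMSEQ_le_const) auto
qed

text \<open>A Fredholm operator and its adjoint are bounded below modulo compact operators. The displacement
  argument makes the commuting part bounded below together with its adjoint, hence invertible.\<close>

theorem fredholm_index_essential_commutant:
  assumes T: "T \<in> essential_commutant" and fred: "fredholm T"
  shows "fredholm_index T = 0"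
proof -
  obtain X K where TXK: "T = X + K" and X: "X \<in> commutant" and K: "K \<in> compact_ops"
    using T by (auto simp: essential_commutant_def)
  note Xb = commutantD(1)[OF X] and Kb = compact_ops_bounded[OF K]
  have Tb: "T \<in> bounded_ops" and cl: "closed (range (blinfun_apply T))"
    and ker: "finite_dim (op_kernel T)" and coker: "finite_dim (op_kernel (op_adjoint T))"
    using fred by (auto simp: fredholm_def)
  let ?X = "op_adjoint X" and ?K = "op_adjoint K"
  have adjT: "op_adjoint T = ?X + ?K" unfolding TXK by (rule op_adjoint_add[OF Xb Kb])
  note X'b = op_adjoint_in_bounded_ops[OF Xb] and K' = op_adjoint_in_compact_ops[OF K]
  obtain C P where C: "C > 0" "P \<in> compact_ops" "\<And>f. norm (f - P f) \<le> C * norm (T f)"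
    using bounded_below_modulo_compact[OF cl ker] by blast
  have Xlow: "norm f \<le> C * norm (X f)" for f
    by (rule commutant_bounded_below[OF X K C(2,1)]) (use C(3) in \<open>simp add: TXK blinfun.add_left\<close>)
  \<comment> \<open>The adjoint is bounded below on the range of T, which it pairs with bounded preimages.\<close>
  obtain C' where C': "C' > 0" "\<And>f. \<exists>f'. T f' = T f \<and> norm f' \<le> C' * norm (T f)"
    using closed_range_preimage_bound[OF cl] by blast
  have low: "norm g \<le> C' * norm (op_adjoint T g)" if "g \<in> range (blinfun_apply T)" for g
  proof (cases "g = 0")
    case False
    obtain h where h: "g = T h" using \<open>g \<in> range (blinfun_apply T)\<close> by blast
    obtain f where f: "T f = g" "norm f \<le> C' * norm g" using C'(2)[of h] unfolding h by blast
    have "(norm g)\<^sup>2 = cmod (hinner g g)" by (simp add: hinner_self_norm norm_power)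
    also have "hinner g g = hinner f (op_adjoint T g)" using hinner_op_adjoint[OF Tb, of f g] f by simp
    also have "cmod \<dots> \<le> norm f * norm (op_adjoint T g)" by (rule cmod_hinner_le)
    also have "\<dots> \<le> C' * norm g * norm (op_adjoint T g)" by (intro mult_right_mono f) simp
    finally have "norm g * norm g \<le> norm g * (C' * norm (op_adjoint T g))"
      by (simp add: power2_eq_square algebra_simps)
    then show ?thesis using False by simp
  qed (use C' in simp)
  obtain D where D: "finite D" "op_kernel (op_adjoint T) \<subseteq> hardy2.span D"
      "D \<subseteq> op_kernel (op_adjoint T)"
    by (rule finite_dim_basis[OF coker]) blast
  obtain Q where Q: "Q \<in> compact_ops" "\<And>k. k \<in> hardy2.span D \<Longrightarrow> Q k = k" "\<And>f. Q f \<in> hardy2.span D"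
      "\<And>f g. hinner (Q f) g = hinner f (Q g)"
    using finite_dim_projection[OF D(1)] by blast
  have Qker: "Q g \<in> op_kernel (op_adjoint T)" for g
    using Q(3) hardy2.span_minimal[OF D(3) subspace_op_kernel[OF op_adjoint_in_bounded_ops[OF Tb]]] by blast
  have "norm (g - Q g) \<le> C' * norm (op_adjoint T g)" for g
  proof -
    have "hinner (g - Q g) k = 0" if "k \<in> op_kernel (op_adjoint T)" for k
      using that Q(2)[of k] D(2) by (auto simp: hinner_diff_left Q(4))
    then have "g - Q g \<in> range (blinfun_apply T)"
      using closed_range_eq_orthogonal[OF Tb cl] by blast
    moreover have "op_adjoint T (g - Q g) = op_adjoint T g"
      using Qker[of g] by (simp add: op_kernel_def blinfun.diff_right)
    ultimately show ?thesis using low[of "g - Q g"] by simp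
  qed
  then have X'low: "norm f \<le> C' * norm (?X f)" for f
    by (intro commutant_bounded_below[OF adjoint_in_commutant[OF X] K' Q(1) C'(1)]) (simp add: adjT blinfun.add_left)
  have "closed (blinfun_apply X ` UNIV)"
  proof (rule bounded_below_closed_image)
    show "1 / C > 0" using C by simp
    show "1 / C * norm f \<le> norm (X f)" for f using Xlow[of f] C by (simp add: field_simps)
  qed simp
  then have "range (blinfun_apply X) = UNIV"
  proof (rule closed_subspace_eq_UNIV[OF subspace_range[OF Xb]])
    fix f assume "\<And>v. v \<in> range (blinfun_apply X) \<Longrightarrow> hinner f v = 0"
    then have "hinner (?X f) g = 0" for g by (simp add: hinner_op_adjoint_left[OF Xb])
    then have "?X f = 0" by (intro hinner_ext) simp
    then show "f = 0" using X'low[of f] by simp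
  qed
  then obtain y where y: "\<And>g. X (y g) = g" by (metis surj_def)
  have inj: "f = g" if "X f = X g" for f g using Xlow[of "f - g"] that by (simp add: blinfun.diff_right)
  obtain Y where Y: "Y \<in> bounded_ops" "\<And>f. Y f = y f"
  proof (rule bounded_op_exists[of y C])
    show "y (f + g) = y f + y g" for f g by (rule inj) (simp add: y blinfun.add_right)
    show "y (c *\<^sub>h f) = c *\<^sub>h y f" for c f by (rule inj) (simp add: y bounded_opsD[OF Xb])
    show "norm (y f) \<le> C * norm f" for f using Xlow[of "y f"] by (simp add: y)
  qed blast
  have XY: "X (Y f) = f" and YX: "Y (X f) = f" for f using y inj by (simp_all add: Y(2))
  have "hardy2.dim (op_kernel (op_adjoint T)) \<le> hardy2.dim (op_kernel T)"
    using invertible_plus_compact_dim_le[OF Xb Y(1) YX XY K] ker coker unfolding TXK by blast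
  moreover have "hardy2.dim (op_kernel T) \<le> hardy2.dim (op_kernel (op_adjoint T))"
  proof -
    let ?Y = "op_adjoint Y"
    have "?Y (?X f) = f" for f
      by (rule hinner_ext) (simp add: hinner_op_adjoint_left[OF Xb] hinner_op_adjoint_left[OF Y(1)] XY)
    moreover have "?X (?Y f) = f" for f
      by (rule hinner_ext) (simp add: hinner_op_adjoint_left[OF Xb] hinner_op_adjoint_left[OF Y(1)] YX)
    moreover have "op_adjoint (?X + ?K) = T" using op_adjoint_op_adjoint[OF Tb] by (simp add: adjT)
    ultimately show ?thesis
      using invertible_plus_compact_dim_le[OF X'b op_adjoint_in_bounded_ops[OF Y(1)] _ _ K'] ker coker
      by (simp add: adjT)
  qed
  ultimately show ?thesis by (simp add: fredholm_index_def)
qed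

end

section \<open>Bounded functions and Hilbert--Schmidt operators\<close>

text \<open>Discrete Parseval identity: the columns of the Fourier matrix are orthogonal because the
  powers of a root of unity other than one sum to zero.\<close>

lemma sum_roots_of_unity:
  assumes "k < L" "l < L"
  shows "(\<Sum>j<L. (exp (2 * of_real pi * \<i> * of_nat k / of_nat L) *
      cnj (exp (2 * of_real pi * \<i> * of_nat l / of_nat L))) ^ j) = (if k = l then of_nat L else 0)"
proof -
  define x where "x k = exp (2 * of_real pi * \<i> * of_nat k / of_nat L)" for k
  have L: "L \<ge> 1" using assms by simp
  have norm: "x k * cnj (x k) = 1" for k
    by (simp add: x_def exp_cnj exp_add[symmetric])
  have pow: "x k ^ L = 1" for k
    using L by (simp add: x_def exp_of_nat_mult[symmetric] exp_eq_1) (metis of_int_of_nat_eq)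
  define q where "q = x k * cnj (x l)"
  have qL: "q ^ L = 1" by (simp add: q_def power_mult_distrib pow complex_cnj_power[symmetric])
  show ?thesis
  proof (cases "k = l")
    case True
    then show ?thesis using norm[of l] by (simp add: x_def)
  next
    case False
    have "x k \<noteq> x l" unfolding x_def
      using False assms complex_root_unity_eq[OF L, of k l] by simp
    have "q \<noteq> 1"
    proof
      assume "q = 1"
      then have "x k * (x l * cnj (x l)) = x l" by (simp add: q_def mult.assoc mult.left_commute)
      then show False using norm \<open>x k \<noteq> x l\<close> by simp
    qed
    then have "(\<Sum>j<L. q ^ j) = 0" by (simp add: geometric_sum qL)
    then show ?thesis using False by (simp add: q_def x_def)
  qed
qed

lemma discrete_parseval:
  fixes b :: "nat \<Rightarrow> complex"
  assumes L: "L > 0"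
  defines "w \<equiv> \<lambda>j. exp (2 * of_real pi * \<i> * of_nat j / of_nat L)"
  shows "(\<Sum>j<L. (cmod (\<Sum>k<L. b k * w j ^ k))\<^sup>2) = real L * (\<Sum>k<L. (cmod (b k))\<^sup>2)"
proof -
  have sw: "w j ^ k = w k ^ j" for j k
    by (simp add: w_def exp_of_nat_mult[symmetric] mult_ac)
  have "of_real (\<Sum>j<L. (cmod (\<Sum>k<L. b k * w j ^ k))\<^sup>2)
      = (\<Sum>j<L. (\<Sum>k<L. b k * w j ^ k) * cnj (\<Sum>k<L. b k * w j ^ k))"
    by (simp only: of_real_sum complex_norm_square)
  also have "\<dots> = (\<Sum>j<L. \<Sum>k<L. \<Sum>l<L. b k * cnj (b l) * (w k * cnj (w l)) ^ j)"
  proof (rule sum.cong[OF refl])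
    fix j
    show "(\<Sum>k<L. b k * w j ^ k) * cnj (\<Sum>k<L. b k * w j ^ k)
        = (\<Sum>k<L. \<Sum>l<L. b k * cnj (b l) * (w k * cnj (w l)) ^ j)"
      unfolding cnj_sum sum_product sw[of j] by (simp add: power_mult_distrib mult_ac)
  qed
  also have "\<dots> = (\<Sum>k<L. \<Sum>j<L. \<Sum>l<L. b k * cnj (b l) * (w k * cnj (w l)) ^ j)"
    by (rule sum.swap)
  also have "\<dots> = (\<Sum>k<L. \<Sum>l<L. \<Sum>j<L. b k * cnj (b l) * (w k * cnj (w l)) ^ j)"
    by (intro sum.cong refl sum.swap)
  also have "\<dots> = (\<Sum>k<L. \<Sum>l<L. b k * cnj (b l) * (if k = l then of_nat L else 0))"
    unfolding w_def by (intro sum.cong refl) (simp add: sum_distrib_left[symmetric] sum_roots_of_unity)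
  also have "\<dots> = (\<Sum>k<L. of_nat L * (b k * cnj (b k)))"
    by (intro sum.cong refl) (simp add: if_distrib[of "\<lambda>x. _ * x"] mult_ac cong: if_cong)
  also have "\<dots> = of_real (real L * (\<Sum>k<L. (cmod (b k))\<^sup>2))"
    by (simp add: sum_distrib_left complex_norm_square[symmetric] del: of_real_power)
  finally show ?thesis by (simp only: of_real_eq_iff)
qed

text \<open>Averages of the square modulus over equidistant points of a circle of radius r < 1 bound the
  coefficients of the Taylor polynomials, which converge uniformly on the circle.\<close>

lemma sum_taylor_coeff_le:
  fixes g :: "nat \<Rightarrow> complex \<Rightarrow> complex"
  assumes hol: "\<And>n. n < N \<Longrightarrow> g n holomorphic_on ball 0 1"
    and bound: "\<And>z. z \<in> ball 0 1 \<Longrightarrow> (\<Sum>n<N. (cmod (g n z))\<^sup>2) \<le> C"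
  shows "(\<Sum>n<N. \<Sum>k<M. (cmod (taylor_coeff (g n) k))\<^sup>2) \<le> C"
proof -
  define a where "a n k = taylor_coeff (g n) k" for n k
  have C0: "C \<ge> 0" using bound[of 0] by (meson centre_in_ball order_trans sum_nonneg zero_le_power2 zero_less_one)
  have circle: "(\<Sum>n<N. \<Sum>k<M. (cmod (a n k))\<^sup>2 * (r ^ k)\<^sup>2) \<le> C" if r: "0 < r" "r < 1" for r
  proof -
    have sums: "(\<lambda>k. a n k * z ^ k) sums g n z" if "n < N" "z \<in> ball 0 1" for n z
      using holomorphic_power_series[OF hol[OF that(1)] that(2)] by (simp add: a_def taylor_coeff_def)
    have abs: "summable (\<lambda>k. cmod (a n k) * r ^ k)" if "n < N" for n
    proof -
      have "summable (\<lambda>k. a n k * of_real ((1 + r) / 2) ^ k)"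
        using sums[OF that, of "of_real ((1 + r) / 2)"] r by (simp add: sums_iff del: of_real_add of_real_divide)
      from powser_insidea[OF this, of "of_real r"] show ?thesis
        using r by (simp add: norm_mult norm_power del: of_real_add of_real_divide)
    qed
    define \<tau> where "\<tau> n L = (\<Sum>k. cmod (a n (k + L)) * r ^ (k + L))" for n L
    have tau: "(\<lambda>L. \<tau> n L) \<longlonglongrightarrow> 0" if "n < N" for n
      unfolding \<tau>_def using suminf_exist_split2[OF abs[OF that]] .
    have near: "cmod (\<Sum>k<L. a n k * z ^ k) \<le> cmod (g n z) + \<tau> n L" if "n < N" "cmod z = r" for n z L
    proof -
      have z: "z \<in> ball 0 1" using that r by simp
      have sm: "summable (\<lambda>k. a n k * z ^ k)" using sums[OF that(1) z] by (rule sums_summable)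
      have sm': "summable (\<lambda>k. cmod (a n (k + L) * z ^ (k + L)))"
        using summable_ignore_initial_segment[OF abs[OF that(1)], of L] that(2) by (simp add: norm_mult norm_power)
      have "g n z = (\<Sum>k. a n (k + L) * z ^ (k + L)) + (\<Sum>k<L. a n k * z ^ k)"
        using suminf_split_initial_segment[OF sm, of L] sums[OF that(1) z] by (simp add: sums_iff)
      then have "(\<Sum>k<L. a n k * z ^ k) = g n z - (\<Sum>k. a n (k + L) * z ^ (k + L))" by simp
      then have "cmod (\<Sum>k<L. a n k * z ^ k) \<le> cmod (g n z) + cmod (\<Sum>k. a n (k + L) * z ^ (k + L))"
        by (simp add: norm_triangle_ineq4)
      also have "cmod (\<Sum>k. a n (k + L) * z ^ (k + L)) \<le> \<tau> n L"
        using summable_norm[OF sm'] that(2) by (simp add: \<tau>_def norm_mult norm_power)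
      finally show ?thesis by simp
    qed
    define err where "err L = (\<Sum>n<N. 2 * sqrt C * \<tau> n L + (\<tau> n L)\<^sup>2)" for L
    have main: "(\<Sum>n<N. \<Sum>k<M. (cmod (a n k))\<^sup>2 * (r ^ k)\<^sup>2) \<le> C + err L"
      if L: "L \<ge> M" "L > 0" for L
    proof -
      define w where "w j = exp (2 * of_real pi * \<i> * of_nat j / of_nat L)" for j
      have nw: "cmod (of_real r * w j) = r" for j using r by (simp add: w_def norm_mult)
      have point: "(\<Sum>n<N. (cmod (\<Sum>k<L. a n k * (of_real r * w j) ^ k))\<^sup>2)
          \<le> C + err L" for j
      proof -
        let ?z = "of_real r * w j"
        have zb: "?z \<in> ball 0 1" using nw[of j] r by simp
        have "(cmod (\<Sum>k<L. a n k * ?z ^ k))\<^sup>2 \<le> (cmod (g n ?z))\<^sup>2 + (2 * sqrt C * \<tau> n L + (\<tau> n L)\<^sup>2)"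
          if n: "n < N" for n
        proof -
          have t0: "\<tau> n L \<ge> 0" unfolding \<tau>_def using r abs[OF n]
            by (intro suminf_nonneg summable_ignore_initial_segment) auto
          have "(cmod (g n ?z))\<^sup>2 \<le> (\<Sum>n<N. (cmod (g n ?z))\<^sup>2)"
            using n by (intro member_le_sum) auto
          then have gC: "cmod (g n ?z) \<le> sqrt C" using bound[OF zb] by (intro real_le_rsqrt) linarith
          have "(cmod (\<Sum>k<L. a n k * ?z ^ k))\<^sup>2 \<le> (cmod (g n ?z) + \<tau> n L)\<^sup>2"
            using near[OF n nw] by (intro power_mono) auto
          also have "\<dots> = (cmod (g n ?z))\<^sup>2 + (2 * cmod (g n ?z) * \<tau> n L + (\<tau> n L)\<^sup>2)"
            by (simp add: power2_sum)
          also have "2 * cmod (g n ?z) * \<tau> n L \<le> 2 * sqrt C * \<tau> n L"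
            using gC t0 by (intro mult_right_mono) auto
          finally show ?thesis by simp
        qed
        then have "(\<Sum>n<N. (cmod (\<Sum>k<L. a n k * ?z ^ k))\<^sup>2)
            \<le> (\<Sum>n<N. (cmod (g n ?z))\<^sup>2 + (2 * sqrt C * \<tau> n L + (\<tau> n L)\<^sup>2))"
          by (intro sum_mono) auto
        also have "\<dots> = (\<Sum>n<N. (cmod (g n ?z))\<^sup>2) + err L"
          unfolding err_def by (rule sum.distrib)
        finally show ?thesis using bound[OF zb] by linarith
      qed
      have pars: "(\<Sum>j<L. (cmod (\<Sum>k<L. a n k * (of_real r * w j) ^ k))\<^sup>2)
          = real L * (\<Sum>k<L. (cmod (a n k))\<^sup>2 * (r ^ k)\<^sup>2)" for n
        using discrete_parseval[OF L(2), of "\<lambda>k. a n k * of_real r ^ k"] r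
        by (simp add: w_def power_mult_distrib mult.assoc norm_mult norm_power)
      have "real L * (\<Sum>n<N. \<Sum>k<L. (cmod (a n k))\<^sup>2 * (r ^ k)\<^sup>2)
          = (\<Sum>j<L. \<Sum>n<N. (cmod (\<Sum>k<L. a n k * (of_real r * w j) ^ k))\<^sup>2)"
        by (subst sum.swap) (simp add: pars sum_distrib_left)
      also have "\<dots> \<le> (\<Sum>j<L. C + err L)"
        by (intro sum_mono point)
      also have "\<dots> = real L * (C + err L)" by simp
      finally have "(\<Sum>n<N. \<Sum>k<L. (cmod (a n k))\<^sup>2 * (r ^ k)\<^sup>2) \<le> C + err L"
        using L(2) by (simp only: mult_le_cancel_left_pos of_nat_0_less_iff)
      moreover have "(\<Sum>n<N. \<Sum>k<M. (cmod (a n k))\<^sup>2 * (r ^ k)\<^sup>2) \<le> (\<Sum>n<N. \<Sum>k<L. (cmod (a n k))\<^sup>2 * (r ^ k)\<^sup>2)"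
        using L(1) by (intro sum_mono sum_mono2) auto
      ultimately show ?thesis by linarith
    qed
    have "(\<lambda>L. C + err L) \<longlonglongrightarrow> C + (\<Sum>n<N. 2 * sqrt C * 0 + 0\<^sup>2)"
      unfolding err_def by (intro tendsto_intros tau) auto
    then have "(\<lambda>L. C + err L) \<longlonglongrightarrow> C" by simp
    then show ?thesis
      by (rule LIMSEQ_le_const) (use main in \<open>auto intro!: exI[of _ "Suc M"]\<close>)
  qed
  define r where "r m = 1 - 1 / real (m + 2)" for m
  have "(\<lambda>m. 1 / real (m + 2)) \<longlonglongrightarrow> 0" using LIMSEQ_ignore_initial_segment[OF lim_1_over_n, of 2] by simp
  then have r1: "r \<longlonglongrightarrow> 1 - 0" unfolding r_def by (intro tendsto_intros)
  have "(\<lambda>m. \<Sum>n<N. \<Sum>k<M. (cmod (a n k))\<^sup>2 * (r m ^ k)\<^sup>2) \<longlonglongrightarrow> (\<Sum>n<N. \<Sum>k<M. (cmod (a n k))\<^sup>2 * ((1 - 0) ^ k)\<^sup>2)"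
    by (intro tendsto_intros r1)
  then have "(\<Sum>n<N. \<Sum>k<M. (cmod (a n k))\<^sup>2 * ((1 - 0) ^ k)\<^sup>2) \<le> C"
    by (rule LIMSEQ_le_const2) (auto intro!: exI[of _ 0] circle simp: r_def)
  then show ?thesis by (simp add: a_def)
qed

lemma hardy2_of_bounded:
  assumes hol: "g holomorphic_on ball 0 1" and bound: "\<And>z. z \<in> ball 0 1 \<Longrightarrow> cmod (g z) \<le> B"
  obtains f where "\<And>z. z \<in> ball 0 1 \<Longrightarrow> hval f z = g z" "\<And>n. hcoeff f n = taylor_coeff g n"
proof -
  have "(\<Sum>n<Suc 0. \<Sum>k<M. (cmod (taylor_coeff g k))\<^sup>2) \<le> B\<^sup>2" for M
    by (rule sum_taylor_coeff_le) (use hol bound in \<open>auto intro!: power_mono\<close>)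
  from this[of "Suc _"] have "summable (\<lambda>k. (cmod (taylor_coeff g k))\<^sup>2)"
    by (intro bounded_imp_summable[of _ "B\<^sup>2"]) (auto simp: lessThan_Suc_atMost)
  then obtain f where f: "\<And>n. hcoeff f n = taylor_coeff g n" by (rule hardy2_of_coeffs) blast
  have "hval f z = g z" if "z \<in> ball 0 1" for z
  proof (rule sums_unique2[OF hval_sums[OF that]])
    show "(\<lambda>n. hcoeff f n * z ^ n) sums g z"
      using holomorphic_power_series[OF hol that] unfolding f unfolding taylor_coeff_def by simp
  qed
  then show ?thesis using f that by blast
qed

lemma szego_kernel:
  assumes "p \<in> ball 0 1"
  obtains k where "\<And>z. z \<in> ball 0 1 \<Longrightarrow> hval k z = 1 / (1 - cnj p * z)" "\<And>f. hinner f k = hval f p"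
proof -
  have p: "cmod p < 1" using assms by simp
  have "summable (\<lambda>n. ((cmod p)\<^sup>2) ^ n)" using p by (intro summable_geometric) (simp add: abs_square_less_1)
  then have "summable (\<lambda>n. (cmod (cnj p ^ n))\<^sup>2)" by (simp add: norm_power power_mult[symmetric] mult.commute)
  then obtain k where k: "\<And>n. hcoeff k n = cnj p ^ n" by (rule hardy2_of_coeffs) blast
  show ?thesis
  proof (rule that[of k])
    fix z :: complex assume z: "z \<in> ball 0 1"
    have "cmod (cnj p * z) < 1" using mult_strict_mono'[of "cmod p" 1 "cmod z" 1] p z by (simp add: norm_mult)
    from geometric_sums[OF this] have "(\<lambda>n. hcoeff k n * z ^ n) sums (1 / (1 - cnj p * z))"
      by (simp add: k power_mult_distrib)
    then show "hval k z = 1 / (1 - cnj p * z)" using hval_sums[OF z, of k] sums_unique2 by blast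
  next
    show "hinner f k = hval f p" for f
      using hval_sums[OF assms, of f] by (simp add: hinner_def k sums_iff)
  qed
qed

lemma hval_bound:
  obtains M where "M \<ge> 0" "\<And>f. cmod (hval f z) \<le> M * norm f"
proof (cases "z \<in> ball 0 1")
  case True
  obtain k where "\<And>f. hinner f k = hval f z" by (rule szego_kernel[OF True]) blast
  then show ?thesis using that[of "norm k"] cmod_hinner_le[of _ k] by (metis mult.commute norm_ge_zero)
next
  case False
  then show ?thesis using that[of 0] by (simp add: hval_eq_0)
qed

lemma bounded_linear_hval: "bounded_linear (\<lambda>f. hval f z)"
proof -
  obtain M where M: "\<And>f. cmod (hval f z) \<le> M * norm f" using hval_bound by blast
  show ?thesis
  proof (rule bounded_linear_intro)
    show "hval (r *\<^sub>R f) z = r *\<^sub>R hval f z" for r and f :: hardy2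
      by (simp add: hscale_of_real[symmetric] hval_hscale scaleR_conv_of_real)
    show "norm (hval f z) \<le> norm f * M" for f using M[of f] by (simp add: mult.commute)
  qed (rule hval_add)
qed

lemmas tendsto_hval = bounded_linear.tendsto[OF bounded_linear_hval]

lemma hval_sum: "hval (sum F A) z = (\<Sum>i\<in>A. hval (F i) z)"
  by (induction A rule: infinite_finite_induct) (auto simp: hval_add)

text \<open>Weighted composition operators whose weight decays where the symbol approaches the circle are
  Hilbert--Schmidt: the images of the monomials have square-summable norms.\<close>

lemma weighted_composition_compact:
  assumes hol: "h holomorphic_on ball 0 1" "\<phi> holomorphic_on ball 0 1"
    and self: "\<And>z. z \<in> ball 0 1 \<Longrightarrow> \<phi> z \<in> ball 0 1"
    and bound: "\<And>z. z \<in> ball 0 1 \<Longrightarrow> (cmod (h z))\<^sup>2 \<le> B * (1 - (cmod (\<phi> z))\<^sup>2)"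
  obtains K where "K \<in> compact_ops" "\<And>f z. z \<in> ball 0 1 \<Longrightarrow> hval (K f) z = h z * hval f (\<phi> z)"
proof -
  define g where "g n z = h z * \<phi> z ^ n" for n z
  have ghol: "g n holomorphic_on ball 0 1" for n unfolding g_def by (intro holomorphic_intros hol)
  have le: "(\<Sum>n<N. (cmod (g n z))\<^sup>2) \<le> B" if z: "z \<in> ball 0 1" for N z
  proof -
    define t where "t = (cmod (\<phi> z))\<^sup>2"
    have t: "0 \<le> t" "t < 1" using self[OF z] by (auto simp: t_def abs_square_less_1)
    have hb: "(cmod (h z))\<^sup>2 \<le> B * (1 - t)" using bound[OF z] by (simp add: t_def)
    then have B0: "B \<ge> 0" using t by (smt (verit) mult_neg_pos zero_le_power2)
    have "(\<Sum>n<N. (cmod (g n z))\<^sup>2) = (cmod (h z))\<^sup>2 * (\<Sum>n<N. t ^ n)"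
      by (simp add: g_def t_def norm_mult norm_power power_mult_distrib power_mult[symmetric] mult.commute sum_distrib_left)
    also have "\<dots> \<le> B * (1 - t) * (\<Sum>n<N. t ^ n)" using t by (intro mult_right_mono hb sum_nonneg) auto
    also have "\<dots> = B * (1 - t ^ N)" using one_diff_power_eq[of t N] by (simp add: mult.assoc)
    also have "\<dots> \<le> B * 1" using t B0 by (intro mult_left_mono) auto
    finally show ?thesis by simp
  qed
  have "cmod (g n z) \<le> sqrt B" if "z \<in> ball 0 1" for n z
  proof -
    have "(cmod (g n z))\<^sup>2 \<le> (\<Sum>n<Suc n. (cmod (g n z))\<^sup>2)" by (intro member_le_sum) auto
    also have "\<dots> \<le> B" by (rule le[OF that])
    finally show ?thesis by (rule real_le_rsqrt)
  qed
  then have "\<exists>f. (\<forall>z\<in>ball 0 1. hval f z = g n z) \<and> (\<forall>k. hcoeff f k = taylor_coeff (g n) k)" for n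
    using hardy2_of_bounded[OF ghol, of n] by metis
  then obtain G where G: "\<And>n z. z \<in> ball 0 1 \<Longrightarrow> hval (G n) z = g n z"
      "\<And>n k. hcoeff (G n) k = taylor_coeff (g n) k" by metis
  have hs: "(\<Sum>n<N. (norm (G n))\<^sup>2) \<le> B" for N
  proof (rule LIMSEQ_le_const2)
    show "(\<lambda>M. \<Sum>n<N. \<Sum>k<M. (cmod (hcoeff (G n) k))\<^sup>2) \<longlonglongrightarrow> (\<Sum>n<N. (norm (G n))\<^sup>2)"
      using norm_sq_sums by (intro tendsto_sum) (auto simp: sums_def)
    show "\<exists>M0. \<forall>M\<ge>M0. (\<Sum>n<N. \<Sum>k<M. (cmod (hcoeff (G n) k))\<^sup>2) \<le> B"
      unfolding G(2) using sum_taylor_coeff_le[OF ghol le] by blast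
  qed
  have sm: "summable (\<lambda>n. (norm (G n))\<^sup>2)"
    by (rule bounded_imp_summable[of _ B]) (use hs[of "Suc _"] in \<open>auto simp: lessThan_Suc_atMost\<close>)
  obtain e where e: "\<And>n k. hcoeff (e n) k = (if k = n then 1 else 0)" by (rule monomials) blast
  have he: "hinner f (e n) = hcoeff f n" for f n
  proof -
    have "(\<lambda>k. hcoeff f k * cnj (hcoeff (e n) k)) = (\<lambda>k. if k = n then hcoeff f k else 0)"
      by (auto simp: e)
    then show ?thesis unfolding hinner_def using sums_single[of n "hcoeff f"] by (simp add: sums_iff)
  qed
  define T where "T N = (\<Sum>n<N. rank_one (e n) (G n))" for N
  have Tc: "T N \<in> compact_ops" for N unfolding T_def by (intro sum_in_compact_ops rank_one_in_compact_ops)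
  have Tapp: "T N f = (\<Sum>n<N. hcoeff f n *\<^sub>h G n)" for N f
    by (simp add: T_def blinfun.sum_left rank_one_apply he)
  have diff: "norm (T N - T M) \<le> sqrt (\<Sum>n\<in>{M..<N}. (norm (G n))\<^sup>2)" if "M \<le> N" for M N
  proof (rule norm_blinfun_bound)
    fix f
    have "(T N - T M) f = (\<Sum>n\<in>{M..<N}. hcoeff f n *\<^sub>h G n)"
    proof -
      have "(\<Sum>n<N. hcoeff f n *\<^sub>h G n) = (\<Sum>n<M. hcoeff f n *\<^sub>h G n) + (\<Sum>n\<in>{M..<N}. hcoeff f n *\<^sub>h G n)"
        using that by (metis lessThan_atLeast0 sum.atLeastLessThan_concat zero_le)
      then show ?thesis by (simp add: blinfun.diff_left Tapp)
    qed
    then have "norm ((T N - T M) f) \<le> (\<Sum>n\<in>{M..<N}. cmod (hcoeff f n) * norm (G n))"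
      using norm_sum[of "\<lambda>n. hcoeff f n *\<^sub>h G n" "{M..<N}"] by (simp add: norm_hscale)
    also have "\<dots> \<le> L2_set (\<lambda>n. cmod (hcoeff f n)) {M..<N} * L2_set (\<lambda>n. norm (G n)) {M..<N}"
      using L2_set_mult_ineq[of "\<lambda>n. cmod (hcoeff f n)" "\<lambda>n. norm (G n)" "{M..<N}"] by simp
    also have "\<dots> \<le> norm f * L2_set (\<lambda>n. norm (G n)) {M..<N}"
    proof (rule mult_right_mono)
      show "L2_set (\<lambda>n. cmod (hcoeff f n)) {M..<N} \<le> norm f"
        unfolding L2_set_def by (intro real_le_lsqrt sum_hcoeff_le_norm) auto
    qed (rule L2_set_nonneg)
    finally show "norm ((T N - T M) f) \<le> sqrt (\<Sum>n\<in>{M..<N}. (norm (G n))\<^sup>2) * norm f"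
      by (simp add: L2_set_def mult.commute)
  qed (simp add: sum_nonneg)
  have "Cauchy T"
  proof (rule CauchyI')
    fix \<epsilon> :: real assume eps: "0 < \<epsilon>"
    then obtain M where M: "\<And>m n. m \<ge> M \<Longrightarrow> norm (\<Sum>k\<in>{m..<n}. (norm (G k))\<^sup>2) < \<epsilon>\<^sup>2"
      using sm unfolding summable_Cauchy by (metis zero_less_power)
    have "dist (T m) (T n) < \<epsilon>" if "m \<ge> M" "n > m" for m n
    proof -
      have "norm (T n - T m) \<le> sqrt (\<Sum>k\<in>{m..<n}. (norm (G k))\<^sup>2)" using diff that by simp
      also have "\<dots> < sqrt (\<epsilon>\<^sup>2)" using M[OF that(1), of n] by (intro real_sqrt_less_mono) simp
      finally show ?thesis using eps by (simp add: dist_norm norm_minus_commute)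
    qed
    then show "\<exists>M. \<forall>m\<ge>M. \<forall>n>m. dist (T m) (T n) < \<epsilon>" by blast
  qed
  then obtain K where K: "T \<longlonglongrightarrow> K" using Cauchy_convergent convergent_def by blast
  have "K \<in> compact_ops" using closed_sequentially[OF closed_compact_ops] Tc K by blast
  moreover have "hval (K f) z = h z * hval f (\<phi> z)" if z: "z \<in> ball 0 1" for f z
  proof (rule LIMSEQ_unique)
    show "(\<lambda>N. hval (T N f) z) \<longlonglongrightarrow> hval (K f) z" by (intro tendsto_hval blinfun_tendsto_apply K)
    have "(\<lambda>n. h z * (hcoeff f n * \<phi> z ^ n)) sums (h z * hval f (\<phi> z))"
      by (intro sums_mult hval_sums self z)
    then show "(\<lambda>N. hval (T N f) z) \<longlonglongrightarrow> h z * hval f (\<phi> z)"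
      by (simp add: Tapp hval_sum hval_hscale G(1)[OF z] g_def sums_def mult_ac)
  qed
  ultimately show ?thesis using that by blast
qed

section \<open>Operators defined on a total family\<close>

lemma closure_subspace:
  assumes V: "hardy2.subspace V"
  shows "hardy2.subspace (closure V)"
  unfolding hardy2.subspace_def
proof (intro conjI ballI allI)
  show "0 \<in> closure V" using hardy2.subspace_0[OF V] closure_subset by blast
  fix f assume "f \<in> closure V"
  then obtain x where x: "\<And>n. x n \<in> V" "x \<longlonglongrightarrow> f" by (auto simp: closure_sequential)
  show "c *\<^sub>h f \<in> closure V" for c unfolding closure_sequential
    by (rule exI[of _ "\<lambda>n. c *\<^sub>h x n"]) (auto intro!: hardy2.subspace_scale[OF V] x tendsto_hscale)
  fix g assume "g \<in> closure V"
  then obtain y where y: "\<And>n. y n \<in> V" "y \<longlonglongrightarrow> g" by (auto simp: closure_sequential)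
  show "f + g \<in> closure V" unfolding closure_sequential
    by (rule exI[of _ "\<lambda>n. x n + y n"]) (auto intro!: hardy2.subspace_add[OF V] x y tendsto_add)
qed

text \<open>Linear combinations, formed simultaneously for a whole family of vectors: an element of
  \<open>combinations G\<close> with values \<open>F s\<close> and \<open>F t\<close> records the same combination applied to the
  values of the generators at \<open>s\<close> and at \<open>t\<close>, so a linear map sending the generators at \<open>s\<close> to those
  at \<open>t\<close> must send \<open>F s\<close> to \<open>F t\<close>.\<close>

inductive_set combinations :: "('i \<Rightarrow> hardy2) set \<Rightarrow> ('i \<Rightarrow> hardy2) set" for G where
  zero: "(\<lambda>_. 0) \<in> combinations G"
| gen: "F \<in> G \<Longrightarrow> F \<in> combinations G"
| add: "F \<in> combinations G \<Longrightarrow> F' \<in> combinations G \<Longrightarrow> (\<lambda>i. F i + F' i) \<in> combinations G"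
| scale: "F \<in> combinations G \<Longrightarrow> (\<lambda>i. c *\<^sub>h F i) \<in> combinations G"

lemma subspace_combinations: "hardy2.subspace {F s | F. F \<in> combinations G}"
  unfolding hardy2.subspace_def
proof (intro conjI ballI allI)
  show "0 \<in> {F s | F. F \<in> combinations G}" using combinations.zero[of G] by force
  fix f assume "f \<in> {F s | F. F \<in> combinations G}"
  then obtain F where F: "F \<in> combinations G" "f = F s" by blast
  show "c *\<^sub>h f \<in> {F s | F. F \<in> combinations G}" for c
    using combinations.scale[OF F(1), of c] F(2) by force
  fix g assume "g \<in> {F s | F. F \<in> combinations G}"
  then obtain F' where F': "F' \<in> combinations G" "g = F' s" by blast
  show "f + g \<in> {F s | F. F \<in> combinations G}"
    using combinations.add[OF F(1) F'(1)] F(2) F'(2) by force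
qed

text \<open>The pairs \<open>(F s, F t)\<close> form a linear relation; by the norm bound its closure is the graph of a bounded
  operator, everywhere defined because the generators at \<open>s\<close> are total.\<close>

lemma operator_from_combinations:
  assumes total: "\<And>f. (\<And>F. F \<in> G \<Longrightarrow> hinner f (F s) = 0) \<Longrightarrow> f = 0"
    and bound: "\<And>F. F \<in> combinations G \<Longrightarrow> norm (F t) \<le> M * norm (F s)" and M: "M > 0"
  obtains A :: hop where "A \<in> bounded_ops" "\<And>F. F \<in> combinations G \<Longrightarrow> A (F s) = F t"
proof -
  let ?V = "{F s | F. F \<in> combinations G}"
  have dense: "closure ?V = UNIV"
  proof (rule closed_subspace_eq_UNIV)
    show "hardy2.subspace (closure ?V)" by (intro closure_subspace subspace_combinations)
    fix f assume "\<And>v. v \<in> closure ?V \<Longrightarrow> hinner f v = 0"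
    then show "f = 0"
      by (intro total) (use closure_subset[of ?V] combinations.gen in blast)
  qed simp
  define R where "R f g \<longleftrightarrow> (\<exists>X. (\<forall>n::nat. X n \<in> combinations G) \<and> (\<lambda>n. X n s) \<longlonglongrightarrow> f \<and> (\<lambda>n. X n t) \<longlonglongrightarrow> g)" for f g
  have R_add: "R (f + f') (g + g')" if "R f g" "R f' g'" for f f' g g'
  proof -
    obtain X X' where X: "\<And>n. X n \<in> combinations G" "(\<lambda>n. X n s) \<longlonglongrightarrow> f" "(\<lambda>n. X n t) \<longlonglongrightarrow> g"
        "\<And>n. X' n \<in> combinations G" "(\<lambda>n. X' n s) \<longlonglongrightarrow> f'" "(\<lambda>n. X' n t) \<longlonglongrightarrow> g'"
      using \<open>R f g\<close> \<open>R f' g'\<close> unfolding R_def by metis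
    show ?thesis unfolding R_def
      by (rule exI[of _ "\<lambda>n i. X n i + X' n i"]) (auto intro!: combinations.add tendsto_add X)
  qed
  have R_scale: "R (c *\<^sub>h f) (c *\<^sub>h g)" if "R f g" for c f g
  proof -
    obtain X where X: "\<And>n. X n \<in> combinations G" "(\<lambda>n. X n s) \<longlonglongrightarrow> f" "(\<lambda>n. X n t) \<longlonglongrightarrow> g"
      using \<open>R f g\<close> unfolding R_def by metis
    show ?thesis unfolding R_def
      by (rule exI[of _ "\<lambda>n i. c *\<^sub>h X n i"]) (auto intro!: combinations.scale tendsto_hscale X)
  qed
  have R_bound: "norm g \<le> M * norm f" if "R f g" for f g
  proof -
    obtain X where X: "\<And>n. X n \<in> combinations G" "(\<lambda>n. X n s) \<longlonglongrightarrow> f" "(\<lambda>n. X n t) \<longlonglongrightarrow> g"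
      using \<open>R f g\<close> unfolding R_def by metis
    show ?thesis
    proof (rule LIMSEQ_le)
      show "(\<lambda>n. norm (X n t)) \<longlonglongrightarrow> norm g" by (intro tendsto_norm X)
      show "(\<lambda>n. M * norm (X n s)) \<longlonglongrightarrow> M * norm f" by (intro tendsto_intros X)
    qed (use bound X(1) in blast)
  qed
  have R_diff: "R (f - f') (g - g')" if "R f g" "R f' g'" for f f' g g'
    using R_add[OF that(1) R_scale[OF that(2), of "-1"]] by simp
  have R_total: "\<exists>g. R f g" for f
  proof -
    have "f \<in> closure ?V" using dense by simp
    then obtain x where x: "\<And>n. x n \<in> ?V" "x \<longlonglongrightarrow> f" unfolding closure_sequential by blast
    then have "\<forall>n. \<exists>F. F \<in> combinations G \<and> x n = F s" by blast
    then obtain X where X: "\<And>n. X n \<in> combinations G" "\<And>n. x n = X n s" by metis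
    have "Cauchy (\<lambda>n. X n t)"
    proof (rule CauchyI)
      fix e :: real assume "0 < e"
      then have "0 < e / M" using M by simp
      then obtain N where N: "\<And>m n. m \<ge> N \<Longrightarrow> n \<ge> N \<Longrightarrow> norm (x m - x n) < e / M"
        using CauchyD[OF LIMSEQ_imp_Cauchy[OF x(2)]] by blast
      have "norm (X m t - X n t) < e" if "m \<ge> N" "n \<ge> N" for m n
      proof -
        have "(\<lambda>i. X m i + (-1) *\<^sub>h X n i) \<in> combinations G"
          by (intro combinations.add combinations.scale X)
        from bound[OF this] have "norm (X m t - X n t) \<le> M * norm (x m - x n)" by (simp add: X(2))
        also have "\<dots> < e" using N[OF that] M by (simp add: field_simps)
        finally show ?thesis .
      qed
      then show "\<exists>N. \<forall>m\<ge>N. \<forall>n\<ge>N. norm (X m t - X n t) < e" by blast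
    qed
    then obtain g where "(\<lambda>n. X n t) \<longlonglongrightarrow> g" using Cauchy_convergent convergent_def by blast
    moreover have "x = (\<lambda>n. X n s)" using X(2) by blast
    then have "(\<lambda>n. X n s) \<longlonglongrightarrow> f" using x(2) by simp
    ultimately have "R f g" using X(1) unfolding R_def by blast
    then show ?thesis by blast
  qed
  have R_unique: "g = g'" if "R f g" "R f g'" for f g g'
    using R_bound[OF R_diff[OF that]] by simp
  obtain a where a: "\<And>f. R f (a f)" using R_total by metis
  have a_eq: "R f g \<Longrightarrow> a f = g" for f g using R_unique[OF a] .
  obtain A :: hop where A: "A \<in> bounded_ops" "\<And>f. A f = a f"
    by (rule bounded_op_exists[of a M]) (auto intro!: a_eq R_add R_scale a R_bound)
  have "A (F s) = F t" if "F \<in> combinations G" for F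
    unfolding A(2) by (rule a_eq) (use that in \<open>auto simp: R_def intro!: exI[of _ "\<lambda>_. F"]\<close>)
  then show ?thesis using that A(1) by blast
qed

text \<open>Proportional Gram matrices make the correspondence between two families a multiple of an isometry on
  linear combinations.\<close>

lemma operator_from_gram:
  fixes x y :: "'a \<Rightarrow> hardy2"
  assumes total: "\<And>f. (\<And>b. b \<in> S \<Longrightarrow> hinner f (x b) = 0) \<Longrightarrow> f = 0"
    and gram: "\<And>b c. b \<in> S \<Longrightarrow> c \<in> S \<Longrightarrow> hinner (y b) (y c) = of_real C * hinner (x b) (x c)"
    and C: "C > 0"
  obtains A :: hop where "A \<in> bounded_ops" "\<And>b. b \<in> S \<Longrightarrow> A (x b) = y b"
proof -
  define G where "G = (\<lambda>b (t::bool). if t then y b else x b) ` S"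
  have G1: "hinner (F True) (y c) = of_real C * hinner (F False) (x c)" if "c \<in> S" "F \<in> combinations G" for F c
    using that(2)
    by (induction rule: combinations.induct)
       (auto simp: G_def gram that(1) hinner_add_left hinner_hscale_left algebra_simps)
  have G2: "hinner (F True) (F' True) = of_real C * hinner (F False) (F' False)"
    if "F \<in> combinations G" "F' \<in> combinations G" for F F'
    using that(2)
    by (induction rule: combinations.induct)
       (auto simp: G_def G1[OF _ that(1)] hinner_add_right hinner_hscale_right algebra_simps)
  have nrm: "norm (F True) \<le> sqrt C * norm (F False)" if "F \<in> combinations G" for F
  proof -
    have "(norm (F True))\<^sup>2 = C * (norm (F False))\<^sup>2"
      using G2[OF that that] by (simp only: hinner_self_norm of_real_mult[symmetric] of_real_eq_iff)
    then have "(norm (F True))\<^sup>2 = (sqrt C * norm (F False))\<^sup>2" using C by (simp add: power_mult_distrib)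
    then show ?thesis using C by (simp add: power2_eq_iff_nonneg)
  qed
  obtain A where A: "A \<in> bounded_ops" "\<And>F. F \<in> combinations G \<Longrightarrow> A (F False) = F True"
  proof (rule operator_from_combinations[of G False True "sqrt C"])
    fix f assume "\<And>F. F \<in> G \<Longrightarrow> hinner f (F False) = 0"
    then show "f = 0" by (intro total) (force simp: G_def)
  qed (use nrm C in auto)
  have "A (x b) = y b" if "b \<in> S" for b
    using A(2)[OF combinations.gen, of "\<lambda>t. if t then y b else x b"] that by (simp add: G_def)
  then show ?thesis using that A(1) by blast
qed

section \<open>The half-plane picture\<close>

text \<open>\<open>W\<close> maps the disk to the right half-plane and \<open>\<zeta>\<close> to infinity; \<open>y\<close> translates a
  chosen horizontal line to the real axis. Multiplication by \<open>wt\<close> turns a function \<open>G\<close> on the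
  half-plane into the function \<open>wt z * G (W z)\<close> on the disk, in such a way that the Cauchy kernels
  \<open>1 / (w + b)\<close> have the inner products \<open>2 / (b + c)\<close>.\<close>

locale half_plane =
  fixes \<zeta> :: complex and y :: real
  assumes norm_zeta: "cmod \<zeta> = 1"
begin

definition W :: "complex \<Rightarrow> complex" where "W z = (\<zeta> + z) / (\<zeta> - z) - \<i> * of_real y"
definition wt :: "complex \<Rightarrow> complex" where "wt z = 2 * \<zeta> / (\<zeta> - z)"
definition Winv :: "complex \<Rightarrow> complex" where
  "Winv q = \<zeta> * (q + \<i> * of_real y - 1) / (q + \<i> * of_real y + 1)"

lemma zeta_nz: "\<zeta> \<noteq> 0" and zeta_cnj: "\<zeta> * cnj \<zeta> = 1"
  using norm_zeta complex_norm_square[of \<zeta>] by auto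

lemma zeta_minus_nz: "z \<in> ball 0 1 \<Longrightarrow> \<zeta> - z \<noteq> 0"
  using norm_zeta by auto

lemma wt_nz: "z \<in> ball 0 1 \<Longrightarrow> wt z \<noteq> 0"
  using zeta_minus_nz zeta_nz by (simp add: wt_def)

lemma wt_eq: "z \<in> ball 0 1 \<Longrightarrow> wt z = W z + \<i> * of_real y + 1"
  using zeta_minus_nz[of z] by (simp add: wt_def W_def field_simps)

lemma Re_W: "z \<in> ball 0 1 \<Longrightarrow> Re (W z) = (1 - (cmod z)\<^sup>2) / (cmod (\<zeta> - z))\<^sup>2"
proof -
  have n: "(Re \<zeta>)\<^sup>2 + (Im \<zeta>)\<^sup>2 = 1" using norm_zeta by (simp add: cmod_def)
  have "Re ((\<zeta> + z) / (\<zeta> - z)) = Re ((\<zeta> + z) * cnj (\<zeta> - z)) / (cmod (\<zeta> - z))\<^sup>2"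
    by (subst complex_div_cnj) (simp only: Re_divide_of_real of_real_power[symmetric])
  also have "Re ((\<zeta> + z) * cnj (\<zeta> - z)) = (Re \<zeta>)\<^sup>2 + (Im \<zeta>)\<^sup>2 - (cmod z)\<^sup>2"
    unfolding cmod_power2 by (simp add: algebra_simps power2_eq_square)
  finally show ?thesis by (simp add: W_def n)
qed

lemma Re_W_pos: "z \<in> ball 0 1 \<Longrightarrow> Re (W z) > 0"
  using zeta_minus_nz[of z] by (simp add: Re_W abs_square_less_1 zero_less_divide_iff)

lemma Winv_in_ball:
  assumes "Re q > 0" shows "Winv q \<in> ball 0 1"
proof -
  define Q where "Q = q + \<i> * of_real y"
  have "Re Q > 0" using assms by (simp add: Q_def)
  then have "(cmod (Q - 1))\<^sup>2 < (cmod (Q + 1))\<^sup>2" 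
    unfolding cmod_power2 by (simp add: power2_eq_square algebra_simps)
  then have "cmod (Q - 1) < cmod (Q + 1)" by (rule power_less_imp_less_base) simp
  then show ?thesis by (simp add: Winv_def Q_def[symmetric] norm_divide norm_mult norm_zeta divide_less_eq)
qed

lemma W_Winv:
  assumes "Re q > 0" shows "W (Winv q) = q"
proof -
  define Q where "Q = q + \<i> * of_real y"
  have "Re (Q + 1) \<noteq> 0" using assms by (simp add: Q_def)
  then have Q: "Q + 1 \<noteq> 0" by (metis zero_complex.sel(1))
  have "\<zeta> + Winv q = \<zeta> * (2 * Q) / (Q + 1)" "\<zeta> - Winv q = \<zeta> * 2 / (Q + 1)"
    unfolding Winv_def Q_def[symmetric] using Q by (simp_all add: field_simps)
  then have "(\<zeta> + Winv q) / (\<zeta> - Winv q) = Q" using Q zeta_nz by simp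
  then show ?thesis by (simp add: W_def Q_def)
qed

lemma Winv_W:
  assumes "z \<in> ball 0 1" shows "Winv (W z) = z"
proof -
  have nz: "\<zeta> - z \<noteq> 0" by (rule zeta_minus_nz[OF assms])
  have "W z + \<i> * of_real y - 1 = 2 * z / (\<zeta> - z)" "W z + \<i> * of_real y + 1 = 2 * \<zeta> / (\<zeta> - z)"
    using nz by (simp_all add: W_def field_simps)
  then show ?thesis using nz zeta_nz by (simp add: Winv_def)
qed

lemma wt_Winv: "Re q > 0 \<Longrightarrow> wt (Winv q) = q + \<i> * of_real y + 1"
  using wt_eq[OF Winv_in_ball] W_Winv by simp

lemma holomorphic_W: "W holomorphic_on ball 0 1"
  unfolding W_def by (intro holomorphic_intros) (use zeta_minus_nz in auto)

lemma holomorphic_wt: "wt holomorphic_on ball 0 1"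
  unfolding wt_def by (intro holomorphic_intros) (use zeta_minus_nz in auto)

subsection \<open>Cauchy kernels\<close>

lemma kernel_exists:
  assumes b: "b > 0"
  shows "\<exists>k. (\<forall>z\<in>ball 0 1. hval k z = wt z / (W z + of_real b))
    \<and> (\<forall>f. hinner f k = 2 * hval f (Winv (of_real b)) / wt (Winv (of_real b)))"
proof -
  define A where "A = of_real b - \<i> * of_real y"
  have pb: "Winv (of_real b) \<in> ball 0 1" using b by (intro Winv_in_ball) simp
  obtain k where k: "\<And>z. z \<in> ball 0 1 \<Longrightarrow> hval k z = 1 / (1 - cnj (Winv (of_real b)) * z)"
      "\<And>f. hinner f k = hval f (Winv (of_real b))"
    by (rule szego_kernel[OF pb]) blast
  have "Re (A + 1) \<noteq> 0" using b by (simp add: A_def)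
  then have A1: "A + 1 \<noteq> 0" by (metis zero_complex.sel(1))
  have cD: "cnj (Winv (of_real b)) = cnj \<zeta> * (A - 1) / (A + 1)" by (simp add: Winv_def A_def)
  have cwt: "cnj (wt (Winv (of_real b))) = A + 1" using b by (simp add: wt_Winv A_def)
  have "hval ((2 / (A + 1)) *\<^sub>h k) z = wt z / (W z + of_real b)" if z: "z \<in> ball 0 1" for z
  proof -
    have nz: "\<zeta> - z \<noteq> 0" by (rule zeta_minus_nz[OF z])
    define Y where "Y = (A + 1) - cnj \<zeta> * (A - 1) * z"
    have zY: "\<zeta> * Y = (\<zeta> + z) + A * (\<zeta> - z)"
    proof -
      have "\<zeta> * Y = \<zeta> * (A + 1) - (\<zeta> * cnj \<zeta>) * (A - 1) * z" by (simp add: Y_def algebra_simps)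
      then show ?thesis by (simp add: zeta_cnj algebra_simps)
    qed
    have "hval ((2 / (A + 1)) *\<^sub>h k) z = 2 / ((A + 1) * (1 - cnj \<zeta> * (A - 1) / (A + 1) * z))"
      by (simp add: hval_hscale k(1)[OF z] cD)
    also have "(A + 1) * (1 - cnj \<zeta> * (A - 1) / (A + 1) * z) = Y"
      using A1 by (simp add: Y_def right_diff_distrib)
    also have "2 / Y = 2 * \<zeta> / (\<zeta> * Y)" using zeta_nz by simp
    also have "\<dots> = wt z / (W z + of_real b)"
    proof -
      have "W z + of_real b = ((\<zeta> + z) + A * (\<zeta> - z)) / (\<zeta> - z)"
        using nz by (simp add: W_def A_def field_simps)
      then show ?thesis using nz by (simp add: zY wt_def)
    qed
    finally show ?thesis .
  qed
  moreover have "hinner f ((2 / (A + 1)) *\<^sub>h k) = 2 * hval f (Winv (of_real b)) / wt (Winv (of_real b))" for f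
  proof -
    have "cnj (2 / (A + 1)) = 2 / wt (Winv (of_real b))" by (simp add: cwt[symmetric])
    then show ?thesis by (simp add: hinner_hscale_right k(2))
  qed
  ultimately show ?thesis by blast
qed

definition ker :: "real \<Rightarrow> hardy2" where
  "ker b = (SOME k. (\<forall>z\<in>ball 0 1. hval k z = wt z / (W z + of_real b))
    \<and> (\<forall>f. hinner f k = 2 * hval f (Winv (of_real b)) / wt (Winv (of_real b))))"

lemma hval_ker: "b > 0 \<Longrightarrow> z \<in> ball 0 1 \<Longrightarrow> hval (ker b) z = wt z / (W z + of_real b)"
  and hinner_ker: "b > 0 \<Longrightarrow> hinner f (ker b) = 2 * hval f (Winv (of_real b)) / wt (Winv (of_real b))"
  using someI_ex[OF kernel_exists[of b]] unfolding ker_def[symmetric] by auto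

lemma hinner_ker_ker:
  assumes "b > 0" "c > 0"
  shows "hinner (ker b) (ker c) = of_real (2 / (b + c))"
proof -
  have "Winv (of_real c) \<in> ball 0 1" "W (Winv (of_real c)) = of_real c"
    using assms Winv_in_ball[of "of_real c"] W_Winv[of "of_real c"] by auto
  then show ?thesis using assms wt_nz[of "Winv (of_real c)"]
    by (simp add: hinner_ker hval_ker add.commute)
qed

text \<open>A function orthogonal to all kernels vanishes on an arc in the disk, hence everywhere.\<close>

lemma ker_total:
  assumes "\<And>b. b > 0 \<Longrightarrow> hinner f (ker b) = 0"
  shows "f = 0"
proof (rule hardy2_eq_iff_on_disk)
  have z: "hval f (Winv (of_real b)) = 0" if "b > 0" for b :: real
    using assms[OF that] that wt_nz[OF Winv_in_ball[of "of_real b"]] by (simp add: hinner_ker)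
  let ?S = "(\<lambda>b. Winv (of_real b)) ` {0<..}"
  have islim: "Winv 1 islimpt ?S"
    unfolding islimpt_sequential
  proof (intro exI conjI allI)
    let ?x = "\<lambda>n. Winv (of_real (1 + 1 / real (Suc n)))"
    show "?x n \<in> ?S - {Winv 1}" for n
    proof -
      have "Winv (of_real (1 + 1 / real (Suc n))) \<noteq> Winv 1"
      proof
        assume "Winv (of_real (1 + 1 / real (Suc n))) = Winv 1"
        then have "W (Winv (of_real (1 + 1 / real (Suc n)))) = W (Winv 1)" by simp
        then have "complex_of_real (1 + 1 / real (Suc n)) = complex_of_real 1"
          by (simp add: W_Winv add_pos_pos del: of_real_add)
        then show False by (simp only: of_real_eq_iff) simp
      qed
      then show ?thesis by (auto intro!: imageI add_pos_pos simp del: of_real_add)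
    qed
    have nz: "1 + \<i> * of_real y + 1 \<noteq> 0" by (simp add: complex_eq_iff)
    have l: "(\<lambda>n. complex_of_real (1 + 1 / real (Suc n))) \<longlonglongrightarrow> of_real (1 + 0)"
      by (intro tendsto_of_real tendsto_add tendsto_const LIMSEQ_Suc[OF lim_1_over_n])
    have "?x \<longlonglongrightarrow> Winv (of_real (1 + 0))"
      unfolding Winv_def by (intro tendsto_intros l) (use nz in simp)
    then show "?x \<longlonglongrightarrow> Winv 1" by simp
  qed
  show "hval f w = hval 0 w" if "w \<in> ball 0 1" for w
  proof -
    have "hval f w = 0"
    proof (rule analytic_continuation[OF hval_holomorphic, of ?S "Winv 1"])
      show "?S \<subseteq> ball 0 1" using Winv_in_ball by auto
      show "Winv 1 \<in> ball 0 1" by (rule Winv_in_ball) simp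
    qed (use that z islim in auto)
    then show ?thesis by simp
  qed
qed

lemma closed_subspace_ker_UNIV:
  assumes "hardy2.subspace S" "closed S" "\<And>b. b > 0 \<Longrightarrow> ker b \<in> S"
  shows "S = UNIV"
  by (rule closed_subspace_eq_UNIV[OF assms(1,2)]) (rule ker_total, use assms(3) in auto)

lemma ops_eqI:
  assumes "A \<in> bounded_ops" "B \<in> bounded_ops" "\<And>b. b > 0 \<Longrightarrow> A (ker b) = B (ker b)"
  shows "A = B"
proof -
  have "{f. A f = B f} = UNIV"
  proof (rule closed_subspace_ker_UNIV)
    show "hardy2.subspace {f. A f = B f}"
      by (auto simp: hardy2.subspace_def blinfun.add_right bounded_opsD[OF assms(1)] bounded_opsD[OF assms(2)])
    show "closed {f. A f = B f}" by (intro closed_Collect_eq continuous_intros)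
  qed (use assms(3) in auto)
  then show ?thesis by (intro blinfun_eqI) auto
qed

lemma adjoint_pairI:
  assumes A: "A \<in> bounded_ops" and B: "B \<in> bounded_ops"
    and eq: "\<And>b c. b > 0 \<Longrightarrow> c > 0 \<Longrightarrow> hinner (A (ker b)) (ker c) = hinner (ker b) (B (ker c))"
  shows "hinner (A f) g = hinner f (B g)"
proof -
  have "op_adjoint A = B"
  proof (rule ops_eqI[OF op_adjoint_in_bounded_ops[OF A] B])
    fix c :: real assume c: "c > 0"
    have "op_adjoint A (ker c) - B (ker c) = 0"
    proof (rule ker_total)
      fix b :: real assume b: "b > 0"
      have "hinner (ker b) (op_adjoint A (ker c) - B (ker c)) = 0"
        using eq[OF b c] by (simp add: hinner_diff_right hinner_op_adjoint[OF A, symmetric])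
      then show "hinner (op_adjoint A (ker c) - B (ker c)) (ker b) = 0" by (subst hinner_commute) simp
    qed
    then show "op_adjoint A (ker c) = B (ker c)" by simp
  qed
  then show ?thesis using hinner_op_adjoint[OF A] by simp
qed

lemma gram_scaledI:
  assumes A: "A \<in> bounded_ops"
    and eq: "\<And>b c. b > 0 \<Longrightarrow> c > 0 \<Longrightarrow> hinner (A (ker b)) (A (ker c)) = of_real C * hinner (ker b) (ker c)"
  shows "hinner (A f) (A g) = of_real C * hinner f g"
proof -
  have "hinner ((op_adjoint A o\<^sub>L A) f) g = hinner f (op_scale (of_real C) id_blinfun g)"
    by (rule adjoint_pairI)
       (use A in \<open>auto simp: compose_in_bounded_ops op_adjoint_in_bounded_ops op_scale_in_bounded_ops
          hinner_op_adjoint_left op_scale_apply hinner_hscale_right eq\<close>)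
  then show ?thesis by (simp add: hinner_op_adjoint_left[OF A] op_scale_apply hinner_hscale_right)
qed

text \<open>Point evaluations are continuous, so a weighted composition with an affine map of the half-plane is
  recognised by its values on the total family of kernels.\<close>

lemma affine_hval:
  assumes A: "A \<in> bounded_ops" and \<alpha>: "\<alpha> > 0" and s: "s \<ge> 0" and z: "z \<in> ball 0 1"
    and eq: "\<And>b. b > 0 \<Longrightarrow> hval (A (ker b)) z = c * wt z / (of_real \<alpha> * W z + of_real s + of_real b)"
  defines "z' \<equiv> Winv (of_real \<alpha> * W z + of_real s)"
  shows "hval (A f) z = c * wt z * (hval f z' / wt z')"
proof -
  have q: "Re (of_real \<alpha> * W z + of_real s) > 0" using Re_W_pos[OF z] \<alpha> s by (simp add: add_pos_nonneg)
  have z': "z' \<in> ball 0 1" and Wz': "W z' = of_real \<alpha> * W z + of_real s"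
    unfolding z'_def using Winv_in_ball[OF q] W_Winv[OF q] by auto
  let ?S = "{f. hval (A f) z = c * wt z * (hval f z' / wt z')}"
  have "?S = UNIV"
  proof (rule closed_subspace_ker_UNIV)
    show "hardy2.subspace ?S"
      by (auto simp: hardy2.subspace_def blinfun.add_right bounded_opsD[OF A] hval_add hval_hscale
          algebra_simps add_divide_distrib)
    have c: "continuous_on UNIV (\<lambda>f. hval f w)" for w
      by (rule linear_continuous_on[OF bounded_linear_hval])
    have "continuous_on UNIV (\<lambda>f. hval (A f) z)"
      by (rule linear_continuous_on[OF bounded_linear_compose[OF bounded_linear_hval blinfun.bounded_linear_right]])
    then show "closed ?S"
      by (intro closed_Collect_eq continuous_intros c) (use wt_nz[OF z'] in auto)
    show "ker b \<in> ?S" if "b > 0" for b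
      using eq[OF that] hval_ker[OF that z'] wt_nz[OF z'] by (simp add: Wz')
  qed
  then show ?thesis by blast
qed

subsection \<open>Translations\<close>

text \<open>If \<open>p 0\<close> exceeded \<open>a\<close>, the ratios \<open>p n / a\<close> would grow at least like iterated squares of a number
  larger than one.\<close>

lemma doubling_bound:
  fixes p :: "nat \<Rightarrow> real"
  assumes "\<And>n. 0 \<le> p n" "\<And>n. p n \<le> B" "\<And>n. (p n)\<^sup>2 \<le> p (Suc n) * a" "0 \<le> a"
  shows "p 0 \<le> a"
proof (cases "a = 0")
  case True
  then show ?thesis using assms(3)[of 0] by simp
next
  case False
  then have a: "a > 0" using assms(4) by simp
  show ?thesis
  proof (rule ccontr)
    assume "\<not> p 0 \<le> a"
    then have q: "p 0 / a > 1" using a by simp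
    have pw: "(p 0 / a) ^ (2 ^ n) \<le> p n / a" for n
    proof (induction n)
      case (Suc n)
      have "(p 0 / a) ^ (2 ^ Suc n) = ((p 0 / a) ^ (2 ^ n))\<^sup>2" by (simp add: power_mult[symmetric] mult.commute)
      also have "\<dots> \<le> (p n / a)\<^sup>2" using Suc q by (intro power_mono) auto
      also have "\<dots> \<le> p (Suc n) * a / a\<^sup>2" using assms(3)[of n] by (simp add: power_divide divide_right_mono)
      also have "\<dots> = p (Suc n) / a" using a by (simp add: power2_eq_square)
      finally show ?case .
    qed simp
    obtain n where n: "B / a < (p 0 / a) ^ n" using real_arch_pow[OF q] by blast
    have "(p 0 / a) ^ n \<le> (p 0 / a) ^ (2 ^ n)" using q by (intro power_increasing) (auto simp: less_imp_le)
    also have "\<dots> \<le> p n / a" by (rule pw)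
    also have "\<dots> \<le> B / a" using assms(2) a by (simp add: divide_right_mono)
    finally show False using n by simp
  qed
qed

text \<open>The maps \<open>ker b \<mapsto> ker (b + s)\<close> form a semigroup of formally self-adjoint operators with
  bounded orbits, whence \<open>\<parallel>F s\<parallel>\<^sup>2 = \<langle>F (2 s), F 0\<rangle> \<le> \<parallel>F (2 s)\<parallel> \<parallel>F 0\<parallel>\<close>. Iterating the
  doubling shows that they are contractions.\<close>

lemma translation_exists:
  assumes s: "s \<ge> 0"
  obtains P where "P \<in> bounded_ops" "\<And>b. b > 0 \<Longrightarrow> P (ker b) = ker (b + s)"
proof -
  define G where "G = (\<lambda>b t. ker (b + t)) ` {0<..}"
  have G1: "hinner (F t) (ker (c + u)) = hinner (F (t + u)) (ker c)"
    if "c > 0" "t \<ge> 0" "u \<ge> 0" "F \<in> combinations G" for F c t u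
    using that(4)
    by (induction rule: combinations.induct)
       (use that(1-3) in \<open>auto simp: G_def hinner_ker_ker hinner_add_left hinner_hscale_left algebra_simps\<close>)
  have G2: "hinner (F t) (F' u) = hinner (F (t + u)) (F' 0)"
    if "t \<ge> 0" "u \<ge> 0" "F \<in> combinations G" "F' \<in> combinations G" for F F' t u
    using that(4)
    by (induction rule: combinations.induct)
       (use that(1-3) in \<open>auto simp: G_def G1 hinner_add_right hinner_hscale_right\<close>)
  have bdd: "\<exists>B. \<forall>t\<ge>0. norm (F t) \<le> B" if "F \<in> combinations G" for F
    using that
  proof (induction rule: combinations.induct)
    case (gen F)
    then obtain b where b: "b > 0" "F = (\<lambda>t. ker (b + t))" by (auto simp: G_def)
    have "norm (F t) \<le> sqrt (1 / b)" if "t \<ge> 0" for t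
    proof -
      have "complex_of_real ((norm (F t))\<^sup>2) = of_real (2 / ((b + t) + (b + t)))"
        unfolding hinner_self_norm[symmetric] b(2) using b(1) that by (intro hinner_ker_ker) auto
      then have "(norm (F t))\<^sup>2 = 2 / ((b + t) + (b + t))" by (simp only: of_real_eq_iff)
      also have "\<dots> = 1 / (b + t)" using b(1) that by (simp add: field_simps)
      also have "\<dots> \<le> 1 / b" using b(1) that by (simp add: frac_le)
      finally show ?thesis by (rule real_le_rsqrt)
    qed
    then show ?case by blast
  next
    case (add F F')
    then obtain B B' where "\<forall>t\<ge>0. norm (F t) \<le> B" "\<forall>t\<ge>0. norm (F' t) \<le> B'" by blast
    then have "norm (F t + F' t) \<le> B + B'" if "t \<ge> 0" for t using that by (meson norm_add_rule_thm)
    then show ?case by blast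
  next
    case (scale F c)
    then obtain B where "\<forall>t\<ge>0. norm (F t) \<le> B" by blast
    then have "norm (c *\<^sub>h F t) \<le> cmod c * B" if "t \<ge> 0" for t using that by (simp add: norm_hscale mult_left_mono)
    then show ?case by blast
  qed auto
  have contr: "norm (F s) \<le> 1 * norm (F 0)" if F: "F \<in> combinations G" for F
  proof -
    obtain B where B: "\<And>t. t \<ge> 0 \<Longrightarrow> norm (F t) \<le> B" using bdd[OF F] by blast
    have "norm (F (2 ^ 0 * s)) \<le> norm (F 0)"
    proof (rule doubling_bound[of "\<lambda>n. norm (F (2 ^ n * s))" B])
      fix n
      let ?u = "2 ^ n * s"
      have u: "?u \<ge> 0" using s by simp
      have "(norm (F ?u))\<^sup>2 = cmod (hinner (F ?u) (F ?u))" by (simp add: hinner_self_norm norm_power)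
      also have "hinner (F ?u) (F ?u) = hinner (F (2 ^ Suc n * s)) (F 0)"
        using G2[OF u u F F] by (simp add: algebra_simps)
      also have "cmod \<dots> \<le> norm (F (2 ^ Suc n * s)) * norm (F 0)" by (rule cmod_hinner_le)
      finally show "(norm (F ?u))\<^sup>2 \<le> norm (F (2 ^ Suc n * s)) * norm (F 0)" .
    qed (use B s in auto)
    then show ?thesis by simp
  qed
  obtain P where P: "P \<in> bounded_ops" "\<And>F. F \<in> combinations G \<Longrightarrow> P (F 0) = F s"
  proof (rule operator_from_combinations[of G 0 s 1])
    fix f assume "\<And>F. F \<in> G \<Longrightarrow> hinner f (F 0) = 0"
    then show "f = 0" by (intro ker_total) (force simp: G_def)
  qed (use contr in auto)
  have "P (ker b) = ker (b + s)" if "b > 0" for b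
    using P(2)[OF combinations.gen, of "\<lambda>t. ker (b + t)"] that by (auto simp: G_def)
  then show ?thesis using that P(1) by blast
qed

definition translation :: "real \<Rightarrow> hop" where
  "translation s = (SOME P. P \<in> bounded_ops \<and> (\<forall>b>0. P (ker b) = ker (b + s)))"

lemma translation:
  assumes "s \<ge> 0"
  shows "translation s \<in> bounded_ops" "b > 0 \<Longrightarrow> translation s (ker b) = ker (b + s)"
proof -
  have "\<exists>P. P \<in> bounded_ops \<and> (\<forall>b>0. P (ker b) = ker (b + s))" using translation_exists[OF assms] by metis
  from someI_ex[OF this] show "translation s \<in> bounded_ops" "b > 0 \<Longrightarrow> translation s (ker b) = ker (b + s)"
    unfolding translation_def by auto
qed

lemma translation_self_adjoint: "s \<ge> 0 \<Longrightarrow> hinner (translation s f) g = hinner f (translation s g)"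
  by (rule adjoint_pairI) (auto simp: translation hinner_ker_ker algebra_simps)

lemma hval_translation:
  assumes "s \<ge> 0" "z \<in> ball 0 1"
  defines "z' \<equiv> Winv (W z + of_real s)"
  shows "hval (translation s f) z = wt z * (hval f z' / wt z')"
  using affine_hval[OF translation(1)[OF assms(1)], of 1 s z 1 f] assms
  by (simp add: translation hval_ker algebra_simps)

subsection \<open>Dilations\<close>

definition dilation :: "real \<Rightarrow> hop" where
  "dilation r = (SOME A. A \<in> bounded_ops \<and> (\<forall>b>0. A (ker b) = of_real (1 / sqrt r) *\<^sub>h ker (b / r)))"

lemma gram_dilated:
  assumes r: "r > 0" and bc: "b > 0" "c > 0"
  shows "hinner (of_real (1 / sqrt r) *\<^sub>h ker (b / r)) (of_real (1 / sqrt r) *\<^sub>h ker (c / r))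
    = of_real 1 * hinner (ker b) (ker c)"
proof -
  have bc': "b / r > 0" "c / r > 0" using r bc by auto
  have "hinner (of_real (1 / sqrt r) *\<^sub>h ker (b / r)) (of_real (1 / sqrt r) *\<^sub>h ker (c / r))
      = of_real ((1 / sqrt r) * (1 / sqrt r) * (2 / (b / r + c / r)))"
    by (simp only: hinner_hscale_left hinner_hscale_right hinner_ker_ker[OF bc']
        complex_cnj_complex_of_real of_real_mult[symmetric] mult.assoc)
  also have "(1 / sqrt r) * (1 / sqrt r) * (2 / (b / r + c / r)) = 2 / (b + c)"
    using r by (simp add: real_sqrt_mult_self add_divide_distrib[symmetric])
  finally show ?thesis using bc by (simp add: hinner_ker_ker)
qed

lemma dilation:
  assumes r: "r > 0"
  shows "dilation r \<in> bounded_ops" "b > 0 \<Longrightarrow> dilation r (ker b) = of_real (1 / sqrt r) *\<^sub>h ker (b / r)"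
proof -
  obtain A where "A \<in> bounded_ops" "\<And>b. b \<in> {0<..} \<Longrightarrow> A (ker b) = of_real (1 / sqrt r) *\<^sub>h ker (b / r)"
    by (rule operator_from_gram[of "{0<..}" ker "\<lambda>b. of_real (1 / sqrt r) *\<^sub>h ker (b / r)" 1])
       (use ker_total gram_dilated[OF r] in auto)
  then have "\<exists>A. A \<in> bounded_ops \<and> (\<forall>b>0. A (ker b) = of_real (1 / sqrt r) *\<^sub>h ker (b / r))"
    by auto
  from someI_ex[OF this]
  show "dilation r \<in> bounded_ops" "b > 0 \<Longrightarrow> dilation r (ker b) = of_real (1 / sqrt r) *\<^sub>h ker (b / r)"
    unfolding dilation_def by auto
qed

lemma norm_dilation:
  assumes r: "r > 0" shows "norm (dilation r f) = norm f"
proof -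
  have "hinner (dilation r f) (dilation r f) = of_real 1 * hinner f f"
    by (rule gram_scaledI[OF dilation(1)[OF r]]) (simp only: dilation(2)[OF r] gram_dilated[OF r])
  then have "(norm (dilation r f))\<^sup>2 = (norm f)\<^sup>2" by (simp only: hinner_self_norm of_real_1 mult_1 of_real_eq_iff)
  then show ?thesis by (simp add: power2_eq_iff_nonneg)
qed

lemma hval_dilation:
  assumes r: "r > 0" and z: "z \<in> ball 0 1"
  defines "z' \<equiv> Winv (of_real r * W z)"
  shows "hval (dilation r f) z = of_real (sqrt r) * wt z * (hval f z' / wt z')"
proof -
  have eq: "hval (dilation r (ker b)) z = of_real (sqrt r) * wt z / (of_real r * W z + of_real 0 + of_real b)"
    if b: "b > 0" for b
  proof -
    have "of_real r * W z + of_real b = of_real (sqrt r) * of_real (sqrt r) * (W z + of_real (b / r))"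
      using r by (simp only: of_real_mult[symmetric] real_sqrt_mult_self) (simp add: algebra_simps)
    then show ?thesis using r b z by (simp add: dilation hval_hscale hval_ker)
  qed
  show ?thesis using affine_hval[OF dilation(1)[OF r] r _ z eq, of f] by (simp add: z'_def)
qed

subsection \<open>Imaginary powers\<close>

abbreviation ipow :: "real \<Rightarrow> complex" where "ipow \<beta> \<equiv> - 1 - \<i> * of_real \<beta>"

lemma power_exists:
  assumes b: "b > 0"
  shows "\<exists>f. \<forall>z\<in>ball 0 1. hval f z = wt z * (W z + of_real b) powr (ipow \<beta>)"
proof -
  define g where "g z = wt z * (W z + of_real b) powr (ipow \<beta>)" for z
  have hol: "g holomorphic_on ball 0 1"
    unfolding g_def using b Re_W_pos
    by (intro holomorphic_intros holomorphic_wt holomorphic_W)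
       (force simp: complex_nonpos_Reals_iff)
  define e where "e = cmod (1 + \<i> * of_real y - of_real b)"
  \<comment> \<open>The argument of a complex number is bounded, so a purely imaginary power is too.\<close>
  have bound: "cmod (g z) \<le> (1 + e / b) * exp (\<bar>\<beta>\<bar> * pi)" if z: "z \<in> ball 0 1" for z
  proof -
    define q where "q = W z + of_real b"
    have Rq: "b \<le> Re q" using Re_W_pos[OF z] by (simp add: q_def)
    then have q: "b \<le> cmod q" using complex_Re_le_cmod[of q] by linarith
    then have qpos: "cmod q > 0" using b by linarith
    have "wt z = q + (1 + \<i> * of_real y - of_real b)" by (simp add: wt_eq[OF z] q_def)
    then have "cmod (wt z) \<le> cmod q + e" by (metis norm_triangle_ineq e_def)
    then have "cmod (wt z) / cmod q \<le> (cmod q + e) / cmod q"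
      by (rule divide_right_mono) simp
    also have "\<dots> = 1 + e / cmod q" using qpos by (simp add: add_divide_distrib)
    also have "\<dots> \<le> 1 + e / b"
      using q b by (intro add_left_mono divide_left_mono mult_pos_pos) (auto simp: e_def intro: qpos)
    finally have 1: "cmod (wt z) / cmod q \<le> 1 + e / b" .
    have "\<beta> * Arg q \<le> \<bar>\<beta>\<bar> * \<bar>Arg q\<bar>" by (metis abs_ge_self abs_mult)
    also have "\<dots> \<le> \<bar>\<beta>\<bar> * pi" using Arg_bounded[of q] by (intro mult_left_mono) auto
    finally have 2: "exp (\<beta> * Arg q) \<le> exp (\<bar>\<beta>\<bar> * pi)" by simp
    have "cmod (g z) = cmod (wt z) / cmod q * exp (\<beta> * Arg q)"
      using qpos by (simp add: g_def q_def[symmetric] norm_mult norm_powr_complex powr_minus_divide)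
    also have "\<dots> \<le> (1 + e / b) * exp (\<bar>\<beta>\<bar> * pi)"
      using 1 2 b by (intro mult_mono) (auto simp: e_def intro!: add_nonneg_nonneg divide_nonneg_nonneg)
    finally show ?thesis .
  qed
  obtain f where "\<And>z. z \<in> ball 0 1 \<Longrightarrow> hval f z = g z"
    by (rule hardy2_of_bounded[OF hol bound]) blast+
  then show ?thesis unfolding g_def by blast
qed

text \<open>The image of the kernel at \<open>b\<close> under multiplication by \<open>t powr (\<i> * \<beta>)\<close> on the Laplace transform
  side, up to the constant factor \<open>Gamma (1 + \<i> * \<beta>)\<close>. Omitting the factor makes the resulting
  operator a multiple of a unitary; \<open>gram_const\<close> below measures the multiple.\<close>

definition cpower :: "real \<Rightarrow> real \<Rightarrow> hardy2" where
  "cpower \<beta> b = (SOME f. \<forall>z\<in>ball 0 1. hval f z = wt z * (W z + of_real b) powr (ipow \<beta>))"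

lemma hval_power:
  "b > 0 \<Longrightarrow> z \<in> ball 0 1 \<Longrightarrow> hval (cpower \<beta> b) z = wt z * (W z + of_real b) powr (ipow \<beta>)"
  using someI_ex[OF power_exists[of b \<beta>]] unfolding cpower_def[symmetric] by blast

lemma powr_of_real_mult:
  "r > 0 \<Longrightarrow> q \<noteq> 0 \<Longrightarrow> (of_real r * q) powr s = of_real r powr s * q powr (s :: complex)"
  by (simp add: powr_def Ln_times_of_real[of r q] Ln_of_real exp_add[symmetric] distrib_left)

lemma translation_power:
  assumes s: "s \<ge> 0" and b: "b > 0"
  shows "translation s (cpower \<beta> b) = cpower \<beta> (b + s)"
proof (rule hardy2_eq_iff_on_disk)
  fix z :: complex assume z: "z \<in> ball 0 1"
  have q: "Re (W z + of_real s) > 0" using Re_W_pos[OF z] s by simp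
  show "hval (translation s (cpower \<beta> b)) z = hval (cpower \<beta> (b + s)) z"
    using hval_translation[OF s z, of "cpower \<beta> b"] hval_power[OF b Winv_in_ball[OF q], of \<beta>]
      wt_nz[OF Winv_in_ball[OF q]] hval_power[of "b + s" z \<beta>] b s z
    unfolding W_Winv[OF q] by (simp add: add_ac)
qed

text \<open>The dilation part of the affine map rescales the base of the power, which costs the scalar
  \<open>r powr (- 1 - \<i> * \<beta>)\<close>.\<close>

lemma affine_power:
  assumes A: "A \<in> bounded_ops" and r: "r > 0" and s: "s \<ge> 0" and b: "b > 0"
    and eq: "\<And>z f. z \<in> ball 0 1 \<Longrightarrow> hval (A f) z = c * wt z *
      (hval f (Winv (of_real r * W z + of_real s)) / wt (Winv (of_real r * W z + of_real s)))"
  shows "A (cpower \<beta> b) = (c * of_real r powr (ipow \<beta>)) *\<^sub>h cpower \<beta> ((s + b) / r)"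
proof (rule hardy2_eq_iff_on_disk)
  fix z :: complex assume z: "z \<in> ball 0 1"
  have q: "Re (of_real r * W z + of_real s) > 0" using Re_W_pos[OF z] r s by (simp add: add_pos_nonneg)
  have sb: "(s + b) / r > 0" using s b r by simp
  have nz: "W z + of_real ((s + b) / r) \<noteq> 0"
  proof
    assume "W z + of_real ((s + b) / r) = 0"
    then have "Re (W z) + (s + b) / r = 0" by (metis Re_complex_of_real plus_complex.sel(1) zero_complex.sel(1))
    then show False using Re_W_pos[OF z] sb by linarith
  qed
  have "of_real r * W z + of_real s + of_real b = of_real r * (W z + of_real ((s + b) / r))"
    using r by (simp add: field_simps)
  then have "(of_real r * W z + of_real s + of_real b) powr (ipow \<beta>)
      = of_real r powr (ipow \<beta>) * (W z + of_real ((s + b) / r)) powr (ipow \<beta>)"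
    by (simp only: powr_of_real_mult[OF r nz])
  then show "hval (A (cpower \<beta> b)) z
      = hval ((c * of_real r powr (ipow \<beta>)) *\<^sub>h cpower \<beta> ((s + b) / r)) z"
    using eq[OF z, of "cpower \<beta> b"] hval_power[OF b Winv_in_ball[OF q], of \<beta>] wt_nz[OF Winv_in_ball[OF q]]
    by (simp add: W_Winv[OF q] hval_hscale hval_power[OF sb z] mult_ac)
qed

definition gram_const :: "real \<Rightarrow> real" where "gram_const \<beta> = (norm (cpower \<beta> 1))\<^sup>2"

lemma norm_power_dilation:
  assumes b: "b > 0"
  shows "(norm (cpower \<beta> b))\<^sup>2 = gram_const \<beta> / b"
proof -
  have "dilation b (cpower \<beta> b) = (of_real (sqrt b) * of_real b powr (ipow \<beta>)) *\<^sub>h cpower \<beta> ((0 + b) / b)"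
    by (rule affine_power[OF dilation(1)[OF b] b]) (use hval_dilation[OF b] b in auto)
  then have "norm (cpower \<beta> b) = cmod (of_real (sqrt b) * of_real b powr (ipow \<beta>)) * norm (cpower \<beta> 1)"
    using norm_dilation[OF b, of "cpower \<beta> b"] b by (simp add: norm_hscale)
  also have "cmod (of_real (sqrt b) * of_real b powr (ipow \<beta>)) = sqrt b / b"
    using b by (simp add: norm_mult norm_powr_complex powr_minus_divide)
  finally have "(norm (cpower \<beta> b))\<^sup>2 = (sqrt b)\<^sup>2 / b\<^sup>2 * gram_const \<beta>"
    by (simp add: gram_const_def power_mult_distrib power_divide)
  then show ?thesis using b by (simp add: power2_eq_square)
qed

text \<open>Self-adjointness of the translations makes the inner product a function of the sum of the
  parameters, and the dilations make this function homogeneous. So the Gram matrix is proportional to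
  that of the kernels, and no integral has to be evaluated.\<close>

lemma gram_power:
  assumes "b > 0" "c > 0"
  shows "hinner (cpower \<beta> b) (cpower \<beta> c) = of_real (gram_const \<beta>) * hinner (ker b) (ker c)"
proof -
  have le: "hinner (cpower \<beta> b) (cpower \<beta> c) = of_real (2 * gram_const \<beta> / (b + c))" if c: "c > 0" "c \<le> b" for b c
  proof -
    define h where "h = (b - c) / 2"
    have h: "h \<ge> 0" "c + h > 0" using c by (auto simp: h_def intro: add_pos_nonneg)
    have "cpower \<beta> b = translation h (cpower \<beta> (c + h))"
      using translation_power[OF h] by (simp add: h_def field_simps)
    then have "hinner (cpower \<beta> b) (cpower \<beta> c) = hinner (cpower \<beta> (c + h)) (cpower \<beta> (c + h))"
      by (simp add: translation_self_adjoint[OF h(1)] translation_power[OF h(1) c(1)])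
    also have "\<dots> = of_real (gram_const \<beta> / (c + h))" by (simp only: hinner_self_norm norm_power_dilation[OF h(2)])
    also have "gram_const \<beta> / (c + h) = 2 * gram_const \<beta> / (b + c)" using c by (simp add: h_def field_simps)
    finally show ?thesis .
  qed
  have "hinner (cpower \<beta> b) (cpower \<beta> c) = of_real (2 * gram_const \<beta> / (b + c))"
  proof (cases "c \<le> b")
    case False
    then have "hinner (cpower \<beta> c) (cpower \<beta> b) = of_real (2 * gram_const \<beta> / (c + b))" using assms by (intro le) auto
    then show ?thesis by (subst hinner_commute) (simp add: add.commute)
  qed (use le assms in auto)
  also have "\<dots> = of_real (gram_const \<beta>) * of_real (2 / (b + c))" by (simp only: of_real_mult[symmetric]) simp
  finally show ?thesis by (simp only: hinner_ker_ker[OF assms])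
qed

text \<open>The argument of the point 2 + i is positive, so the imaginary power grows exponentially there.\<close>

lemma gram_const_growth:
  obtains M \<theta> where "M > 0" "\<theta> > 0" "\<And>\<beta>. M * exp (\<theta> * \<beta>) \<le> gram_const \<beta>"
proof -
  define p where "p = Winv (1 + \<i>)"
  have z: "p \<in> ball 0 1" and Wz: "W (p) = 1 + \<i>" using Winv_in_ball[of "1 + \<i>"] W_Winv[of "1 + \<i>"] by (auto simp: p_def)
  define q where "q = 2 + \<i>"
  have qnz: "cmod q > 0" by (simp add: q_def complex_eq_iff)
  obtain m where m: "m \<ge> 0" "\<And>f. cmod (hval f (p)) \<le> m * norm f" using hval_bound by blast
  have wpos: "cmod (wt (p)) > 0" using wt_nz[OF z] by simp
  have ev: "cmod (wt (p)) / cmod q * exp (\<beta> * Arg q) \<le> m * norm (cpower \<beta> 1)" for \<beta>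
  proof -
    have "W (p) + of_real 1 = q" by (simp add: Wz q_def)
    then show ?thesis using m(2)[of "cpower \<beta> 1"] hval_power[OF _ z, of 1 \<beta>] qnz
      by (simp add: norm_mult norm_powr_complex powr_minus_divide)
  qed
  have mpos: "m > 0"
  proof (rule ccontr)
    assume "\<not> m > 0"
    then have "m = 0" using m(1) by simp
    then have "cmod (wt (p)) / cmod q \<le> 0" using ev[of 0] by simp
    then show False using wpos qnz by (simp add: divide_le_0_iff)
  qed
  define k where "k = cmod (wt (p)) / cmod q / m"
  have k: "k > 0" using wpos qnz mpos by (simp add: k_def)
  show ?thesis
  proof (rule that[of "k\<^sup>2" "2 * Arg q"])
    show "2 * Arg q > 0" using Im_Ln_pos_lt[of q] Arg_eq_Im_Ln[of q] qnz by (simp add: q_def)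
    fix \<beta>
    have "k * exp (\<beta> * Arg q) \<le> norm (cpower \<beta> 1)" 
    proof -
      have "k * exp (\<beta> * Arg q) = (cmod (wt (p)) / cmod q * exp (\<beta> * Arg q)) / m" by (simp add: k_def)
      also have "\<dots> \<le> norm (cpower \<beta> 1)" using ev[of \<beta>] mpos by (subst pos_divide_le_eq) (auto simp: mult.commute)
      finally show ?thesis .
    qed
    then have "(k * exp (\<beta> * Arg q))\<^sup>2 \<le> gram_const \<beta>" unfolding gram_const_def using k by (intro power_mono) auto
    then show "k\<^sup>2 * exp (2 * Arg q * \<beta>) \<le> gram_const \<beta>"
      by (simp add: power_mult_distrib exp_double[symmetric] mult_ac)
  qed (use k in simp)
qed

lemma gram_const_pos: "gram_const \<beta> > 0"
  by (rule gram_const_growth) (meson exp_gt_zero less_le_trans mult_pos_pos)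

definition imag_power :: "real \<Rightarrow> hop" where
  "imag_power \<beta> = (SOME A. A \<in> bounded_ops \<and> (\<forall>b>0. A (ker b) = cpower \<beta> b))"

lemma imag_power: "imag_power \<beta> \<in> bounded_ops" "b > 0 \<Longrightarrow> imag_power \<beta> (ker b) = cpower \<beta> b"
proof -
  obtain A where "A \<in> bounded_ops" "\<And>b. b \<in> {0<..} \<Longrightarrow> A (ker b) = cpower \<beta> b"
    by (rule operator_from_gram[of "{0<..}" ker "cpower \<beta>" "gram_const \<beta>"])
       (use ker_total gram_power gram_const_pos in auto)
  then have "\<exists>A. A \<in> bounded_ops \<and> (\<forall>b>0. A (ker b) = cpower \<beta> b)" by auto
  from someI_ex[OF this] show "imag_power \<beta> \<in> bounded_ops" "b > 0 \<Longrightarrow> imag_power \<beta> (ker b) = cpower \<beta> b"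
    unfolding imag_power_def by auto
qed

lemma hinner_imag_power: "hinner (imag_power \<beta> f) (imag_power \<beta> g) = of_real (gram_const \<beta>) * hinner f g"
  by (rule gram_scaledI) (auto simp: imag_power gram_power)

lemma hinner_power_ker:
  assumes "b > 0" "c > 0"
  shows "hinner (cpower \<beta> b) (ker c) = 2 * of_real (b + c) powr (ipow \<beta>)"
proof -
  have "Winv (of_real c) \<in> ball 0 1" "W (Winv (of_real c)) = of_real c"
    using assms Winv_in_ball[of "of_real c"] W_Winv[of "of_real c"] by auto
  then show ?thesis using assms wt_nz[of "Winv (of_real c)"]
    by (simp add: hinner_ker hval_power add.commute)
qed

lemma imag_power_adjoint: "hinner (imag_power \<beta> f) g = hinner f (imag_power (- \<beta>) g)"
proof (rule adjoint_pairI)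
  fix b c :: real assume bc: "b > 0" "c > 0"
  have "cnj (of_real (b + c) powr (ipow (- \<beta>))) = of_real (b + c) powr (ipow \<beta>)"
  proof -
    have "cnj ((- 1 + \<i> * of_real \<beta>) * of_real (ln (b + c))) = (ipow \<beta>) * of_real (ln (b + c))"
      by (simp add: complex_eq_iff)
    then have "cnj (exp ((- 1 + \<i> * of_real \<beta>) * of_real (ln (b + c)))) = exp ((ipow \<beta>) * of_real (ln (b + c)))"
      by (simp only: exp_cnj)
    then show ?thesis using bc by (simp add: powr_def Ln_of_real del: of_real_add)
  qed
  then have "hinner (ker b) (cpower (- \<beta>) c) = 2 * of_real (b + c) powr (ipow \<beta>)"
    using bc by (subst hinner_commute) (simp add: hinner_power_ker add.commute)
  then show "hinner (imag_power \<beta> (ker b)) (ker c) = hinner (ker b) (imag_power (- \<beta>) (ker c))"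
    using bc by (simp add: imag_power hinner_power_ker)
qed (rule imag_power)+

lemma imag_power_inverse: "imag_power (- \<beta>) (imag_power \<beta> f) = of_real (gram_const \<beta>) *\<^sub>h f"
proof (rule hinner_ext)
  show "hinner (imag_power (- \<beta>) (imag_power \<beta> f)) g = hinner (of_real (gram_const \<beta>) *\<^sub>h f) g" for g
    using imag_power_adjoint[of "- \<beta>" "imag_power \<beta> f" g] hinner_imag_power[of \<beta> f g]
    by (simp add: hinner_hscale_left)
qed

lemma gram_const_minus: "gram_const (- \<beta>) = gram_const \<beta>"
proof -
  let ?f = "cpower \<beta> 1"
  have f: "?f = imag_power \<beta> (ker 1)" by (simp add: imag_power)
  have "of_real (gram_const (- \<beta>)) *\<^sub>h ?f = imag_power \<beta> (imag_power (- \<beta>) ?f)"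
    using imag_power_inverse[of "- \<beta>" ?f] by simp
  also have "\<dots> = of_real (gram_const \<beta>) *\<^sub>h ?f"
    unfolding f imag_power_inverse by (simp add: bounded_opsD[OF imag_power(1)])
  finally have "(gram_const (- \<beta>)) *\<^sub>R ?f = gram_const \<beta> *\<^sub>R ?f" by (simp only: hscale_of_real)
  moreover have "?f \<noteq> 0" using gram_const_pos[of \<beta>] by (auto simp: gram_const_def)
  ultimately show ?thesis by simp
qed

definition unitary_power :: "real \<Rightarrow> hop" where
  "unitary_power \<beta> = op_scale (of_real (1 / sqrt (gram_const \<beta>))) (imag_power \<beta>)"

lemma unitary_power_in_bounded_ops: "unitary_power \<beta> \<in> bounded_ops"
  unfolding unitary_power_def by (intro op_scale_in_bounded_ops imag_power)

lemma unitary_power_adjoint: "hinner (unitary_power \<beta> f) g = hinner f (unitary_power (- \<beta>) g)"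
  by (simp add: unitary_power_def op_scale_apply hinner_hscale_left hinner_hscale_right
      imag_power_adjoint gram_const_minus)

lemma unitary_power_inverse: "unitary_power (- \<beta>) (unitary_power \<beta> f) = f"
proof -
  have "(of_real (1 / sqrt (gram_const \<beta>)) * of_real (1 / sqrt (gram_const \<beta>)))
      * complex_of_real (gram_const \<beta>) = 1"
    using gram_const_pos[of \<beta>] by (simp only: of_real_mult[symmetric]) simp
  then show ?thesis
    by (simp only: unitary_power_def op_scale_apply bounded_opsD[OF imag_power(1)] gram_const_minus
        imag_power_inverse hardy2.scale_scale mult.assoc[symmetric] hardy2.scale_one)
qed

lemma norm_unitary_power: "norm (unitary_power \<beta> f) = norm f"
proof -
  have "hinner (unitary_power \<beta> f) (unitary_power \<beta> f) = hinner f f"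
    by (simp only: unitary_power_adjoint unitary_power_inverse)
  then have "(norm (unitary_power \<beta> f))\<^sup>2 = (norm f)\<^sup>2" by (simp only: hinner_self_norm of_real_eq_iff)
  then show ?thesis by (simp add: power2_eq_iff_nonneg)
qed

lemma weak_convergence_extend:
  fixes A :: "nat \<Rightarrow> hop"
  assumes A: "\<And>n. A n \<in> bounded_ops" "\<And>n f. norm (A n f) \<le> norm f"
    and ker: "\<And>b. b > 0 \<Longrightarrow> (\<lambda>n. hinner (A n (ker b)) g) \<longlonglongrightarrow> 0"
  shows "(\<lambda>n. hinner (A n f) g) \<longlonglongrightarrow> 0"
proof -
  let ?S = "{f. (\<lambda>n. hinner (A n f) g) \<longlonglongrightarrow> 0}"
  have "?S = UNIV"
  proof (rule closed_subspace_ker_UNIV)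
    show "hardy2.subspace ?S"
      unfolding hardy2.subspace_def
      by (auto simp: blinfun.add_right bounded_opsD[OF A(1)] hinner_add_left hinner_hscale_left
          intro: tendsto_add_zero tendsto_mult_right_zero)
    show "closed ?S"
    proof (rule closed_sequentiallyI)
      fix x l assume x: "\<And>k. x k \<in> ?S" and l: "x \<longlonglongrightarrow> l"
      have "(\<lambda>n. hinner (A n l) g) \<longlonglongrightarrow> 0"
      proof (rule LIMSEQ_I)
        fix e :: real assume e: "0 < e"
        define d where "d = e / (2 * (norm g + 1))"
        have gp: "norm g + 1 > 0" by (simp add: add_nonneg_pos)
        have d: "d > 0" using e gp by (simp add: d_def)
        obtain k where k: "norm (x k - l) < d" using LIMSEQ_D[OF l d] by blast
        have "(\<lambda>n. hinner (A n (x k)) g) \<longlonglongrightarrow> 0" using x[of k] by simp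
        then obtain N where N: "\<And>n. n \<ge> N \<Longrightarrow> cmod (hinner (A n (x k)) g) < e / 2"
          using LIMSEQ_D[of _ 0 "e/2"] e by fastforce
        have "cmod (hinner (A n l) g) < e" if "n \<ge> N" for n
        proof -
          have "A n l = A n (x k) + A n (l - x k)" by (simp add: blinfun.diff_right)
          then have "cmod (hinner (A n l) g) \<le> cmod (hinner (A n (x k)) g) + cmod (hinner (A n (l - x k)) g)"
            by (simp add: hinner_add_left norm_triangle_ineq)
          also have "cmod (hinner (A n (l - x k)) g) \<le> norm (A n (l - x k)) * norm g" by (rule cmod_hinner_le)
          also have "\<dots> \<le> d * (norm g + 1)"
            using k d A(2)[of n "l - x k"] by (intro mult_mono) (auto simp: norm_minus_commute)
          also have "\<dots> = e / 2" using gp by (simp only: d_def) (simp add: divide_simps)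
          finally show ?thesis using N[OF that] by simp
        qed
        then show "\<exists>N. \<forall>n\<ge>N. norm (hinner (A n l) g - 0) < e" by auto
      qed
      then show "l \<in> ?S" by simp
    qed
  qed (use ker in auto)
  then show ?thesis by blast
qed

text \<open>On kernels the normalising constant beats the inner products, which stay bounded; density
  extends the weak convergence to all vectors, in one argument and then, passing to the adjoints, in
  the other.\<close>

lemma unitary_power_weakly_null:
  assumes lim: "filterlim \<beta> at_top sequentially"
  shows "(\<lambda>n. hinner (unitary_power (\<beta> n) f) g) \<longlonglongrightarrow> 0"
proof -
  note bop = unitary_power_in_bounded_ops and nrm = eq_refl[OF norm_unitary_power]
  have kk: "(\<lambda>n. hinner (unitary_power (\<beta> n) (ker b)) (ker c)) \<longlonglongrightarrow> 0" if bc: "b > 0" "c > 0" for b c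
  proof -
    obtain M \<theta> where M: "M > 0" "\<theta> > 0" "\<And>\<beta>. M * exp (\<theta> * \<beta>) \<le> gram_const \<beta>" using gram_const_growth by blast
    have "filterlim (\<lambda>n. exp (\<theta> * \<beta> n)) at_top sequentially"
      by (rule filterlim_compose[OF exp_at_top filterlim_tendsto_pos_mult_at_top[OF tendsto_const M(2) lim]])
    then have "filterlim (\<lambda>n. M * exp (\<theta> * \<beta> n)) at_top sequentially"
      by (rule filterlim_tendsto_pos_mult_at_top[OF tendsto_const M(1)])
    then have "filterlim (\<lambda>n. gram_const (\<beta> n)) at_top sequentially"
      by (rule filterlim_at_top_mono) (use M(3) in simp)
    then have "filterlim (\<lambda>n. sqrt (gram_const (\<beta> n))) at_top sequentially"
      by (rule filterlim_compose[OF sqrt_at_top])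
    then have "(\<lambda>n. 2 / (b + c) / sqrt (gram_const (\<beta> n))) \<longlonglongrightarrow> 0"
      by (rule real_tendsto_divide_at_top[OF tendsto_const])
    moreover have "cmod (hinner (unitary_power (\<beta> n) (ker b)) (ker c)) = 2 / (b + c) / sqrt (gram_const (\<beta> n))" for n
    proof -
      have "cmod (of_real (b + c) powr (ipow (\<beta> n))) = 1 / (b + c)"
        using bc by (simp add: norm_powr_complex powr_minus_divide del: of_real_add)
      then show ?thesis using bc gram_const_pos[of "\<beta> n"]
        by (simp add: unitary_power_def op_scale_apply hinner_hscale_left imag_power hinner_power_ker
            norm_mult norm_divide del: of_real_add)
    qed
    ultimately have "(\<lambda>n. cmod (hinner (unitary_power (\<beta> n) (ker b)) (ker c))) \<longlonglongrightarrow> 0" by (simp only:)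
    then show ?thesis by (rule tendsto_norm_zero_cancel)
  qed
  have flip: "(\<lambda>n. hinner (unitary_power (- \<gamma> n) g) f) \<longlonglongrightarrow> 0"
    if "(\<lambda>n. hinner (unitary_power (\<gamma> n) f) g) \<longlonglongrightarrow> 0" for \<gamma> :: "nat \<Rightarrow> real" and f g
    using tendsto_cnj[OF that] by (simp add: unitary_power_adjoint hinner_commute[symmetric])
  have "(\<lambda>n. hinner (unitary_power (\<beta> n) f) (ker c)) \<longlonglongrightarrow> 0" if "c > 0" for c
    by (rule weak_convergence_extend[OF bop nrm kk[OF _ that]])
  from weak_convergence_extend[OF bop nrm flip[OF this]]
  have "(\<lambda>n. hinner (unitary_power (- \<beta> n) g) f) \<longlonglongrightarrow> 0" by blast
  from flip[of "\<lambda>n. - \<beta> n", OF this] show ?thesis by simp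
qed

subsection \<open>Affine composition operators commute with weakly null unitaries\<close>

text \<open>Composition with \<open>w \<mapsto> \<mu> w + a\<close> is a multiple of a translation followed by a dilation. It commutes
  with those imaginary powers for which the scalar produced by the dilation reduces to \<open>1 / \<mu>\<close>.\<close>

lemma affine_model:
  assumes lam: "\<mu> > 0" "\<mu> \<noteq> 1" and a: "a \<ge> 0"
  obtains U V X where "weakly_null_unitaries U V" "X \<in> bounded_ops" "\<And>n f. X (U n f) = U n (X f)"
    "\<And>f z. z \<in> ball 0 1 \<Longrightarrow> hval (X f) z = wt z *
        (hval f (Winv (of_real \<mu> * W z + of_real a)) / wt (Winv (of_real \<mu> * W z + of_real a)))"
proof -
  define X where "X = op_scale (of_real (1 / sqrt \<mu>)) (dilation \<mu> o\<^sub>L translation a)"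
  have Xb: "X \<in> bounded_ops"
    unfolding X_def using lam a by (intro op_scale_in_bounded_ops compose_in_bounded_ops dilation translation)
  have Xker: "X (ker b) = of_real (1 / \<mu>) *\<^sub>h ker ((a + b) / \<mu>)" if "b > 0" for b
  proof -
    have "X (ker b) = (of_real (1 / sqrt \<mu>) * of_real (1 / sqrt \<mu>)) *\<^sub>h ker ((a + b) / \<mu>)"
      using that lam a by (simp add: X_def op_scale_apply translation dilation add.commute)
    also have "of_real (1 / sqrt \<mu>) * of_real (1 / sqrt \<mu>) = complex_of_real (1 / \<mu>)"
      using lam by (simp only: of_real_mult[symmetric]) simp
    finally show ?thesis .
  qed
  have Xval: "hval (X f) z = 1 * wt z *
      (hval f (Winv (of_real \<mu> * W z + of_real a)) / wt (Winv (of_real \<mu> * W z + of_real a)))"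
    if z: "z \<in> ball 0 1" for f z
  proof (rule affine_hval[OF Xb lam(1) a z])
    fix b :: real assume b: "b > 0"
    have "(a + b) / \<mu> > 0" using a b lam by simp
    then have "hval (X (ker b)) z = of_real (1 / \<mu>) * (wt z / (W z + of_real ((a + b) / \<mu>)))"
      using b z by (simp only: Xker hval_hscale hval_ker)
    also have "\<dots> = wt z / (of_real \<mu> * (W z + of_real ((a + b) / \<mu>)))" by simp
    also have "of_real \<mu> * (W z + of_real ((a + b) / \<mu>)) = of_real \<mu> * W z + of_real a + of_real b"
      using lam by (simp add: field_simps)
    finally show "hval (X (ker b)) z = 1 * wt z / (of_real \<mu> * W z + of_real a + of_real b)" by simp
  qed
  \<comment> \<open>For these exponents the function t powr (i * \<beta>) is invariant under the dilation of t by \<mu>.\<close>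
  define \<beta> where "\<beta> n = 2 * pi / \<bar>ln \<mu>\<bar> * real n" for n
  have lnz: "ln \<mu> \<noteq> 0" using lam by simp
  have inv: "of_real \<mu> powr (ipow (\<beta> n)) = complex_of_real (1 / \<mu>)" for n
  proof -
    have "\<exists>k::int. \<beta> n * ln \<mu> = 2 * pi * of_int k"
    proof (cases "ln \<mu> > 0")
      case True
      then show ?thesis by (intro exI[of _ "int n"]) (simp add: \<beta>_def)
    next
      case False
      then show ?thesis using lnz by (intro exI[of _ "- int n"]) (simp add: \<beta>_def)
    qed
    then obtain k :: int where k: "\<beta> n * ln \<mu> = 2 * pi * of_int k" by blast
    have "of_real \<mu> powr (ipow (\<beta> n)) = exp (- of_real (ln \<mu>) - \<i> * of_real (\<beta> n * ln \<mu>))"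
      using lam by (simp add: powr_def Ln_of_real algebra_simps)
    also have "\<dots> = exp (- of_real (ln \<mu>)) * exp (- (\<i> * of_real (\<beta> n * ln \<mu>)))"
      by (simp add: exp_diff exp_minus divide_inverse)
    also have "exp (- (\<i> * of_real (\<beta> n * ln \<mu>))) = 1"
      unfolding k exp_eq_1 by (simp add: exI[of _ "- k"])
    also have "exp (- complex_of_real (ln \<mu>)) = of_real (1 / \<mu>)"
      using lam by (simp add: exp_minus exp_of_real divide_inverse)
    finally show ?thesis by simp
  qed
  have comm: "X (imag_power (\<beta> n) f) = imag_power (\<beta> n) (X f)" for n f
  proof -
    have "X o\<^sub>L imag_power (\<beta> n) = imag_power (\<beta> n) o\<^sub>L X"
    proof (rule ops_eqI)
      fix b :: real assume b: "b > 0"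
      have "X (cpower (\<beta> n) b) = (1 * of_real \<mu> powr (ipow (\<beta> n))) *\<^sub>h cpower (\<beta> n) ((a + b) / \<mu>)"
        by (rule affine_power[OF Xb lam(1) a b Xval])
      moreover have "(a + b) / \<mu> > 0" using a b lam by simp
      ultimately show "(X o\<^sub>L imag_power (\<beta> n)) (ker b) = (imag_power (\<beta> n) o\<^sub>L X) (ker b)"
        using b by (simp add: imag_power Xker inv bounded_opsD[OF imag_power(1)])
    qed (simp_all add: compose_in_bounded_ops Xb imag_power(1))
    then show ?thesis by (metis blinfun_apply_blinfun_compose)
  qed
  have lim: "filterlim \<beta> at_top sequentially"
    unfolding \<beta>_def using lnz
    by (intro filterlim_tendsto_pos_mult_at_top[OF tendsto_const] filterlim_real_sequentially) simp
  have "weakly_null_unitaries (\<lambda>n. unitary_power (\<beta> n)) (\<lambda>n. unitary_power (- \<beta> n))"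
  proof
    show "unitary_power (\<beta> n) (unitary_power (- \<beta> n) f) = f" for n f
      using unitary_power_inverse[of "- \<beta> n" f] by simp
  qed (rule unitary_power_in_bounded_ops unitary_power_inverse unitary_power_adjoint
      unitary_power_weakly_null[OF lim])+
  moreover have "X (unitary_power (\<beta> n) f) = unitary_power (\<beta> n) (X f)" for n f
    by (simp add: unitary_power_def op_scale_apply bounded_opsD[OF Xb] comm)
  ultimately show ?thesis using that Xb Xval by simp
qed

end

section \<open>Linear-fractional maps fixing a boundary point\<close>

text \<open>Conjugation by the Cayley map at \<open>\<zeta>\<close> moves the fixed point to infinity, so the conjugated map is
  affine; its slope is the reciprocal of the derivative of \<open>\<phi>\<close> at \<open>\<zeta>\<close>.\<close>

lemma linear_fractional_affine:
  assumes lf: "linear_fractional_self_map \<phi>" and zeta: "cmod \<zeta> = 1"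
    and fixed: "\<phi> \<zeta> = \<zeta>" and der: "deriv \<phi> \<zeta> \<noteq> 1"
  obtains \<mu> A where "\<mu> \<noteq> 0" "\<mu> \<noteq> 1" "\<phi> holomorphic_on ball 0 1"
    "\<And>z. z \<in> ball 0 1 \<Longrightarrow> (\<zeta> + \<phi> z) / (\<zeta> - \<phi> z) = \<mu> * ((\<zeta> + z) / (\<zeta> - z)) + A"
proof -
  obtain a b c d where \<phi>: "\<phi> = moebius a b c d" and nz: "\<And>z. z \<in> ball 0 1 \<Longrightarrow> c * z + d \<noteq> 0"
    and self: "\<phi> ` ball 0 1 \<subseteq> ball 0 1"
    using lf by (auto simp: linear_fractional_self_map_def)
  have val: "\<phi> z = (a * z + b) / (c * z + d)" for z by (simp add: \<phi> moebius_def)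
  have "\<zeta> \<noteq> 0" using zeta by auto
  then have nz\<zeta>: "c * \<zeta> + d \<noteq> 0" using fixed val[of \<zeta>] by auto
  then have e1: "b = \<zeta> * (c * \<zeta> + d) - a * \<zeta>" using fixed val[of \<zeta>] by (simp add: field_simps)
  define p where "p = a - \<zeta> * c"
  have minus: "\<zeta> - \<phi> z = p * (\<zeta> - z) / (c * z + d)" if "z \<in> ball 0 1" for z
  proof -
    have "\<zeta> - \<phi> z = (\<zeta> * (c * z + d) - (a * z + b)) / (c * z + d)"
      using nz[OF that] by (simp add: val diff_divide_distrib)
    also have "\<zeta> * (c * z + d) - (a * z + b) = p * (\<zeta> - z)" unfolding e1 p_def by (simp add: algebra_simps)
    finally show ?thesis .
  qed
  have pnz: "p \<noteq> 0"
  proof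
    assume "p = 0"
    then have "\<phi> 0 = \<zeta>" using minus[of 0] by simp
    moreover have "\<phi> 0 \<in> ball 0 1" by (rule subsetD[OF self]) simp
    ultimately show False using zeta by simp
  qed
  have "((\<lambda>z. (a * z + b) / (c * z + d)) has_field_derivative
      (a * (c * \<zeta> + d) - (a * \<zeta> + b) * c) / ((c * \<zeta> + d) * (c * \<zeta> + d))) (at \<zeta>)"
    using nz\<zeta> by (auto intro!: derivative_eq_intros)
  then have "deriv \<phi> \<zeta> = (a * (c * \<zeta> + d) - (a * \<zeta> + b) * c) / ((c * \<zeta> + d) * (c * \<zeta> + d))"
    using val by (intro DERIV_imp_deriv) (simp add: fun_eq_iff[symmetric] ext[of \<phi>, OF val])
  also have "a * (c * \<zeta> + d) - (a * \<zeta> + b) * c = p * (c * \<zeta> + d)" unfolding e1 p_def by (simp add: algebra_simps)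
  finally have "deriv \<phi> \<zeta> = p / (c * \<zeta> + d)" using nz\<zeta> by simp
  then have mu1: "(c * \<zeta> + d) / p \<noteq> 1" using der pnz nz\<zeta> by auto
  have "\<phi> holomorphic_on ball 0 1"
    unfolding ext[of \<phi>, OF val] by (intro holomorphic_intros) (use nz in auto)
  moreover have "(\<zeta> + \<phi> z) / (\<zeta> - \<phi> z) = (c * \<zeta> + d) / p * ((\<zeta> + z) / (\<zeta> - z)) + (d - a) / p"
    if z: "z \<in> ball 0 1" for z
  proof -
    have zz: "\<zeta> - z \<noteq> 0" using z zeta by auto
    have "\<zeta> + \<phi> z = (\<zeta> * (c * z + d) + (a * z + b)) / (c * z + d)"
      using nz[OF z] by (simp add: val add_divide_distrib)
    also have "\<zeta> * (c * z + d) + (a * z + b) = (c * \<zeta> + d) * (\<zeta> + z) + (d - a) * (\<zeta> - z)"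
      unfolding e1 by (simp add: algebra_simps)
    finally have "(\<zeta> + \<phi> z) / (\<zeta> - \<phi> z) = ((c * \<zeta> + d) * (\<zeta> + z) + (d - a) * (\<zeta> - z)) / (p * (\<zeta> - z))"
      using nz[OF z] by (simp add: minus[OF z])
    also have "\<dots> = (c * \<zeta> + d) / p * ((\<zeta> + z) / (\<zeta> - z)) + (d - a) / p"
    proof -
      have "(r * s + t * u) / (v * u) = r / v * (s / u) + t / v" if "u \<noteq> 0" "v \<noteq> 0" for r s t u v :: complex
        using that by (simp add: field_simps)
      then show ?thesis using pnz zz by blast
    qed
    finally show ?thesis .
  qed
  ultimately show ?thesis using that[of "(c * \<zeta> + d) / p" "(d - a) / p"] mu1 pnz nz\<zeta> by simp
qed

lemma affine_half_plane_self_map: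
  assumes "\<And>w. Re w > 0 \<Longrightarrow> Re (\<mu> * w + A) > 0"
  shows "Im \<mu> = 0" "Re \<mu> \<ge> 0" "Re A \<ge> 0"
proof -
  have h: "x * Re \<mu> - t * Im \<mu> + Re A > 0" if "x > 0" for x t
    using assms[of "Complex x t"] that by (simp add: algebra_simps)
  show im: "Im \<mu> = 0"
  proof (rule ccontr)
    assume "Im \<mu> \<noteq> 0"
    then show False using h[of 1 "(Re \<mu> + Re A) / Im \<mu>"] by simp
  qed
  show re: "Re \<mu> \<ge> 0"
  proof (rule ccontr)
    assume "\<not> Re \<mu> \<ge> 0"
    then have n: "Re \<mu> < 0" by simp
    have "(\<bar>Re A\<bar> + 1) / (- Re \<mu>) > 0" using n by (intro divide_pos_pos) auto
    from h[OF this, of 0] show False using n by simp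
  qed
  show "Re A \<ge> 0"
  proof (rule ccontr)
    assume "\<not> Re A \<ge> 0"
    then have n: "Re A < 0" by simp
    define x where "x = - Re A / (Re \<mu> + 1)"
    have x: "x > 0" unfolding x_def using n re by (intro divide_pos_pos) auto
    have "x * (Re \<mu> + 1) = - Re A" using re by (simp add: x_def)
    then show False using h[OF x, of 0] x by (simp add: distrib_left)
  qed
qed

text \<open>The affine map would be an automorphism of the half-plane if the real part of its constant term were
  zero. As its slope is not one, a vertical translation makes the constant real.\<close>

lemma half_plane_normal_form:
  assumes lf: "linear_fractional_self_map \<phi>" and na: "\<not> disk_automorphism \<phi>"
    and zeta: "cmod \<zeta> = 1" and fixed: "\<phi> \<zeta> = \<zeta>" and der: "deriv \<phi> \<zeta> \<noteq> 1"
  obtains \<mu> \<alpha> y where "\<mu> > 0" "\<mu> \<noteq> 1" "\<alpha> > 0" "\<phi> holomorphic_on ball 0 1"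
    "\<And>z. z \<in> ball 0 1 \<Longrightarrow> half_plane.W \<zeta> y (\<phi> z) = of_real \<mu> * half_plane.W \<zeta> y z + of_real \<alpha>"
proof -
  obtain \<nu> A where \<nu>: "\<nu> \<noteq> 0" "\<nu> \<noteq> 1" and hol: "\<phi> holomorphic_on ball 0 1"
    and aff: "\<And>z. z \<in> ball 0 1 \<Longrightarrow> (\<zeta> + \<phi> z) / (\<zeta> - \<phi> z) = \<nu> * ((\<zeta> + z) / (\<zeta> - z)) + A"
    by (rule linear_fractional_affine[OF lf zeta fixed der]) blast
  have self: "\<phi> z \<in> ball 0 1" if "z \<in> ball 0 1" for z
    using lf that unfolding linear_fractional_self_map_def by blast
  interpret H: half_plane \<zeta> 0 by unfold_locales (rule zeta)
  have HW: "H.W z = (\<zeta> + z) / (\<zeta> - z)" for z by (simp add: H.W_def)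
  have affH: "H.W (\<phi> z) = \<nu> * H.W z + A" if "z \<in> ball 0 1" for z unfolding HW by (rule aff[OF that])
  have pos: "Re (\<nu> * w + A) > 0" if "Re w > 0" for w
    using affH[OF H.Winv_in_ball[OF that]] H.Re_W_pos[OF self[OF H.Winv_in_ball[OF that]]] by (simp add: H.W_Winv[OF that])
  note half = affine_half_plane_self_map[OF pos]
  define \<mu> where "\<mu> = Re \<nu>"
  have \<nu>\<mu>: "\<nu> = of_real \<mu>" using half(1) by (simp add: \<mu>_def complex_eq_iff)
  have \<mu>: "\<mu> > 0" "\<mu> \<noteq> 1" using \<nu> half(2) by (auto simp: \<nu>\<mu> \<mu>_def[symmetric])
  have "Re A \<noteq> 0"
  proof
    assume A0: "Re A = 0"
    have \<phi>Winv: "\<phi> z = H.Winv (\<nu> * H.W z + A)" if "z \<in> ball 0 1" for z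
      using H.Winv_W[OF self[OF that]] affH[OF that] by simp
    let ?g = "\<lambda>w. H.Winv ((H.W w - A) / \<nu>)"
    have inv: "Re ((H.W w - A) / \<nu>) > 0" if "w \<in> ball 0 1" for w
      using H.Re_W_pos[OF that] \<mu> A0 by (simp add: \<nu>\<mu> Re_divide_of_real)
    have "bij_betw \<phi> (ball 0 1) (ball 0 1)"
    proof (rule bij_betw_byWitness[of _ ?g])
      show "\<forall>z\<in>ball 0 1. ?g (\<phi> z) = z" using affH \<nu>(1) H.Winv_W by simp
      show "\<forall>w\<in>ball 0 1. \<phi> (?g w) = w"
      proof
        fix w :: complex assume w: "w \<in> ball 0 1"
        show "\<phi> (?g w) = w"
          using \<phi>Winv[OF H.Winv_in_ball[OF inv[OF w]]] \<nu>(1) by (simp add: H.W_Winv[OF inv[OF w]] H.Winv_W[OF w])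
      qed
      show "\<phi> ` ball 0 1 \<subseteq> ball 0 1" using self by blast
      show "?g ` ball 0 1 \<subseteq> ball 0 1" using H.Winv_in_ball[OF inv] by blast
    qed
    then show False using na by (simp add: disk_automorphism_def)
  qed
  then have \<alpha>: "Re A > 0" using half(3) by simp
  define y where "y = Im A / (1 - \<mu>)"
  interpret Y: half_plane \<zeta> y by unfold_locales (rule zeta)
  have YW: "Y.W z = H.W z - \<i> * of_real y" for z by (simp add: Y.W_def HW)
  have "Y.W (\<phi> z) = of_real \<mu> * Y.W z + of_real (Re A)" if "z \<in> ball 0 1" for z
  proof -
    have "Im A = (1 - \<mu>) * y" using \<mu>(2) by (simp add: y_def)
    then have "A = of_real (Re A) + \<i> * (of_real ((1 - \<mu>) * y))" by (metis complex_eq)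
    then show ?thesis by (simp add: YW affH[OF that] \<nu>\<mu> algebra_simps)
  qed
  then show ?thesis using that \<mu> \<alpha> hol by blast
qed

lemma composition_op_eqI:
  assumes "\<And>f z. z \<in> ball 0 1 \<Longrightarrow> hval (blinfun_apply C f) z = hval f (\<phi> z)"
  shows "composition_op \<phi> = C"
  unfolding composition_op_def
proof (rule the_equality)
  fix C' :: hop assume "\<forall>f. \<forall>z\<in>ball 0 1. hval (C' f) z = hval f (\<phi> z)"
  then show "C' = C" by (intro blinfun_eqI hardy2_eq_iff_on_disk) (simp add: assms)
qed (use assms in simp)

text \<open>The difference between the composition operator and a multiple of the half-plane composition
  operator has a weight vanishing at the fixed point, and it is compact because the half-plane map
  keeps a positive distance from the imaginary axis.\<close>

lemma composition_op_essential_commutant: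
  assumes lf: "linear_fractional_self_map \<phi>" and na: "\<not> disk_automorphism \<phi>"
    and zeta: "cmod \<zeta> = 1" and fixed: "\<phi> \<zeta> = \<zeta>" and der: "deriv \<phi> \<zeta> \<noteq> 1"
  obtains U V where "weakly_null_unitaries U V"
    "composition_op \<phi> \<in> weakly_null_unitaries.essential_commutant U"
proof -
  obtain \<mu> \<alpha> y where \<mu>: "\<mu> > 0" "\<mu> \<noteq> 1" and \<alpha>: "\<alpha> > 0" and hol: "\<phi> holomorphic_on ball 0 1"
    and aff: "\<And>z. z \<in> ball 0 1 \<Longrightarrow> half_plane.W \<zeta> y (\<phi> z) = of_real \<mu> * half_plane.W \<zeta> y z + of_real \<alpha>"
    by (rule half_plane_normal_form[OF lf na zeta fixed der]) blast
  interpret half_plane \<zeta> y by unfold_locales (rule zeta)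
  have self: "\<phi> z \<in> ball 0 1" if "z \<in> ball 0 1" for z
    using lf that unfolding linear_fractional_self_map_def by blast
  obtain U V X where unit: "weakly_null_unitaries U V" and X: "X \<in> bounded_ops" "\<And>n f. X (U n f) = U n (X f)"
    and Xval: "\<And>f z. z \<in> ball 0 1 \<Longrightarrow> hval (X f) z = wt z *
        (hval f (Winv (of_real \<mu> * W z + of_real \<alpha>)) / wt (Winv (of_real \<mu> * W z + of_real \<alpha>)))"
    using affine_model[OF \<mu>, of \<alpha>] \<alpha> by (metis less_imp_le)
  interpret weakly_null_unitaries U V by (rule unit)
  define k where "k = of_real \<alpha> + 1 - of_real \<mu> + \<i> * of_real y * (1 - of_real \<mu>)"
  have split: "wt (\<phi> z) = of_real \<mu> * wt z + k" if z: "z \<in> ball 0 1" for z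
    by (simp add: wt_eq[OF z] wt_eq[OF self[OF z]] aff[OF z] k_def algebra_simps)
  define h where "h z = k / (2 * \<zeta>) * (\<zeta> - \<phi> z)" for z
  have h: "h z = k / wt (\<phi> z)" for z by (simp add: h_def wt_def)
  obtain K where K: "K \<in> compact_ops" "\<And>f z. z \<in> ball 0 1 \<Longrightarrow> hval (K f) z = h z * hval f (\<phi> z)"
  proof (rule weighted_composition_compact[of h \<phi> "(cmod k)\<^sup>2 / (4 * \<alpha>)"])
    show "h holomorphic_on ball 0 1" unfolding h_def using zeta_nz by (intro holomorphic_intros hol) auto
    fix z :: complex assume z: "z \<in> ball 0 1"
    show "\<phi> z \<in> ball 0 1" by (rule self[OF z])
    have "\<alpha> \<le> Re (W (\<phi> z))" using Re_W_pos[OF z] \<mu> by (simp add: aff[OF z])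
    also have "\<dots> = (1 - (cmod (\<phi> z))\<^sup>2) / (cmod (\<zeta> - \<phi> z))\<^sup>2" by (rule Re_W[OF self[OF z]])
    finally have "\<alpha> * (cmod (\<zeta> - \<phi> z))\<^sup>2 \<le> 1 - (cmod (\<phi> z))\<^sup>2"
      using zeta_minus_nz[OF self[OF z]] by (simp add: le_divide_eq)
    then have "(cmod k)\<^sup>2 / (4 * \<alpha>) * (\<alpha> * (cmod (\<zeta> - \<phi> z))\<^sup>2) \<le> (cmod k)\<^sup>2 / (4 * \<alpha>) * (1 - (cmod (\<phi> z))\<^sup>2)"
      using \<alpha> by (intro mult_left_mono) auto
    moreover have "(cmod (h z))\<^sup>2 = (cmod k)\<^sup>2 / (4 * \<alpha>) * (\<alpha> * (cmod (\<zeta> - \<phi> z))\<^sup>2)"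
      using \<alpha> by (simp add: h_def norm_mult norm_divide zeta power_mult_distrib power_divide)
    ultimately show "(cmod (h z))\<^sup>2 \<le> (cmod k)\<^sup>2 / (4 * \<alpha>) * (1 - (cmod (\<phi> z))\<^sup>2)" by simp
  qed (use hol in auto)
  have "composition_op \<phi> = op_scale (of_real \<mu>) X + K"
  proof (rule composition_op_eqI)
    fix f and z :: complex assume z: "z \<in> ball 0 1"
    have "Winv (of_real \<mu> * W z + of_real \<alpha>) = \<phi> z" using Winv_W[OF self[OF z]] by (simp add: aff[OF z])
    then have "hval ((op_scale (of_real \<mu>) X + K) f) z = (of_real \<mu> * wt z + k) / wt (\<phi> z) * hval f (\<phi> z)"
      by (simp add: blinfun.add_left hval_add op_scale_apply hval_hscale Xval[OF z] K(2)[OF z] h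
          add_divide_distrib distrib_right)
    also have "\<dots> = hval f (\<phi> z)" using wt_nz[OF self[OF z]] by (simp add: split[OF z, symmetric])
    finally show "hval ((op_scale (of_real \<mu>) X + K) f) z = hval f (\<phi> z)" .
  qed
  moreover have "op_scale (of_real \<mu>) X \<in> commutant"
    using X by (auto simp: commutant_def op_scale_in_bounded_ops op_scale_apply bounded_opsD[OF U])
  ultimately have "composition_op \<phi> \<in> essential_commutant" using K(1) by (auto simp: essential_commutant_def)
  then show ?thesis using that[OF unit] by blast
qed

theorem corollary5p2:
  fixes \<zeta> :: complex and \<phi> :: "complex \<Rightarrow> complex" and T :: hop
  assumes "\<zeta> \<in> sphere 0 1"
    and "linear_fractional_self_map \<phi>"
    and "\<not> disk_automorphism \<phi>"
    and "\<phi> \<zeta> = \<zeta>"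
    and "deriv \<phi> \<zeta> \<noteq> 1"
    and "T \<in> cstar_generated (insert (composition_op \<phi>) compact_ops)"
    and "fredholm T"
  shows "fredholm_index T = 0"
proof -
  have "cmod \<zeta> = 1" using assms(1) by simp
  then obtain U V where unit: "weakly_null_unitaries U V"
    and C: "composition_op \<phi> \<in> weakly_null_unitaries.essential_commutant U"
    using composition_op_essential_commutant assms(2-5) by blast
  interpret weakly_null_unitaries U V by (rule unit)
  have "K \<in> essential_commutant" if "K \<in> compact_ops" for K
  proof -
    have "0 \<in> commutant" by (simp add: commutant_def bounded_ops_def)
    moreover have "K = 0 + K" by simp
    ultimately show ?thesis unfolding essential_commutant_def using that by blast
  qed
  then have "insert (composition_op \<phi>) compact_ops \<subseteq> essential_commutant" using C by blast
  then have "cstar_generated (insert (composition_op \<phi>) compact_ops) \<subseteq> essential_commutant"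
    unfolding cstar_generated_def using unital_cstar_algebra_essential_commutant by blast
  then show ?thesis using fredholm_index_essential_commutant assms(6,7) by blast
qed

end
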